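(* Let $c>1$ and $p,q,r\ge0$ with $p+q+r=1$. Assume $0<r<p$. Then $\mu^{(k)}\in ID^0$ for all $k\in\mathbb{Z}$ if and only if either (a) $r^2>p^2q$, or (b) $p^2q^2<r^2\le p^2q$ and $c^m\ne2$ for all $m\in\mathbb{N}=\{1,2,\ldots\}$.
   Context: For $k\in\mathbb{Z}$ let $\{(N_t^{(k)},L_t^{(k)}),t\ge0\}$ be the bivariate compound Poisson process (pure jump, no drift) with $E[e^{i(z_1N_t^{(k)}+z_2L_t^{(k)})}]=\exp[t\int_{\mathbb{R}^2}(e^{i(z_1x_1+z_2x_2)}-1)\nu^{(k)}(dx)]$, where $\nu^{(k)}$ is concentrated on the points $(1,0)$, $(0,1)$, $(1,c^{-k})$ with masses $u,v,w\ge0$ respectively, and $p=u/(u+v+w)$, $q=v/(u+v+w)$, $r=w/(u+v+w)$. Define $\mu^{(k)}$ as the distribution of $\int_0^{\infty-}c^{-N^{(k)}_{s-}}\,dL_s^{(k)}$ (the almost sure limit of $\int_0^t$ as $t\to\infty$, which exists). It depends on $u,v,w$ only through $p,q,r$. A distribution $\sigma$ on $\mathbb{R}$ is quasi-infinitely divisible if its characteristic function is $\widehat\sigma(z)=\exp[i\gamma z-az^2+\int_{\mathbb{R}}(e^{izx}-1-izx1_{[-1,1]}(x))\,\nu_\sigma(dx)]$, where $\gamma,a\in\mathbb{R}$ and $\nu_\sigma$ is a signed measure (a difference $\nu_\sigma^+-\nu_\sigma^-$ of mutually singular measures, possibly both of infinite mass near $0$) with total variation measure $|\nu_\sigma|$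 satisfying $\nu_\sigma(\{0\})=0$ and $\int(x^2\wedge1)\,|\nu_\sigma|(dx)<\infty$. $ID^0$ is the class of quasi-infinitely divisible distributions on $\mathbb{R}$ that are not infinitely divisible. *)

theory Defs
  imports "HOL-Probability.Probability"
begin

section \<open>Infinitely and quasi-infinitely divisible distributions\<close>

definition infinitely_divisible :: "real measure \<Rightarrow> bool" where
  "infinitely_divisible \<sigma> \<longleftrightarrow> real_distribution \<sigma> \<and>
     (\<forall>n\<ge>1. \<exists>\<rho>. real_distribution \<rho> \<and> \<sigma> = ((\<lambda>\<tau>. \<rho> \<star> \<tau>) ^^ n) (return borel 0))"

definition mutually_singular :: "real measure \<Rightarrow> real measure \<Rightarrow> bool" where
  "mutually_singular \<mu> \<nu> \<longleftrightarrow>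
     (\<exists>A\<in>sets borel. emeasure \<mu> A = 0 \<and> emeasure \<nu> (- A) = 0)"

text \<open>
  Both parts of \<open>\<nu>\<^sub>\<sigma> = \<nu>p - \<nu>n\<close> may have infinite mass near 0, so the signed measure is carried by
  the pair of its mutually singular parts; its total variation measure is \<open>\<nu>p + \<nu>n\<close>, and an
  integral against it is the difference of two integrals. Under the integrability
  condition the compensated exponential is integrable against both parts.
\<close>

definition quasi_levy_measure :: "real measure \<Rightarrow> real measure \<Rightarrow> bool" where
  "quasi_levy_measure \<nu>p \<nu>n \<longleftrightarrow>
     sets \<nu>p = sets borel \<and> sets \<nu>n = sets borel \<and> mutually_singular \<nu>p \<nu>n \<and>
     emeasure \<nu>p {0} + emeasure \<nu>n {0} = 0 \<and>
     (\<integral>\<^sup>+x. ennreal (min (x\<^sup>2) 1) \<partial>\<nu>p) + (\<integral>\<^sup>+x. ennreal (min (x\<^sup>2) 1) \<partial>\<nu>n) < \<infinity>"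

definition compensated_exp :: "real \<Rightarrow> real \<Rightarrow> complex" where
  "compensated_exp z x =
     iexp (z * x) - 1 - \<i> * complex_of_real (z * x * indicator {-1..1} x)"

definition quasi_infinitely_divisible :: "real measure \<Rightarrow> bool" where
  "quasi_infinitely_divisible \<sigma> \<longleftrightarrow> real_distribution \<sigma> \<and>
     (\<exists>\<gamma> a \<nu>p \<nu>n. quasi_levy_measure \<nu>p \<nu>n \<and>
        (\<forall>z. char \<sigma> z =
           exp (\<i> * complex_of_real (\<gamma> * z) - complex_of_real (a * z\<^sup>2)
                + ((CLINT x|\<nu>p. compensated_exp z x) - (CLINT x|\<nu>n. compensated_exp z x)))))"

definition ID0 :: "real measure set" where
  "ID0 = {\<sigma>. quasi_infinitely_divisible \<sigma> \<and> \<not> infinitely_divisible \<sigma>}"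


section \<open>Compound Poisson processes\<close>

text \<open>Processes have time set \<open>[0, \<infinity>)\<close>; their values at negative times are irrelevant.\<close>

definition levy_process :: "'a measure \<Rightarrow> (real \<Rightarrow> 'a \<Rightarrow> 'b::euclidean_space) \<Rightarrow> bool" where
  "levy_process M Z \<longleftrightarrow> prob_space M \<and>
     (\<forall>t\<ge>0. Z t \<in> borel_measurable M) \<and>
     (AE \<omega> in M. Z 0 \<omega> = 0) \<and>
     (\<forall>n (t :: nat \<Rightarrow> real). 0 \<le> t 0 \<longrightarrow> mono t \<longrightarrow>
        prob_space.indep_vars M (\<lambda>_. borel) (\<lambda>i \<omega>. Z (t (Suc i)) \<omega> - Z (t i) \<omega>) {..<n}) \<and>
     (\<forall>s\<ge>0. \<forall>t\<ge>0. distr M borel (\<lambda>\<omega>. Z (s + t) \<omega> - Z s \<omega>) = distr M borel (Z t)) \<and>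
     (\<forall>t\<ge>0. \<forall>\<epsilon>>0.
        ((\<lambda>s. measure M {\<omega> \<in> space M. dist (Z s \<omega>) (Z t \<omega>) > \<epsilon>}) \<longlongrightarrow> 0) (at t within {0..})) \<and>
     (AE \<omega> in M. \<forall>t\<ge>0. continuous (at_right t) (\<lambda>s. Z s \<omega>) \<and>
        (t > 0 \<longrightarrow> (\<exists>l. ((\<lambda>s. Z s \<omega>) \<longlongrightarrow> l) (at_left t))))"

definition compound_poisson_process ::
  "'a measure \<Rightarrow> (real \<Rightarrow> 'a \<Rightarrow> 'b::euclidean_space) \<Rightarrow> 'b measure \<Rightarrow> bool" where
  "compound_poisson_process M Z \<nu> \<longleftrightarrow> levy_process M Z \<and>
     sets \<nu> = sets borel \<and> finite_measure \<nu> \<and> emeasure \<nu> {0} = 0 \<and>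
     (\<forall>t\<ge>0. \<forall>z. (CLINT \<omega>|M. iexp (z \<bullet> Z t \<omega>)) =
        exp (complex_of_real t * (CLINT x|\<nu>. iexp (z \<bullet> x) - 1)))"

definition jump_measure :: "real \<Rightarrow> real \<Rightarrow> real \<Rightarrow> real \<Rightarrow> int \<Rightarrow> (real \<times> real) measure" where
  "jump_measure c u v w k = measure_of UNIV (sets borel)
     (\<lambda>A. ennreal u * indicator A (1, 0) + ennreal v * indicator A (0, 1)
          + ennreal w * indicator A (1, c powi (- k)))"

lemma sets_jump_measure: "sets (jump_measure c u v w k) = sets borel"
  unfolding jump_measure_def
  using sets.sets_measure_of_eq[of "borel :: (real \<times> real) measure"] by simp

lemma emeasure_jump_measure:
  assumes "A \<in> sets borel"
  shows "emeasure (jump_measure c u v w k) A =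
    ennreal u * indicator A (1, 0) + ennreal v * indicator A (0, 1)
      + ennreal w * indicator A (1, c powi (- k))"
proof (rule emeasure_measure_of[OF jump_measure_def])
  show "A \<in> sets (jump_measure c u v w k)"
    using assms by (simp add: sets_jump_measure)
  show "countably_additive (sets (jump_measure c u v w k))
    (\<lambda>A. ennreal u * indicator A (1, 0) + ennreal v * indicator A (0, 1)
      + ennreal w * indicator A (1, c powi (- k)))"
    unfolding countably_additive_def
    by (auto simp: suminf_add[symmetric] ennreal_suminf_cmult suminf_indicator)
qed (auto simp: positive_def)


section \<open>The distribution of the stochastic integral\<close>

text \<open>
  For a process without drift whose jumps are nonnegative in the second coordinate \<open>L\<close>, almost
  every path of \<open>L\<close> is nondecreasing and right-continuous, so the integral with respect to \<open>dL\<close> is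
  the pathwise Lebesgue--Stieltjes integral, taken over \<open>(0, t]\<close>. The term \<open>max 0 s\<close> extends the
  path by its initial value to negative times.
\<close>

definition exp_functional ::
  "real \<Rightarrow> (real \<Rightarrow> 'a \<Rightarrow> real) \<Rightarrow> (real \<Rightarrow> 'a \<Rightarrow> real) \<Rightarrow> real \<Rightarrow> 'a \<Rightarrow> real" where
  "exp_functional c N L t \<omega> =
     (LINT s:{0<..t}|interval_measure (\<lambda>s. L (max 0 s) \<omega>).
        c powr (- Lim (at_left s) (\<lambda>s'. N s' \<omega>)))"

text \<open>
  The measure \<open>\<mu>\<close> is the law of the almost sure limit of \<open>exp_functional c N L t\<close> as \<open>t\<close> tends to
  infinity. The limit is only determined up to a null set, hence the choice of a measurable version.
\<close>

definition exp_functional_law ::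
  "'a measure \<Rightarrow> real \<Rightarrow> (real \<Rightarrow> 'a \<Rightarrow> real) \<Rightarrow> (real \<Rightarrow> 'a \<Rightarrow> real) \<Rightarrow> real measure \<Rightarrow> bool" where
  "exp_functional_law M c N L \<mu> \<longleftrightarrow>
     (\<exists>X\<in>borel_measurable M.
        (AE \<omega> in M. ((\<lambda>t. exp_functional c N L t \<omega>) \<longlongrightarrow> X \<omega>) at_top) \<and> \<mu> = distr M borel X)"

end

theory Submission
  imports Defs
begin

text \<open>
  Write \<open>a = r / p\<close> and \<open>\<kappa> = c powi (- k)\<close>. Decomposing the integral at the first step of length \<open>h\<close> and
  letting \<open>h\<close> tend to 0 gives \<open>\<phi> z = \<phi> (z / c) (p + r e\<^sup>i\<^sup>\<kappa>\<^sup>z) / (1 - q e\<^sup>i\<^sup>z)\<close> for the characteristic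
  function. Expanding both logarithms, which is where \<open>r < p\<close> enters, and iterating, the law has a signed
  Levy measure with atoms \<open>q\<^sup>m / m\<close> at \<open>m / c\<^sup>n\<close> and \<open>- (- a)\<^sup>m / m\<close> at \<open>m \<kappa> / c\<^sup>n\<close>,
  \<open>m \<ge> 1\<close>, \<open>n \<ge> 0\<close>. It is always quasi-infinitely divisible, and infinitely divisible iff no
  point carries negative net mass. The negative atoms, those of even \<open>m\<close> in the second series, are
  covered for \<open>k = 0\<close> if \<open>a \<le> q\<close>, and for \<open>k = l\<close> if \<open>c\<^sup>l = 2\<close> and \<open>a\<^sup>2 \<le> q\<close>, since
  then index \<open>2 m\<close> of the second series meets index \<open>m\<close> of the first. In all other cases the net mass at
  a suitable point is negative, because coincidences only involve terms of smaller order.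
\<close>

section \<open>Poisson series and infinite divisibility\<close>

text \<open>The process is given by its increments and its path regularity, without a sequence of
  jump times to condition on. Hence the recursion is derived on dyadic grids: the characteristic
  functions of Riemann sums follow an Euler scheme with error o(h) per step, and monotonicity of the
  sums controls their change over one unit of time. The mesh tends to 0 while that unit is fixed; as
  the integer time then tends to infinity, increments over a unit vanish, which forces the generator
  term to be zero.

  Infinite divisibility is defined by convolution roots, so it does not come with a positive Levy
  measure to compare with. Instead the explicit signed exponent is shown to be conditionally
  positive definite, and trigonometric test functions isolate its mass at a single point.

  Atoms form an indexed family in which several indices may share a site; coincidences are resolved
  only when net masses are taken. Summability of \<open>g i * x i\<close> controls all series and
  permits the uncompensated \<open>iexp (z * x i) - 1\<close> even when the total mass is
  infinite.\<close>

definition levy_exponent :: "('i \<Rightarrow> real) \<Rightarrow> ('i \<Rightarrow> real) \<Rightarrow> real \<Rightarrow> complex" where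
  "levy_exponent g x z = (\<Sum>\<^sub>\<infinity>i. complex_of_real (g i) * (iexp (z * x i) - 1))"

lemma norm_iexp_minus_1: "cmod (iexp t - 1) \<le> \<bar>t\<bar>"
  using iexp_approx1[of t 0] by simp

lemma norm_iexp_minus_1': "cmod (iexp t - 1) \<le> 2"
  using norm_triangle_ineq4[of "iexp t" 1] by simp

lemma norm_iexp_diff: "cmod (iexp s - iexp t) \<le> \<bar>s - t\<bar>"
proof -
  have "iexp s - iexp t = iexp t * (iexp (s - t) - 1)"
    by (simp add: algebra_simps flip: exp_add)
  then have "cmod (iexp s - iexp t) = cmod (iexp (s - t) - 1)"
    by (simp add: norm_mult)
  then show ?thesis
    using norm_iexp_minus_1[of "s - t"] by simp
qed

lemma has_sum_diff:
  fixes f h :: "'i \<Rightarrow> 'b::real_normed_vector"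
  assumes "(f has_sum a) A" "(h has_sum b) A"
  shows "((\<lambda>i. f i - h i) has_sum a - b) A"
  using has_sum_add[OF assms(1), of "\<lambda>i. - h i" "- b"] assms(2) by (simp add: has_sum_uminus)

text \<open>For real \<open>h\<close>, \<open>summable_on\<close> already means absolute
  convergence, so a bound by a multiple of \<open>\<bar>h i\<bar>\<close> gives norm summability. In
  most applications \<open>h i\<close> is \<open>g i * x i\<close>.\<close>

lemma abs_summable_comparison:
  fixes f :: "'i \<Rightarrow> 'b::banach" and h :: "'i \<Rightarrow> real"
  assumes "h summable_on A" "\<And>i. i \<in> A \<Longrightarrow> norm (f i) \<le> C * \<bar>h i\<bar>"
  shows "(\<lambda>i. norm (f i)) summable_on A" "f summable_on A"
proof -
  have "(\<lambda>i. \<bar>h i\<bar>) summable_on A"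
    using assms(1) summable_on_iff_abs_summable_on_real[of h A] by simp
  then have "(\<lambda>i. C * \<bar>h i\<bar>) summable_on A"
    by (rule summable_on_cmult_right)
  then show *: "(\<lambda>i. norm (f i)) summable_on A"
    by (rule summable_on_comparison_test) (use assms(2) in auto)
  then show "f summable_on A"
    by (rule abs_summable_summable)
qed

lemma levy_exponent_summable:
  assumes "(\<lambda>i. g i * x i) summable_on UNIV"
  shows "(\<lambda>i. norm (complex_of_real (g i) * (iexp (z * x i) - 1))) summable_on UNIV"
    "(\<lambda>i. complex_of_real (g i) * (iexp (z * x i) - 1)) summable_on UNIV"
proof -
  have "norm (complex_of_real (g i) * (iexp (z * x i) - 1)) \<le> \<bar>z\<bar> * \<bar>g i * x i\<bar>" for i
    using mult_left_mono[OF norm_iexp_minus_1[of "z * x i"], of "\<bar>g i\<bar>"]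
    by (simp only: norm_mult abs_mult norm_of_real mult_ac)
  then show "(\<lambda>i. norm (complex_of_real (g i) * (iexp (z * x i) - 1))) summable_on UNIV"
    "(\<lambda>i. complex_of_real (g i) * (iexp (z * x i) - 1)) summable_on UNIV"
    by (rule abs_summable_comparison[OF assms])+
qed

lemma levy_exponent_0 [simp]: "levy_exponent g x 0 = 0"
  by (simp add: levy_exponent_def)

text \<open>The sum of \<open>\<bar>g i * x i\<bar>\<close> is a Lipschitz constant. Continuity is
  what selects the branch of the \<open>n\<close>-th root in \<open>char_root\<close>.\<close>

lemma continuous_on_levy_exponent:
  assumes "(\<lambda>i. g i * x i) summable_on UNIV"
  shows "continuous_on UNIV (levy_exponent g x)"
proof -
  define S where "S = (\<Sum>\<^sub>\<infinity>i. \<bar>g i * x i\<bar>)"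
  have abs: "(\<lambda>i. \<bar>g i * x i\<bar>) summable_on UNIV"
    using assms summable_on_iff_abs_summable_on_real[of "\<lambda>i. g i * x i" UNIV] by simp
  have "dist (levy_exponent g x s) (levy_exponent g x t) \<le> S * dist s t" for s t
  proof -
    have "norm (levy_exponent g x s - levy_exponent g x t) \<le> \<bar>s - t\<bar> * S"
      unfolding S_def
    proof (rule norm_infsum_le)
      show "((\<lambda>i. complex_of_real (g i) * (iexp (s * x i) - 1) - complex_of_real (g i) * (iexp (t * x i) - 1))
          has_sum levy_exponent g x s - levy_exponent g x t) UNIV"
        unfolding levy_exponent_def
                by (intro has_sum_diff has_sum_infsum levy_exponent_summable(2)[OF assms])
      show "((\<lambda>i. \<bar>s - t\<bar> * \<bar>g i * x i\<bar>) has_sum \<bar>s - t\<bar> * (\<Sum>\<^sub>\<infinity>i. \<bar>g i * x i\<bar>)) UNIV"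
        by (intro has_sum_cmult_right has_sum_infsum abs)
      fix i
      have "norm (complex_of_real (g i) * (iexp (s * x i) - 1) - complex_of_real (g i) * (iexp (t * x i) - 1))
        = norm (complex_of_real (g i) * (iexp (s * x i) - iexp (t * x i)))"
        by (simp add: right_diff_distrib)
      also have "\<dots> = \<bar>g i\<bar> * cmod (iexp (s * x i) - iexp (t * x i))"
        by (simp add: norm_mult)
      also have "\<dots> \<le> \<bar>g i\<bar> * \<bar>s * x i - t * x i\<bar>"
        by (intro mult_left_mono norm_iexp_diff) simp
      also have "\<dots> = \<bar>s - t\<bar> * \<bar>g i * x i\<bar>"
        by (simp add: abs_mult flip: left_diff_distrib)
      finally show "norm (complex_of_real (g i) * (iexp (s * x i) - 1) - complex_of_real (g i) * (iexp (t * x i) - 1))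
          \<le> \<bar>s - t\<bar> * \<bar>g i * x i\<bar>" .
    qed
    then show ?thesis
      by (simp add: dist_norm mult.commute)
  qed
  moreover have "S \<ge> 0"
    unfolding S_def by (rule infsum_nonneg) simp
  ultimately show ?thesis
    by (intro lipschitz_on_continuous_on[of S] lipschitz_onI) auto
qed

text \<open>Rate 0 is included because it occurs: for \<open>v = 0\<close>, and at the indices that
  pad a countable family to one indexed by \<open>nat\<close>.\<close>

definition poisson0_pmf :: "real \<Rightarrow> nat pmf" where
  "poisson0_pmf r = (if r > 0 then poisson_pmf r else return_pmf 0)"

lemma pmf_poisson0: "r \<ge> 0 \<Longrightarrow> pmf (poisson0_pmf r) n = r ^ n / fact n * exp (- r)"
  by (auto simp: poisson0_pmf_def power_0_left indicator_def)

lemma poisson0_mean: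
  assumes "r \<ge> 0"
  shows "(\<integral>\<^sup>+n. ennreal (real n) \<partial>poisson0_pmf r) = ennreal r"
proof -
  have "(\<lambda>n. r ^ n /\<^sub>R fact n) sums exp r"
    by (rule exp_converges)
  then have "(\<lambda>n. r * exp (- r) * (r ^ n /\<^sub>R fact n)) sums (r * exp (- r) * exp r)"
    by (rule sums_mult)
  moreover have "r * exp (- r) * (r ^ n /\<^sub>R fact n) = r ^ Suc n / fact (Suc n) * exp (- r) * real (Suc n)" for n
    by (simp add: divide_simps exp_minus del: of_nat_Suc)
  ultimately have "(\<lambda>n. r ^ Suc n / fact (Suc n) * exp (- r) * real (Suc n)) sums r"
    using exp_minus_inverse[of "- r"] by (simp add: mult.assoc del: of_nat_Suc)
  then have s: "(\<lambda>n. r ^ n / fact n * exp (- r) * real n) sums r"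
    by (subst (asm) sums_Suc_iff) simp
  have "(\<integral>\<^sup>+n. ennreal (real n) \<partial>poisson0_pmf r)
      = (\<Sum>n. ennreal (r ^ n / fact n * exp (- r) * real n))"
    using assms
    by (simp add: nn_integral_measure_pmf nn_integral_count_space_nat pmf_poisson0 flip: ennreal_mult)
  also have "\<dots> = ennreal r"
    using s assms by (subst suminf_ennreal2) (auto simp: sums_iff)
  finally show ?thesis .
qed

lemma poisson0_char:
  assumes "r \<ge> 0"
  shows "(CLINT n|poisson0_pmf r. iexp (t * real n)) = exp (complex_of_real r * (iexp t - 1))"
proof -
  let ?f = "\<lambda>n. complex_of_real (r ^ n / fact n * exp (- r)) * iexp (t * real n)"
  have e: "?f n = exp (- complex_of_real r) * ((complex_of_real r * iexp t) ^ n /\<^sub>R fact n)" for n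
    by (simp add: power_mult_distrib scaleR_conv_of_real divide_inverse exp_minus exp_of_real
        flip: exp_of_nat_mult) (simp add: algebra_simps)
  have s: "?f sums exp (complex_of_real r * (iexp t - 1))"
  proof -
    have "(\<lambda>n. exp (- complex_of_real r) * ((complex_of_real r * iexp t) ^ n /\<^sub>R fact n)) sums
      (exp (- complex_of_real r) * exp (complex_of_real r * iexp t))"
      by (intro sums_mult exp_converges)
    then show ?thesis
      unfolding e by (simp add: algebra_simps flip: exp_add)
  qed
  have "(\<lambda>n. norm (?f n)) = (\<lambda>n. exp (- r) * (r ^ n /\<^sub>R fact n))"
    using assms by (auto simp: norm_mult norm_divide norm_power divide_inverse norm_inverse mult_ac)
  then have "summable (\<lambda>n. norm (?f n))"
    using summable_mult[OF summable_exp_generic[of r], of "exp (- r)"] by simp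
  then have "integrable (count_space UNIV) ?f"
    by (simp add: integrable_count_space_nat_iff)
  then have "(CLINT n|count_space UNIV. ?f n) = exp (complex_of_real r * (iexp t - 1))"
    using s by (simp add: integral_count_space_nat sums_iff)
  moreover have "(CLINT n|poisson0_pmf r. iexp (t * real n)) = (CLINT n|count_space UNIV. ?f n)"
    using assms by (subst measure_pmf_eq_density, subst integral_density)
       (auto simp: pmf_poisson0 scaleR_conv_of_real)
  ultimately show ?thesis by simp
qed

text \<open>Realized as \<open>\<Sum>i. x i * N i\<close> with independent Poisson variables \<open>N i\<close> of mean \<open>g i\<close>.\<close>

lemma poisson_series:
  fixes g x :: "nat \<Rightarrow> real"
  assumes g: "\<And>i. g i \<ge> 0" and sm: "summable (\<lambda>i. \<bar>g i * x i\<bar>)"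
  obtains \<rho> where "real_distribution \<rho>"
    "\<And>z. char \<rho> z = exp (\<Sum>i. complex_of_real (g i) * (iexp (z * x i) - 1))"
    "\<And>A. closed A \<Longrightarrow> 0 \<in> A \<Longrightarrow> (\<And>a b. a \<in> A \<Longrightarrow> b \<in> A \<Longrightarrow> a + b \<in> A) \<Longrightarrow> range x \<subseteq> A \<Longrightarrow>
       AE y in \<rho>. y \<in> A"
proof -
  define Q where "Q i = measure_pmf (poisson0_pmf (g i))" for i
  define \<Omega> where "\<Omega> = PiM UNIV Q"
  interpret Q: prob_space "Q i" for i
    unfolding Q_def by (rule measure_pmf.prob_space_axioms)
  interpret product_prob_space Q UNIV ..
  interpret O: prob_space \<Omega>
    unfolding \<Omega>_def by (rule prob_space_axioms)
  define X where "X i \<omega> = x i * real (\<omega> i)" for i and \<omega> :: "nat \<Rightarrow> nat"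
  have comp: "(\<lambda>\<omega>. \<omega> i) \<in> measurable \<Omega> (Q i)" for i
    unfolding \<Omega>_def by (rule measurable_component_singleton) simp
  have meas_Q: "f \<in> measurable (Q i) borel" for f :: "nat \<Rightarrow> real" and i
    unfolding Q_def by simp
  have meas_QC: "f \<in> measurable (Q i) borel" for f :: "nat \<Rightarrow> complex" and i
    unfolding Q_def by simp
  have [measurable]: "X i \<in> borel_measurable \<Omega>" for i
    unfolding X_def by (rule measurable_compose[OF comp meas_Q])
  have dQ: "distr \<Omega> (Q i) (\<lambda>\<omega>. \<omega> i) = Q i" for i
    unfolding \<Omega>_def by (rule PiM_component) simp
  have "O.indep_vars Q (\<lambda>i \<omega>. \<omega> i) UNIV"
    by (subst O.indep_vars_iff_distr_eq_PiM) (simp_all add: comp dQ distr_id2 restrict_UNIV flip: \<Omega>_def)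
  then have indep: "O.indep_vars (\<lambda>_. borel) X UNIV"
    unfolding X_def by (rule O.indep_vars_compose2) (rule meas_Q)
  have char_X: "char (distr \<Omega> borel (X i)) z = exp (complex_of_real (g i) * (iexp (z * x i) - 1))" for i z
  proof -
    have "char (distr \<Omega> borel (X i)) z = (CLINT \<omega>|\<Omega>. iexp (z * x i * real (\<omega> i)))"
      by (simp add: char_def integral_distr X_def mult.assoc)
    also have "\<dots> = (CLINT n|distr \<Omega> (Q i) (\<lambda>\<omega>. \<omega> i). iexp (z * x i * real n))"
      by (rule integral_distr[symmetric, OF comp meas_QC])
    finally show ?thesis
      unfolding dQ unfolding Q_def using poisson0_char[OF g, of i "z * x i"] by simp
  qed
  have mean_X: "(\<integral>\<^sup>+\<omega>. ennreal \<bar>X i \<omega>\<bar> \<partial>\<Omega>) = ennreal \<bar>g i * x i\<bar>" for i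
  proof -
    have "(\<integral>\<^sup>+\<omega>. ennreal \<bar>X i \<omega>\<bar> \<partial>\<Omega>)
        = (\<integral>\<^sup>+n. ennreal (\<bar>x i\<bar> * real n) \<partial>distr \<Omega> (Q i) (\<lambda>\<omega>. \<omega> i))"
      by (subst nn_integral_distr[OF comp]) (auto simp: X_def abs_mult Q_def)
    also have "\<dots> = (\<integral>\<^sup>+n. ennreal (\<bar>x i\<bar> * real n) \<partial>Q i)"
      unfolding dQ ..
    also have "\<dots> = ennreal \<bar>x i\<bar> * (\<integral>\<^sup>+n. ennreal (real n) \<partial>Q i)"
      by (subst nn_integral_cmult[symmetric]) (auto simp: ennreal_mult Q_def)
    also have "\<dots> = ennreal \<bar>g i * x i\<bar>"
      unfolding Q_def poisson0_mean[OF g] using g[of i]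
      by (simp add: abs_mult mult.commute flip: ennreal_mult)
    finally show ?thesis .
  qed
  \<comment> \<open>The expected sum of absolute values equals the sum of
    \<open>\<bar>g i * x i\<bar>\<close> and is finite, so the random series converges absolutely
    almost surely, without centering.\<close>
  have ae: "AE \<omega> in \<Omega>. summable (\<lambda>i. X i \<omega>)"
  proof -
    have "(\<integral>\<^sup>+\<omega>. (\<Sum>i. ennreal \<bar>X i \<omega>\<bar>) \<partial>\<Omega>) = (\<Sum>i. ennreal \<bar>g i * x i\<bar>)"
      by (subst nn_integral_suminf) (auto simp: mean_X)
    also have "\<dots> \<noteq> \<infinity>"
      using sm by (simp add: suminf_ennreal2)
    finally have "AE \<omega> in \<Omega>. (\<Sum>i. ennreal \<bar>X i \<omega>\<bar>) \<noteq> \<infinity>"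
      by (intro nn_integral_PInf_AE) auto
    then show ?thesis
    proof eventually_elim
      case (elim \<omega>)
      then have "summable (\<lambda>i. \<bar>X i \<omega>\<bar>)"
        by (intro summable_suminf_not_top) auto
      then show ?case
        by (rule summable_rabs_cancel)
    qed
  qed
  define Y where "Y \<omega> = (\<Sum>i. X i \<omega>)" for \<omega>
  have [measurable]: "Y \<in> borel_measurable \<Omega>"
    unfolding Y_def by measurable
  show ?thesis
  proof
    show "real_distribution (distr \<Omega> borel Y)"
      by (rule O.real_distribution_distr) measurable
    show "char (distr \<Omega> borel Y) z = exp (\<Sum>i. complex_of_real (g i) * (iexp (z * x i) - 1))" for z
    proof (rule LIMSEQ_unique)
      let ?S = "\<lambda>J \<omega>. \<Sum>i<J. X i \<omega>"
      have "(\<lambda>J. CLINT \<omega>|\<Omega>. iexp (z * ?S J \<omega>)) \<longlonglongrightarrow> (CLINT \<omega>|\<Omega>. iexp (z * Y \<omega>))"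
      proof (rule integral_dominated_convergence[where w = "\<lambda>_. 1"])
        show "AE \<omega> in \<Omega>. (\<lambda>J. iexp (z * ?S J \<omega>)) \<longlonglongrightarrow> iexp (z * Y \<omega>)"
          using ae
        proof eventually_elim
          case (elim \<omega>)
          then have "(\<lambda>J. ?S J \<omega>) \<longlonglongrightarrow> Y \<omega>"
            unfolding Y_def by (rule summable_LIMSEQ)
          then show ?case
            by (intro tendsto_intros)
        qed
      qed auto
      then show "(\<lambda>J. CLINT \<omega>|\<Omega>. iexp (z * ?S J \<omega>)) \<longlonglongrightarrow> char (distr \<Omega> borel Y) z"
        by (simp add: char_def integral_distr)
      have "(CLINT \<omega>|\<Omega>. iexp (z * ?S J \<omega>)) = exp (\<Sum>i<J. complex_of_real (g i) * (iexp (z * x i) - 1))" for J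
      proof -
        have "(CLINT \<omega>|\<Omega>. iexp (z * ?S J \<omega>)) = char (distr \<Omega> borel (?S J)) z"
          by (simp add: char_def integral_distr)
        also have "\<dots> = (\<Prod>i<J. char (distr \<Omega> borel (X i)) z)"
          by (intro O.char_distr_sum O.indep_vars_subset[OF indep]) auto
        finally show ?thesis
          by (simp add: char_X exp_sum)
      qed
      moreover have "summable (\<lambda>i. complex_of_real (g i) * (iexp (z * x i) - 1))"
      proof (rule summable_comparison_test')
        show "summable (\<lambda>i. \<bar>z\<bar> * \<bar>g i * x i\<bar>)"
          by (intro summable_mult sm)
        show "norm (complex_of_real (g i) * (iexp (z * x i) - 1)) \<le> \<bar>z\<bar> * \<bar>g i * x i\<bar>" for i
          using mult_left_mono[OF norm_iexp_minus_1[of "z * x i"], of "\<bar>g i\<bar>"]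
          by (simp only: norm_mult abs_mult norm_of_real mult_ac)
      qed
      ultimately show "(\<lambda>J. CLINT \<omega>|\<Omega>. iexp (z * ?S J \<omega>))
          \<longlonglongrightarrow> exp (\<Sum>i. complex_of_real (g i) * (iexp (z * x i) - 1))"
        by (simp add: summable_LIMSEQ tendsto_exp)
    qed
    \<comment> \<open>Partial sums stay in the semigroup \<open>A\<close>, and closedness carries
      this to the limit. Applied to the naturals and to the half-line, this yields the support of
      variables known only through their characteristic functions.\<close>
    fix A :: "real set"
    assume A: "closed A" "0 \<in> A" "\<And>a b. a \<in> A \<Longrightarrow> b \<in> A \<Longrightarrow> a + b \<in> A" "range x \<subseteq> A"
    have mult: "x i * real n \<in> A" for i n
    proof (induction n)
      case (Suc n)
      moreover have "x i \<in> A" using A(4) by auto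
      ultimately show ?case using A(3)[of "x i" "x i * real n"] by (simp add: algebra_simps)
    qed (use A in simp)
    have fin: "(\<Sum>i<J. X i \<omega>) \<in> A" for J \<omega>
      using A mult by (induction J) (auto simp: X_def)
    have "AE \<omega> in \<Omega>. Y \<omega> \<in> A"
      using ae
    proof eventually_elim
      case (elim \<omega>)
      then have "(\<lambda>J. \<Sum>i<J. X i \<omega>) \<longlonglongrightarrow> Y \<omega>"
        unfolding Y_def by (rule summable_LIMSEQ)
      from closed_sequentially[OF A(1) fin this] show ?case .
    qed
    then show "AE y in distr \<Omega> borel Y. y \<in> A"
      using borel_closed[OF A(1)] by (simp add: AE_distr_iff)
  qed
qed

text \<open>Codes outside the range of \<open>to_nat\<close> get the value 0, which also covers
  finite index types such as \<open>unit\<close> and \<open>bool\<close>.\<close>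

lemma has_sum_to_nat:
  fixes F :: "'i::countable \<Rightarrow> 'b::{comm_monoid_add, t2_space}"
  shows "((\<lambda>n. if n \<in> range (to_nat :: 'i \<Rightarrow> nat) then F (from_nat n) else 0) has_sum S) UNIV \<longleftrightarrow> (F has_sum S) UNIV"
proof -
  have "((\<lambda>n. if n \<in> range (to_nat :: 'i \<Rightarrow> nat) then F (from_nat n) else 0) has_sum S) UNIV
    \<longleftrightarrow> ((\<lambda>n. F (from_nat n)) has_sum S) (range (to_nat :: 'i \<Rightarrow> nat))"
    by (rule has_sum_cong_neutral) auto
  also have "\<dots> \<longleftrightarrow> (F has_sum S) UNIV"
    by (subst has_sum_reindex) (auto simp: comp_def)
  finally show ?thesis .
qed

lemma poisson_sum_exists:
  fixes g x :: "'i::countable \<Rightarrow> real"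
  assumes g: "\<And>i. g i \<ge> 0" and sm: "(\<lambda>i. g i * x i) summable_on UNIV"
  obtains \<rho> where "real_distribution \<rho>"
    "\<And>z. char \<rho> z = exp (levy_exponent g x z)"
    "\<And>A. closed A \<Longrightarrow> 0 \<in> A \<Longrightarrow> (\<And>a b. a \<in> A \<Longrightarrow> b \<in> A \<Longrightarrow> a + b \<in> A) \<Longrightarrow> range x \<subseteq> A \<Longrightarrow>
       AE y in \<rho>. y \<in> A"
proof -
  define R where "R = range (to_nat :: 'i \<Rightarrow> nat)"
  define g' where "g' n = (if n \<in> R then g (from_nat n) else 0)" for n
  define x' where "x' n = (if n \<in> R then x (from_nat n) else 0)" for n
  have g': "g' n \<ge> 0" for n
    using g by (simp add: g'_def)
  have "(\<lambda>i. \<bar>g i * x i\<bar>) summable_on UNIV"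
    using sm summable_on_iff_abs_summable_on_real[of "\<lambda>i. g i * x i" UNIV] by simp
  then obtain S where "((\<lambda>i. \<bar>g i * x i\<bar>) has_sum S) UNIV"
    by (auto simp: summable_on_def)
  then have "((\<lambda>n. if n \<in> R then \<bar>g (from_nat n) * x (from_nat n)\<bar> else 0) has_sum S) UNIV"
    unfolding R_def has_sum_to_nat[of "\<lambda>i. \<bar>g i * x i\<bar>"] .
  also have "(\<lambda>n. if n \<in> R then \<bar>g (from_nat n) * x (from_nat n)\<bar> else 0) = (\<lambda>n. \<bar>g' n * x' n\<bar>)"
    by (auto simp: g'_def x'_def)
  finally have "summable (\<lambda>n. \<bar>g' n * x' n\<bar>)"
    using has_sum_imp_sums sums_summable by blast
  then obtain \<rho> where \<rho>: "real_distribution \<rho>"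
    "\<And>z. char \<rho> z = exp (\<Sum>n. complex_of_real (g' n) * (iexp (z * x' n) - 1))"
    "\<And>A. closed A \<Longrightarrow> 0 \<in> A \<Longrightarrow> (\<And>a b. a \<in> A \<Longrightarrow> b \<in> A \<Longrightarrow> a + b \<in> A) \<Longrightarrow> range x' \<subseteq> A \<Longrightarrow>
       AE y in \<rho>. y \<in> A"
    by (rule poisson_series[of g' x', OF g']) blast
  show ?thesis
  proof
    show "real_distribution \<rho>" by fact
    fix z
    let ?F = "\<lambda>i. complex_of_real (g i) * (iexp (z * x i) - 1)"
    have "(?F has_sum levy_exponent g x z) UNIV"
      unfolding levy_exponent_def by (intro has_sum_infsum levy_exponent_summable(2)[OF sm])
    then have "((\<lambda>n. if n \<in> R then ?F (from_nat n) else 0) has_sum levy_exponent g x z) UNIV"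
      unfolding R_def has_sum_to_nat[of ?F] .
    also have "(\<lambda>n. if n \<in> R then ?F (from_nat n) else 0)
        = (\<lambda>n. complex_of_real (g' n) * (iexp (z * x' n) - 1))"
      by (auto simp: g'_def x'_def)
    finally have "(\<Sum>n. complex_of_real (g' n) * (iexp (z * x' n) - 1)) = levy_exponent g x z"
      using has_sum_imp_sums sums_unique by fastforce
    then show "char \<rho> z = exp (levy_exponent g x z)"
      by (simp add: \<rho>(2))
  next
    fix A :: "real set"
    assume A: "closed A" "0 \<in> A" "\<And>a b. a \<in> A \<Longrightarrow> b \<in> A \<Longrightarrow> a + b \<in> A" "range x \<subseteq> A"
    then have "range x' \<subseteq> A" by (auto simp: x'_def)
    with A show "AE y in \<rho>. y \<in> A" by (intro \<rho>(3)) auto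
  qed
qed

section \<open>Convolution powers and infinite divisibility\<close>

lemma real_distribution_convolution:
  assumes "real_distribution \<rho>" "real_distribution \<tau>"
  shows "real_distribution (\<rho> \<star> \<tau>)" "char (\<rho> \<star> \<tau>) z = char \<rho> z * char \<tau> z"
proof -
  interpret r: real_distribution \<rho> by fact
  interpret t: real_distribution \<tau> by fact
  interpret pair_prob_space \<rho> \<tau> ..
  have [simp]: "sets (\<rho> \<Otimes>\<^sub>M \<tau>) = sets (borel \<Otimes>\<^sub>M borel)"
    by (intro sets_pair_measure_cong) auto
  have "(\<lambda>(x, y). x + y) \<in> borel_measurable (borel \<Otimes>\<^sub>M borel :: (real \<times> real) measure)"
    by measurable
  then have m [measurable]: "(\<lambda>(x, y). x + y) \<in> borel_measurable (\<rho> \<Otimes>\<^sub>M \<tau>)"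
    by (subst measurable_cong_sets[OF _ refl, of _ "borel \<Otimes>\<^sub>M borel"]) auto
  show "real_distribution (\<rho> \<star> \<tau>)"
    unfolding convolution_def using m by (rule P.real_distribution_distr)
  have i: "integrable (\<rho> \<Otimes>\<^sub>M \<tau>) (\<lambda>w. iexp (z * (case w of (x, y) \<Rightarrow> x + y)))"
    using P.integrable_iexp[of "\<lambda>w. z * (case w of (x, y) \<Rightarrow> x + y)"] m by simp
  have "char (\<rho> \<star> \<tau>) z = (CLINT w|\<rho> \<Otimes>\<^sub>M \<tau>. iexp (z * (case w of (x, y) \<Rightarrow> x + y)))"
    unfolding convolution_def char_def using m by (subst integral_distr) auto
  also have "\<dots> = (CLINT x|\<rho>. CLINT y|\<tau>. iexp (z * x) * iexp (z * y))"
    using integral_fst'[OF i] by (simp add: distrib_left exp_add)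
  also have "\<dots> = char \<rho> z * char \<tau> z"
    by (simp add: char_def)
  finally show "char (\<rho> \<star> \<tau>) z = char \<rho> z * char \<tau> z" .
qed

lemma convolution_power:
  assumes "real_distribution \<rho>"
  shows "real_distribution (((\<lambda>\<tau>. \<rho> \<star> \<tau>) ^^ n) (return borel 0))
    \<and> char (((\<lambda>\<tau>. \<rho> \<star> \<tau>) ^^ n) (return borel 0)) z = char \<rho> z ^ n"
proof (induction n)
  case 0
  interpret prob_space "return borel (0::real)"
    by (rule prob_space_return) simp
  have "real_distribution (return borel (0::real))"
    by unfold_locales auto
  then show ?case
    by (simp add: char_def integral_return)
next
  case (Suc n)
  then show ?case
    using real_distribution_convolution[OF assms] by simp
qed

text \<open>Dividing all weights by \<open>n\<close> gives a Poisson sum whose characteristic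
  function is an \<open>n\<close>-th root of that of \<open>\<sigma>\<close>; uniqueness of
  characteristic functions makes it a convolution root.\<close>

lemma infinitely_divisible_levy_exponent:
  fixes g x :: "'i::countable \<Rightarrow> real"
  assumes \<sigma>: "real_distribution \<sigma>" "\<And>z. char \<sigma> z = exp (levy_exponent g x z)"
    and g: "\<And>i. g i \<ge> 0" and sm: "(\<lambda>i. g i * x i) summable_on UNIV"
  shows "infinitely_divisible \<sigma>"
  unfolding infinitely_divisible_def
proof (intro conjI allI impI \<sigma>(1))
  fix n :: nat
  assume n: "n \<ge> 1"
  have sm': "(\<lambda>i. (g i / n) * x i) summable_on UNIV"
    using summable_on_cmult_right[OF sm, of "1 / n"] by (simp add: field_simps)
  then obtain \<rho> where \<rho>: "real_distribution \<rho>" "\<And>z. char \<rho> z = exp (levy_exponent (\<lambda>i. g i / n) x z)"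
    using g by (elim poisson_sum_exists[of "\<lambda>i. g i / n" x, rotated]) auto
  have "levy_exponent g x z = of_nat n * levy_exponent (\<lambda>i. g i / n) x z" for z
    unfolding levy_exponent_def using n
    by (subst infsum_cmult_right'[symmetric]) (simp flip: mult.assoc)
  then have "char \<sigma> = char (((\<lambda>\<tau>. \<rho> \<star> \<tau>) ^^ n) (return borel 0))"
    using convolution_power[OF \<rho>(1)] by (auto simp: \<sigma>(2) \<rho>(2) exp_of_nat_mult)
  then have "\<sigma> = ((\<lambda>\<tau>. \<rho> \<star> \<tau>) ^^ n) (return borel 0)"
    using Levy_uniqueness[OF \<sigma>(1)] convolution_power[OF \<rho>(1)] by blast
  with \<rho>(1) show "\<exists>\<rho>. real_distribution \<rho> \<and> \<sigma> = ((\<lambda>\<tau>. \<rho> \<star> \<tau>) ^^ n) (return borel 0)"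
    by blast
qed

section \<open>Quasi-infinite divisibility\<close>

lemma count_space_integral:
  fixes f :: "'a \<Rightarrow> 'b::{banach, second_countable_topology}"
  assumes "(\<lambda>i. norm (f i)) summable_on A"
  shows "integrable (count_space A) f" "integral\<^sup>L (count_space A) f = infsum f A"
proof -
  have s: "Infinite_Set_Sum.abs_summable_on f A"
    using assms by (simp add: abs_summable_equivalent)
  then show "integrable (count_space A) f"
    by (simp add: Infinite_Set_Sum.abs_summable_on_def)
  show "integral\<^sup>L (count_space A) f = infsum f A"
    using infsetsum_infsum[OF s] by (simp add: infsetsum_def)
qed

text \<open>Fubini over the graph of \<open>x\<close>, grouping indices by their site. Summability
  of \<open>g\<close> on the fibers is a separate hypothesis, since \<open>F\<close> may vanish at a
  site.\<close>

lemma infsum_fibers: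
  fixes g x :: "'i \<Rightarrow> real" and F :: "real \<Rightarrow> 'b::{banach, real_normed_vector}"
  assumes sm: "(\<lambda>i. norm (g i *\<^sub>R F (x i))) summable_on UNIV"
    and fib: "\<And>y. g summable_on (x -` {y})"
  shows "(\<lambda>y. norm (infsum g (x -` {y}) *\<^sub>R F y)) summable_on range x"
    and "(\<Sum>\<^sub>\<infinity>y\<in>range x. infsum g (x -` {y}) *\<^sub>R F y) = (\<Sum>\<^sub>\<infinity>i. g i *\<^sub>R F (x i))"
proof -
  define G where "G = (\<lambda>(y, i). g i *\<^sub>R F y)"
  let ?S = "Sigma (range x) (\<lambda>y. x -` {y})"
  have bij: "bij_betw (\<lambda>i. (x i, i)) UNIV ?S"
    by (auto simp: bij_betw_def inj_on_def image_iff)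
  have absG: "(\<lambda>p. norm (G p)) summable_on ?S"
    using summable_on_reindex_bij_betw[OF bij, of "\<lambda>p. norm (G p)"] sm by (simp add: G_def)
  then have sG: "G summable_on ?S"
    by (rule abs_summable_summable)
  have inner: "(\<Sum>\<^sub>\<infinity>i\<in>x -` {y}. g i *\<^sub>R F y) = infsum g (x -` {y}) *\<^sub>R F y" for y
    using fib by (intro infsum_scaleR_left) auto
  have "(\<Sum>\<^sub>\<infinity>y\<in>range x. infsum g (x -` {y}) *\<^sub>R F y) = infsum G ?S"
    using infsum_Sigma_banach[OF sG] by (simp add: inner G_def)
  also have "\<dots> = (\<Sum>\<^sub>\<infinity>i. g i *\<^sub>R F (x i))"
    using infsum_reindex_bij_betw[OF bij, of G] by (simp add: G_def)
  finally show "(\<Sum>\<^sub>\<infinity>y\<in>range x. infsum g (x -` {y}) *\<^sub>R F y) = (\<Sum>\<^sub>\<infinity>i. g i *\<^sub>R F (x i))" .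
  have sn: "(\<lambda>y. \<Sum>\<^sub>\<infinity>i\<in>x -` {y}. norm (G (y, i))) summable_on range x"
    using absG summable_on_Sigma_banach[of "\<lambda>y i. norm (G (y, i))" "range x" "\<lambda>y. x -` {y}"]
    by (simp add: case_prod_unfold)
  have fn: "(\<lambda>i. norm (g i *\<^sub>R F y)) summable_on (x -` {y})" for y
    using summable_on_subset_banach[OF sm, of "x -` {y}"]
    by (rule summable_on_cong[THEN iffD1, rotated]) auto
  show "(\<lambda>y. norm (infsum g (x -` {y}) *\<^sub>R F y)) summable_on range x"
  proof (rule summable_on_comparison_test[OF sn])
    fix y
    show "norm (infsum g (x -` {y}) *\<^sub>R F y) \<le> (\<Sum>\<^sub>\<infinity>i\<in>x -` {y}. norm (G (y, i)))"
      unfolding inner[symmetric] G_def using norm_infsum_bound[OF fn[of y]] by simp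
  qed simp
qed

text \<open>\<open>ennreal\<close> truncates negative values to 0, so the same construction applied
  to \<open>net\<close> and to \<open>- net\<close> yields the positive and the negative part of a
  signed measure. Pushing forward by the identity replaces the discrete sigma-algebra by the Borel
  one.\<close>

definition atomic_measure :: "(real \<Rightarrow> real) \<Rightarrow> real set \<Rightarrow> real measure" where
  "atomic_measure h S = distr (density (count_space S) (\<lambda>y. ennreal (h y))) borel (\<lambda>y. y)"

lemma sets_atomic_measure [simp]: "sets (atomic_measure h S) = sets borel"
  by (simp add: atomic_measure_def)

lemma nn_integral_atomic_measure:
  assumes "f \<in> borel_measurable borel"
  shows "(\<integral>\<^sup>+y. f y \<partial>atomic_measure h S) = (\<integral>\<^sup>+y. ennreal (h y) * f y \<partial>count_space S)"
  unfolding atomic_measure_def using assms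
  by (subst nn_integral_distr) (auto simp: nn_integral_density)

lemma emeasure_atomic_measure_0:
  assumes "A \<in> sets borel" "\<And>y. y \<in> A \<Longrightarrow> y \<in> S \<Longrightarrow> h y \<le> 0"
  shows "emeasure (atomic_measure h S) A = 0"
proof -
  have "emeasure (atomic_measure h S) A = (\<integral>\<^sup>+y. indicator A y \<partial>atomic_measure h S)"
    using assms by simp
  also have "\<dots> = (\<integral>\<^sup>+y. ennreal (h y) * indicator A y \<partial>count_space S)"
    using assms by (intro nn_integral_atomic_measure) auto
  also have "\<dots> = (\<integral>\<^sup>+y. 0 \<partial>count_space S)"
    using assms by (intro nn_integral_cong) (auto simp: indicator_def ennreal_neg)
  finally show ?thesis by simp
qed

lemma integral_atomic_measure:
  fixes f :: "real \<Rightarrow> complex"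
  assumes [measurable]: "f \<in> borel_measurable borel"
    and sm: "(\<lambda>y. norm (h y *\<^sub>R f y)) summable_on S"
  shows "(CLINT y|atomic_measure h S. f y) = (\<Sum>\<^sub>\<infinity>y\<in>S. max 0 (h y) *\<^sub>R f y)"
    and "(\<lambda>y. max 0 (h y) *\<^sub>R f y) summable_on S"
proof -
  have s: "(\<lambda>y. norm (max 0 (h y) *\<^sub>R f y)) summable_on S"
    by (rule summable_on_comparison_test[OF sm]) (auto intro!: mult_right_mono)
  then show "(\<lambda>y. max 0 (h y) *\<^sub>R f y) summable_on S"
    by (rule abs_summable_summable)
  have eq: "atomic_measure h S = distr (density (count_space S) (\<lambda>y. ennreal (max 0 (h y)))) borel (\<lambda>y. y)"
  proof -
    have "ennreal (max 0 (h y)) = ennreal (h y)" for y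
      by (cases "h y \<ge> 0") (auto simp: max_def ennreal_neg)
    then show ?thesis
      by (simp add: atomic_measure_def)
  qed
  have "(CLINT y|atomic_measure h S. f y) = (CLINT y|density (count_space S) (\<lambda>y. ennreal (max 0 (h y))). f y)"
    unfolding eq by (rule integral_distr) auto
  also have "\<dots> = (CLINT y|count_space S. max 0 (h y) *\<^sub>R f y)"
    by (rule integral_density) auto
  also have "\<dots> = (\<Sum>\<^sub>\<infinity>y\<in>S. max 0 (h y) *\<^sub>R f y)"
    by (rule count_space_integral(2)[OF s])
  finally show "(CLINT y|atomic_measure h S. f y) = (\<Sum>\<^sub>\<infinity>y\<in>S. max 0 (h y) *\<^sub>R f y)" .
qed

lemma norm_compensated_exp: "norm (compensated_exp z y) \<le> 2 * \<bar>z\<bar> * \<bar>y\<bar>"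
proof -
  have "norm (compensated_exp z y) \<le> norm (iexp (z * y) - 1)
      + norm (\<i> * complex_of_real (z * y * indicator {-1..1} y))"
    unfolding compensated_exp_def by (rule norm_triangle_ineq4)
  also have "norm (\<i> * complex_of_real (z * y * indicator {-1..1} y)) = \<bar>z * y\<bar> * indicator {-1..1} y"
    unfolding norm_mult norm_of_real by (simp add: abs_mult indicator_def)
  also have "\<dots> \<le> \<bar>z * y\<bar>"
    by (simp add: indicator_def)
  finally show ?thesis
    using norm_iexp_minus_1[of "z * y"] by (simp add: abs_mult)
qed

lemma summable_on_iff_abs: "(\<lambda>i. \<bar>h i :: real\<bar>) summable_on A \<longleftrightarrow> h summable_on A"
  using summable_on_iff_abs_summable_on_real[of h A] by simp

text \<open>On the fiber \<open>x\<close> is constantly \<open>y\<close>, so \<open>g i\<close> is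
  \<open>g i * x i\<close> divided by \<open>y\<close>; at \<open>y = 0\<close> the summability
  hypothesis says nothing about \<open>g\<close>.\<close>

lemma levy_exponent_fiber_summable:
  fixes g x :: "'i \<Rightarrow> real"
  assumes "y \<noteq> 0" "(\<lambda>i. g i * x i) summable_on UNIV"
  shows "g summable_on (x -` {y})"
proof -
  have "(\<lambda>i. g i * x i) summable_on (x -` {y})"
    using assms(2) by (rule summable_on_subset_banach) simp
  then have "(\<lambda>i. g i * x i * inverse y) summable_on (x -` {y})"
    by (rule summable_on_cmult_left)
  then show ?thesis
    by (rule summable_on_cong[THEN iffD1, rotated]) (use assms(1) in auto)
qed

text \<open>The two parts of the Levy measure must be mutually singular, so masses at a common site
  are added up first and only then split by sign.\<close>

lemma quasi_infinitely_divisible_levy_exponent: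
  fixes g x :: "'i::countable \<Rightarrow> real"
  assumes \<sigma>: "real_distribution \<sigma>" "\<And>z. char \<sigma> z = exp (levy_exponent g x z)"
    and x: "\<And>i. x i \<noteq> 0" and sm: "(\<lambda>i. g i * x i) summable_on UNIV"
  shows "quasi_infinitely_divisible \<sigma>"
proof -
  define S where "S = range x"
  define net where "net y = infsum g (x -` {y})" for y
  define \<nu>p where "\<nu>p = atomic_measure net S"
  define \<nu>n where "\<nu>n = atomic_measure (\<lambda>y. - net y) S"
  define J :: "real \<Rightarrow> real" where "J y = indicator {-1..1} y" for y
  \<comment> \<open>The drift that undoes the compensation in \<open>compensated_exp\<close>; it
    converges because \<open>g i * x i\<close> is summable.\<close>
  define \<gamma> where "\<gamma> = (\<Sum>\<^sub>\<infinity>i. g i * x i * J (x i))"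
  have "0 \<notin> S"
    using x by (auto simp: S_def)
  have "countable S"
    by (simp add: S_def)
  have fib: "g summable_on (x -` {y})" for y
  proof (cases "y = 0")
    case True
    then have "x -` {y} = {}" using x by auto
    then show ?thesis by simp
  next
    case False
    then show ?thesis by (rule levy_exponent_fiber_summable[OF _ sm])
  qed
  have abs: "(\<lambda>i. \<bar>g i * x i\<bar>) summable_on UNIV"
    using sm by (simp only: summable_on_iff_abs)
  have net_sm: "(\<lambda>y. \<bar>net y * y\<bar>) summable_on S"
    using infsum_fibers(1)[of g "\<lambda>y. y" x] fib abs by (simp add: net_def S_def)
  have net_fin: "(\<integral>\<^sup>+y. ennreal \<bar>net y * y\<bar> \<partial>count_space S) < \<infinity>"
  proof -
    have "integrable (count_space S) (\<lambda>y. net y * y)"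
      using net_sm by (intro count_space_integral(1)) simp
    then show ?thesis
      by (simp add: integrable_iff_bounded)
  qed
  have fin: "(\<integral>\<^sup>+y. ennreal (min (y\<^sup>2) 1) \<partial>atomic_measure h S) < \<infinity>" if h: "\<And>y. \<bar>h y\<bar> = \<bar>net y\<bar>" for h
  proof -
    have "(\<integral>\<^sup>+y. ennreal (min (y\<^sup>2) 1) \<partial>atomic_measure h S)
        = (\<integral>\<^sup>+y. ennreal (h y) * ennreal (min (y\<^sup>2) 1) \<partial>count_space S)"
      by (intro nn_integral_atomic_measure) measurable
    also have "\<dots> \<le> (\<integral>\<^sup>+y. ennreal \<bar>net y * y\<bar> \<partial>count_space S)"
    proof (rule nn_integral_mono)
      fix y :: real
      have "min (y\<^sup>2) 1 \<le> \<bar>y\<bar>"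
      proof (cases "\<bar>y\<bar> \<le> 1")
        case True
        then have "\<bar>y\<bar> * \<bar>y\<bar> \<le> \<bar>y\<bar>"
          using mult_left_mono[of "\<bar>y\<bar>" 1 "\<bar>y\<bar>"] by simp
        then show ?thesis by (simp add: power2_eq_square min_def)
      qed auto
      then have le: "\<bar>h y\<bar> * min (y\<^sup>2) 1 \<le> \<bar>net y * y\<bar>"
        unfolding h abs_mult by (intro mult_left_mono) auto
      have "ennreal (h y) * ennreal (min (y\<^sup>2) 1) \<le> ennreal \<bar>h y\<bar> * ennreal (min (y\<^sup>2) 1)"
        by (intro mult_right_mono ennreal_leI) auto
      also have "\<dots> = ennreal (\<bar>h y\<bar> * min (y\<^sup>2) 1)"
        by (rule ennreal_mult[symmetric]) auto
      also have "\<dots> \<le> ennreal \<bar>net y * y\<bar>"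
        by (rule ennreal_leI[OF le])
      finally show "ennreal (h y) * ennreal (min (y\<^sup>2) 1) \<le> ennreal \<bar>net y * y\<bar>" .
    qed
    finally show ?thesis using net_fin by simp
  qed
  have "mutually_singular \<nu>p \<nu>n"
    unfolding mutually_singular_def
  proof
    let ?A = "{y\<in>S. net y \<le> 0}"
    show A: "?A \<in> sets borel"
    proof (rule sets.countable)
      show "countable ?A"
        using \<open>countable S\<close> by (simp add: countable_Collect)
    qed simp
    show "emeasure \<nu>p ?A = 0 \<and> emeasure \<nu>n (- ?A) = 0"
      unfolding \<nu>p_def \<nu>n_def
      using A by (intro conjI emeasure_atomic_measure_0 borel_comp) simp_all
  qed
  moreover have "emeasure (atomic_measure h S) {0} = 0" for h
    by (rule emeasure_atomic_measure_0) (use \<open>0 \<notin> S\<close> in simp_all)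
  moreover have "(\<integral>\<^sup>+x. ennreal (min (x\<^sup>2) 1) \<partial>\<nu>p) < \<infinity>" "(\<integral>\<^sup>+x. ennreal (min (x\<^sup>2) 1) \<partial>\<nu>n) < \<infinity>"
    unfolding \<nu>p_def \<nu>n_def by (rule fin, simp)+
  ultimately have qlm: "quasi_levy_measure \<nu>p \<nu>n"
    unfolding quasi_levy_measure_def \<nu>p_def \<nu>n_def
    by (intro conjI sets_atomic_measure) (simp_all only: add_0_left infinity_ennreal_def ennreal_add_less_top)
  have "char \<sigma> z = exp (\<i> * complex_of_real (\<gamma> * z) - complex_of_real (0 * z\<^sup>2)
                + ((CLINT x|\<nu>p. compensated_exp z x) - (CLINT x|\<nu>n. compensated_exp z x)))" for z
  proof -
    let ?F = "compensated_exp z"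
    have F_meas: "?F \<in> borel_measurable borel"
      unfolding compensated_exp_def[abs_def] by measurable
    have "norm (g i *\<^sub>R ?F (x i)) \<le> (2 * \<bar>z\<bar>) * \<bar>g i * x i\<bar>" for i
      using mult_left_mono[OF norm_compensated_exp[of z "x i"], of "\<bar>g i\<bar>"]
      by (simp add: abs_mult algebra_simps)
    then have F: "(\<lambda>i. norm (g i *\<^sub>R ?F (x i))) summable_on UNIV"
      by (rule abs_summable_comparison(1)[OF sm])
    note fibers = infsum_fibers[OF F fib, folded net_def S_def]
    have fib_neg: "(\<lambda>y. norm (- net y *\<^sub>R ?F y)) summable_on S"
      using fibers(1) by simp
    have "(CLINT y|\<nu>p. ?F y) = (\<Sum>\<^sub>\<infinity>y\<in>S. max 0 (net y) *\<^sub>R ?F y)"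
      unfolding \<nu>p_def by (rule integral_atomic_measure(1)[OF F_meas fibers(1)])
    moreover have "(CLINT y|\<nu>n. ?F y) = (\<Sum>\<^sub>\<infinity>y\<in>S. max 0 (- net y) *\<^sub>R ?F y)"
      unfolding \<nu>n_def by (rule integral_atomic_measure(1)[OF F_meas fib_neg])
    moreover have "(\<Sum>\<^sub>\<infinity>y\<in>S. max 0 (net y) *\<^sub>R ?F y - max 0 (- net y) *\<^sub>R ?F y)
        = (\<Sum>\<^sub>\<infinity>y\<in>S. max 0 (net y) *\<^sub>R ?F y) - (\<Sum>\<^sub>\<infinity>y\<in>S. max 0 (- net y) *\<^sub>R ?F y)"
      by (intro infsumI has_sum_diff has_sum_infsum integral_atomic_measure(2)[OF F_meas fibers(1)]
          integral_atomic_measure(2)[OF F_meas fib_neg])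
    ultimately have "(CLINT y|\<nu>p. ?F y) - (CLINT y|\<nu>n. ?F y)
        = (\<Sum>\<^sub>\<infinity>y\<in>S. max 0 (net y) *\<^sub>R ?F y - max 0 (- net y) *\<^sub>R ?F y)"
      by (simp only:)
    also have "\<dots> = (\<Sum>\<^sub>\<infinity>y\<in>S. net y *\<^sub>R ?F y)"
      by (intro infsum_cong) (auto simp: max_def)
    also have "\<dots> = (\<Sum>\<^sub>\<infinity>i. g i *\<^sub>R ?F (x i))"
      by (rule fibers(2))
    finally have 1: "((\<lambda>i. g i *\<^sub>R ?F (x i)) has_sum (CLINT y|\<nu>p. ?F y) - (CLINT y|\<nu>n. ?F y)) UNIV"
      using F by (simp add: abs_summable_summable)
    have "(\<lambda>i. g i * x i * J (x i)) summable_on UNIV"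
      by (rule abs_summable_comparison(2)[OF sm, where C = 1]) (simp add: J_def indicator_def abs_mult)
    then have "((\<lambda>i. g i * x i * J (x i)) has_sum \<gamma>) UNIV"
      unfolding \<gamma>_def by (rule has_sum_infsum)
    then have "((\<lambda>i. complex_of_real (g i * x i * J (x i))) has_sum complex_of_real \<gamma>) UNIV"
      by (rule has_sum_bounded_linear[OF bounded_linear_of_real])
    then have "((\<lambda>i. \<i> * z * complex_of_real (g i * x i * J (x i))) has_sum \<i> * z * complex_of_real \<gamma>) UNIV"
      by (rule has_sum_cmult_right)
    from has_sum_add[OF 1 this]
    have "((\<lambda>i. complex_of_real (g i) * (iexp (z * x i) - 1)) has_sum
        (CLINT y|\<nu>p. ?F y) - (CLINT y|\<nu>n. ?F y) + \<i> * z * complex_of_real \<gamma>) UNIV"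
      by (rule has_sum_cong[THEN iffD1, rotated])
        (simp add: compensated_exp_def J_def scaleR_conv_of_real algebra_simps)
    then have "levy_exponent g x z = (CLINT y|\<nu>p. ?F y) - (CLINT y|\<nu>n. ?F y) + \<i> * z * complex_of_real \<gamma>"
      unfolding levy_exponent_def by (rule infsumI)
    then show ?thesis
      by (simp add: \<sigma>(2) mult_ac add_ac)
  qed
  with qlm \<sigma>(1) show ?thesis
    unfolding quasi_infinitely_divisible_def by blast
qed

section \<open>Net masses of infinitely divisible distributions\<close>

text \<open>The quotient of \<open>char \<rho>\<close> and \<open>exp (\<psi> z / n)\<close> is
  continuous with values among the finitely many \<open>n\<close>-th roots of unity, hence constant
  on the line, and it is 1 at 0.\<close>

lemma char_root:
  assumes \<rho>: "real_distribution \<rho>" and n: "n \<ge> 1"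
    and \<psi>: "continuous_on UNIV \<psi>" "\<psi> 0 = 0" "\<And>z. char \<rho> z ^ n = exp (\<psi> z)"
  shows "char \<rho> z = exp (\<psi> z / of_nat n)"
proof -
  interpret real_distribution \<rho> by fact
  define h where "h z = char \<rho> z * exp (- \<psi> z / of_nat n)" for z
  have "h z ^ n = 1" for z
    using n by (simp add: h_def power_mult_distrib \<psi>(3) flip: exp_of_nat_mult exp_add)
  then have "h ` UNIV \<subseteq> {w. w ^ n = 1}"
    by auto
  then have "finite (h ` UNIV)"
    using finite_roots_unity[OF n] finite_subset by auto
  moreover have "continuous_on UNIV h"
    unfolding h_def by (intro continuous_intros \<psi>(1) continuous_at_imp_continuous_on ballI isCont_char) (use n in auto)
  ultimately have "h constant_on UNIV"
    by (intro continuous_finite_range_constant) auto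
  then have "h z = h 0"
    by (auto simp: constant_on_def)
  also have "h 0 = 1"
    by (simp add: h_def \<psi>(2) char_zero)
  finally show ?thesis
    by (simp add: h_def exp_minus field_simps)
qed

lemma tendsto_exp_scaled:
  fixes w :: "'a::{banach, real_normed_field}"
  shows "(\<lambda>n. of_nat n * (exp (w / of_nat n) - 1)) \<longlonglongrightarrow> w"
proof (cases "w = 0")
  case False
  have "((\<lambda>h. (exp h - 1) / h) \<longlongrightarrow> 1) (at (0::'a))"
    using DERIV_exp[of "0::'a"] by (simp add: DERIV_def)
  moreover have "filterlim (\<lambda>n. w / of_nat n) (at 0) sequentially"
    unfolding filterlim_at
  proof (intro conjI tendsto_divide_0[OF tendsto_const] tendsto_of_nat)
    show "\<forall>\<^sub>F n in sequentially. w / of_nat n \<in> UNIV \<and> w / of_nat n \<noteq> 0"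
      using eventually_gt_at_top[of 0] by eventually_elim (use False in auto)
  qed
  ultimately have "(\<lambda>n. (exp (w / of_nat n) - 1) / (w / of_nat n)) \<longlonglongrightarrow> 1"
    by (rule filterlim_compose)
  from tendsto_mult_left[OF this, of w]
  have "(\<lambda>n. w * ((exp (w / of_nat n) - 1) / (w / of_nat n))) \<longlonglongrightarrow> w"
    by simp
  moreover have "\<forall>\<^sub>F n in sequentially. w * ((exp (w / of_nat n) - 1) / (w / of_nat n))
      = of_nat n * (exp (w / of_nat n) - 1)"
    using eventually_gt_at_top[of 0] by eventually_elim (use False in auto)
  ultimately show ?thesis
    by (rule Lim_transform_eventually)
qed simp

section \<open>Conditional positive definiteness of Levy exponents\<close>

lemma has_sum_sum_finite:
  fixes f :: "'l \<Rightarrow> 'i \<Rightarrow> 'b::real_normed_vector"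
  assumes "finite A" "\<And>l. l \<in> A \<Longrightarrow> (f l has_sum s l) B"
  shows "((\<lambda>i. \<Sum>l\<in>A. f l i) has_sum (\<Sum>l\<in>A. s l)) B"
  using assms by (induction A) (auto intro!: has_sum_add)

definition trig :: "'l set \<Rightarrow> ('l \<Rightarrow> complex) \<Rightarrow> ('l \<Rightarrow> real) \<Rightarrow> real \<Rightarrow> complex" where
  "trig A b t y = (\<Sum>l\<in>A. b l * iexp (t l * y))"

lemma trig_norm_square:
  "complex_of_real ((cmod (trig A b t y))\<^sup>2)
    = (\<Sum>l\<in>A. \<Sum>m\<in>A. b l * cnj (b m) * iexp ((t l - t m) * y))"
proof -
  have "complex_of_real ((cmod (trig A b t y))\<^sup>2) = trig A b t y * cnj (trig A b t y)"
    by (rule complex_norm_square)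
  also have "\<dots> = (\<Sum>l\<in>A. \<Sum>m\<in>A. (b l * iexp (t l * y)) * cnj (b m * iexp (t m * y)))"
    by (simp add: trig_def sum_product)
  also have "\<dots> = (\<Sum>l\<in>A. \<Sum>m\<in>A. b l * cnj (b m) * iexp ((t l - t m) * y))"
    by (intro sum.cong refl) (simp add: exp_cnj left_diff_distrib right_diff_distrib exp_diff exp_minus field_simps)
  finally show ?thesis .
qed

text \<open>A Levy exponent is conditionally positive definite, being the limit of
  \<open>n (char \<rho> - 1)\<close> for the \<open>n\<close>-th convolution roots \<open>\<rho>\<close>.\<close>

lemma infinitely_divisible_trig_nonneg:
  fixes g x :: "'i \<Rightarrow> real" and b :: "'l \<Rightarrow> complex"
  assumes \<sigma>: "infinitely_divisible \<sigma>" "\<And>z. char \<sigma> z = exp (levy_exponent g x z)"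
    and sm: "(\<lambda>i. g i * x i) summable_on UNIV"
    and A: "finite A" "sum b A = 0"
  shows "(\<Sum>\<^sub>\<infinity>i. g i * (cmod (trig A b t (x i)))\<^sup>2) \<ge> 0"
proof -
  let ?\<psi> = "levy_exponent g x"
  define Q where "Q f = (\<Sum>l\<in>A. \<Sum>m\<in>A. b l * cnj (b m) * f (t l - t m))" for f :: "real \<Rightarrow> complex"
  \<comment> \<open>Here \<open>sum b A = 0\<close> enters: the form \<open>Q\<close> ignores
    additive constants, so the \<open>- 1\<close> in \<open>n * (char \<rho> - 1)\<close> and in the
    exponent drops out.\<close>
  have Q_const: "Q (\<lambda>z. a) = 0" for a
  proof -
    have "Q (\<lambda>z. a) = (\<Sum>l\<in>A. b l) * (\<Sum>m\<in>A. cnj (b m)) * a"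
      unfolding Q_def sum_product by (simp add: sum_distrib_right)
    then show ?thesis using A by simp
  qed
  have Q_diff: "Q (\<lambda>z. f z - h z) = Q f - Q h" for f h
    by (simp add: Q_def right_diff_distrib sum_subtractf)
  have Q_mult: "Q (\<lambda>z. a * f z) = a * Q f" for f a
    by (simp add: Q_def sum_distrib_left algebra_simps)
  have nonneg: "Re (Q (\<lambda>z. of_nat n * (exp (?\<psi> z / of_nat n) - 1))) \<ge> 0" if n: "n \<ge> 1" for n
  proof -
    obtain \<rho> where \<rho>: "real_distribution \<rho>" "\<sigma> = ((\<lambda>\<tau>. \<rho> \<star> \<tau>) ^^ n) (return borel 0)"
      using \<sigma>(1) n unfolding infinitely_divisible_def by blast
    interpret real_distribution \<rho> by fact
    have "char \<rho> z ^ n = exp (?\<psi> z)" for z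
      using convolution_power[OF \<rho>(1), of n z] \<sigma>(2) \<rho>(2) by simp
    then have c: "char \<rho> z = exp (?\<psi> z / of_nat n)" for z
      using char_root[OF \<rho>(1) n continuous_on_levy_exponent[OF sm]] by simp
    have int: "integrable \<rho> (\<lambda>y. iexp (a * y))" for a
      by (rule integrable_iexp) (auto simp del: of_real_mult)
    have int': "integrable \<rho> (\<lambda>y. b l * cnj (b m) * iexp ((t l - t m) * y))" for l m
      by (intro integrable_mult_right int)
    have "Q (char \<rho>) = (\<Sum>l\<in>A. \<Sum>m\<in>A. CLINT y|\<rho>. b l * cnj (b m) * iexp ((t l - t m) * y))"
      unfolding Q_def char_def by (intro sum.cong refl integral_mult_right_zero[symmetric])
    also have "\<dots> = (\<Sum>l\<in>A. CLINT y|\<rho>. \<Sum>m\<in>A. b l * cnj (b m) * iexp ((t l - t m) * y))"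
      by (intro sum.cong refl Bochner_Integration.integral_sum[symmetric] int')
    also have "\<dots> = (CLINT y|\<rho>. \<Sum>l\<in>A. \<Sum>m\<in>A. b l * cnj (b m) * iexp ((t l - t m) * y))"
      by (intro Bochner_Integration.integral_sum[symmetric] Bochner_Integration.integrable_sum int')
    also have "\<dots> = (CLINT y|\<rho>. complex_of_real ((cmod (trig A b t y))\<^sup>2))"
      unfolding trig_norm_square ..
    also have "\<dots> = complex_of_real (LINT y|\<rho>. (cmod (trig A b t y))\<^sup>2)"
      by (rule integral_complex_of_real)
    finally have "Re (Q (char \<rho>)) \<ge> 0"
      by simp
    moreover have "Q (\<lambda>z. of_nat n * (exp (?\<psi> z / of_nat n) - 1)) = of_nat n * Q (char \<rho>)"
      unfolding Q_mult Q_diff Q_const c[symmetric] by simp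
    ultimately show ?thesis by simp
  qed
  have "(\<lambda>n. Q (\<lambda>z. of_nat n * (exp (?\<psi> z / of_nat n) - 1))) \<longlonglongrightarrow> Q ?\<psi>"
    unfolding Q_def by (intro tendsto_sum tendsto_mult_left tendsto_exp_scaled)
  then have "(\<lambda>n. Re (Q (\<lambda>z. of_nat n * (exp (?\<psi> z / of_nat n) - 1)))) \<longlonglongrightarrow> Re (Q ?\<psi>)"
    by (rule tendsto_Re)
  moreover have "\<forall>\<^sub>F n in sequentially. Re (Q (\<lambda>z. of_nat n * (exp (?\<psi> z / of_nat n) - 1))) \<ge> 0"
    using eventually_ge_at_top[of 1] by eventually_elim (rule nonneg)
  ultimately have Q_nonneg: "Re (Q ?\<psi>) \<ge> 0"
    by (rule tendsto_lowerbound) simp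
  have "((\<lambda>i. \<Sum>l\<in>A. \<Sum>m\<in>A. b l * cnj (b m) * (complex_of_real (g i) * (iexp ((t l - t m) * x i) - 1)))
      has_sum Q ?\<psi>) UNIV"
    unfolding Q_def levy_exponent_def
    by (intro has_sum_sum_finite A has_sum_cmult_right has_sum_infsum levy_exponent_summable(2)[OF sm])
  moreover have "(\<Sum>l\<in>A. \<Sum>m\<in>A. b l * cnj (b m) * (complex_of_real (g i) * (iexp ((t l - t m) * x i) - 1)))
      = complex_of_real (g i * (cmod (trig A b t (x i)))\<^sup>2)" for i
  proof -
    have "(\<Sum>l\<in>A. \<Sum>m\<in>A. b l * cnj (b m) * (complex_of_real (g i) * (iexp ((t l - t m) * x i) - 1)))
        = Q (\<lambda>z. complex_of_real (g i) * (iexp (z * x i) - 1))"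
      by (simp add: Q_def)
    also have "\<dots> = complex_of_real (g i) * Q (\<lambda>z. iexp (z * x i))"
      unfolding Q_mult Q_diff Q_const by simp
    also have "Q (\<lambda>z. iexp (z * x i)) = complex_of_real ((cmod (trig A b t (x i)))\<^sup>2)"
      unfolding trig_norm_square Q_def ..
    finally show ?thesis by simp
  qed
  ultimately have "((\<lambda>i. complex_of_real (g i * (cmod (trig A b t (x i)))\<^sup>2)) has_sum Q ?\<psi>) UNIV"
    by simp
  then have "((\<lambda>i. Re (complex_of_real (g i * (cmod (trig A b t (x i)))\<^sup>2))) has_sum Re (Q ?\<psi>)) UNIV"
    by (rule has_sum_Re)
  then have "(\<Sum>\<^sub>\<infinity>i. g i * (cmod (trig A b t (x i)))\<^sup>2) = Re (Q ?\<psi>)"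
    by (intro infsumI) simp
  with Q_nonneg show ?thesis by simp
qed

section \<open>Isolating one atom by averaging over frequencies\<close>

lemma average_powers_tendsto:
  fixes \<omega> :: complex
  assumes "cmod \<omega> = 1"
  shows "(\<lambda>J. (\<Sum>j<J. \<omega> ^ j) / of_nat J) \<longlonglongrightarrow> (if \<omega> = 1 then 1 else 0)"
proof (cases "\<omega> = 1")
  case True
  have "\<forall>\<^sub>F J in sequentially. 1 = (\<Sum>j<J. \<omega> ^ j) / of_nat J"
    using eventually_gt_at_top[of 0] by eventually_elim (simp add: True)
  then show ?thesis
    unfolding if_P[OF True] by (rule Lim_transform_eventually[OF tendsto_const])
next
  case False
  have "norm ((\<Sum>j<J. \<omega> ^ j) / of_nat J) \<le> (2 / cmod (1 - \<omega>)) * (1 / real J)" for J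
  proof -
    have "cmod (1 - \<omega> ^ J) \<le> 2"
      using norm_triangle_ineq4[of 1 "\<omega> ^ J"] assms by (simp add: norm_power)
    then have "cmod (1 - \<omega> ^ J) / cmod (1 - \<omega>) \<le> 2 / cmod (1 - \<omega>)"
      by (intro divide_right_mono) auto
    moreover have "(\<Sum>j<J. \<omega> ^ j) = (1 - \<omega> ^ J) / (1 - \<omega>)"
      using False by (simp add: sum_gp_strict)
    ultimately have "cmod (\<Sum>j<J. \<omega> ^ j) \<le> 2 / cmod (1 - \<omega>)"
      by (simp only: norm_divide)
    from divide_right_mono[OF this, of "real J"] show ?thesis
      by (simp add: norm_divide)
  qed
  moreover have "(\<lambda>J. (2 / cmod (1 - \<omega>)) * (1 / real J)) \<longlonglongrightarrow> 0"
    by (intro tendsto_mult_right_zero lim_1_over_n)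
  ultimately have "(\<lambda>J. (\<Sum>j<J. \<omega> ^ j) / of_nat J) \<longlonglongrightarrow> 0"
    by (rule Lim_null_comparison[OF always_eventually[OF allI]])
  then show ?thesis
    using False by simp
qed

lemma norm_average_powers_le:
  fixes \<omega> :: complex
  assumes "cmod \<omega> = 1"
  shows "cmod ((\<Sum>j<J. \<omega> ^ j) / of_nat J) \<le> 1"
proof -
  have "cmod (\<Sum>j<J. \<omega> ^ j) \<le> (\<Sum>j<J. cmod (\<omega> ^ j))"
    by (rule norm_sum)
  also have "\<dots> = real J"
    by (simp add: norm_power assms)
  finally show ?thesis
    by (cases "J = 0") (simp_all add: norm_divide)
qed

text \<open>For \<open>x i \<noteq> x0\<close> the frequencies with a spurious coincidence are the
  integer multiples of \<open>2 * pi / (x i - x0)\<close>, so only countably many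
  \<open>\<tau>\<close> are excluded. Indices with \<open>x i = x0\<close> merely add the value 0 to
  \<open>B\<close>, by the convention on division by 0.\<close>

lemma separating_frequency:
  fixes x :: "'i::countable \<Rightarrow> real"
  shows "\<exists>\<tau>. \<forall>i. iexp (\<tau> * (x i - x0)) = 1 \<longleftrightarrow> x i = x0"
proof -
  define B where "B = (\<lambda>(i, k). 2 * pi * real_of_int k / (x i - x0)) ` (UNIV :: ('i \<times> int) set)"
  have "countable B"
    by (simp add: B_def)
  then obtain \<tau> where \<tau>: "\<tau> \<notin> B"
    using uncountable_UNIV_real by (metis UNIV_eq_I)
  have "iexp (\<tau> * (x i - x0)) = 1 \<longleftrightarrow> x i = x0" for i
  proof
    assume "iexp (\<tau> * (x i - x0)) = 1"
    then obtain k :: int where k: "\<tau> * (x i - x0) = of_int (2 * k) * pi"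
      unfolding exp_eq_1 by auto
    show "x i = x0"
    proof (rule ccontr)
      assume "x i \<noteq> x0"
      with k have "\<tau> = (\<lambda>(i, k). 2 * pi * real_of_int k / (x i - x0)) (i, k)"
        by (simp add: field_simps)
      with \<tau> show False unfolding B_def by blast
    qed
  qed simp
  then show ?thesis by blast
qed

text \<open>The net mass at \<open>x0\<close> is picked out by integrating the Levy measure against
  \<open>\<bar>(exp (\<i> s x) - 1) K(x)\<bar>\<^sup>2\<close>, where \<open>K\<close> is an average of \<open>exp (\<i> \<tau> j (x - x0))\<close>
  over \<open>j < J\<close>. The first factor
  vanishes at \<open>0\<close>, where the mass may be infinite; for all but countably many \<open>\<tau>\<close> the
  periodic kernel \<open>K\<close> sees no atom other than \<open>x0\<close> as \<open>J\<close> tends to infinity.\<close>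

lemma infinitely_divisible_net_mass_nonneg:
  fixes g x :: "'i::countable \<Rightarrow> real"
  assumes \<sigma>: "infinitely_divisible \<sigma>" "\<And>z. char \<sigma> z = exp (levy_exponent g x z)"
    and sm: "(\<lambda>i. g i * x i) summable_on UNIV" and x0: "x0 \<noteq> 0"
  shows "infsum g (x -` {x0}) \<ge> 0"
proof -
  obtain \<tau> where \<tau>: "\<And>i. iexp (\<tau> * (x i - x0)) = 1 \<longleftrightarrow> x i = x0"
    using separating_frequency[of x x0] by blast
  \<comment> \<open>Half a turn at \<open>x0\<close>: since \<open>iexp (s * x0) = -1\<close>, the
    factor that vanishes at 0 has squared modulus 4 at \<open>x0\<close>.\<close>
  define s where "s = pi / x0"
  define \<omega> where "\<omega> i = iexp (\<tau> * (x i - x0))" for i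
  have \<omega>: "\<omega> i = 1 \<longleftrightarrow> x i = x0" for i
    unfolding \<omega>_def by (rule \<tau>)
  define A where "A J = {..<J} \<times> (UNIV :: bool set)" for J :: nat
  \<comment> \<open>The product of the two factors as a trigonometric polynomial with frequencies
    \<open>\<tau> * j\<close> and \<open>\<tau> * j + s\<close>. The boolean picks the term of
    \<open>iexp (s * x) - 1\<close>, and its signs make the coefficients sum to 0.\<close>
  define b where "b J = (\<lambda>(j, e). iexp (- \<tau> * real j * x0) / of_nat J * (if e then 1 else -1))" for J :: nat
  define t where "t = (\<lambda>(j::nat, e). \<tau> * real j + (if e then s else 0))"
  define T where "T J i = trig (A J) (b J) t (x i)" for J i
  have T: "T J i = (iexp (s * x i) - 1) * ((\<Sum>j<J. \<omega> i ^ j) / of_nat J)" for J i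
  proof -
    have "T J i = (\<Sum>j<J. \<Sum>e\<in>UNIV. b J (j, e) * iexp (t (j, e) * x i))"
      by (simp add: T_def trig_def A_def sum.cartesian_product)
    also have "\<dots> = (\<Sum>j<J. (iexp (s * x i) - 1) * (\<omega> i ^ j / of_nat J))"
    proof (rule sum.cong[OF refl])
      fix j
      have *: "\<omega> i ^ j = iexp (- \<tau> * real j * x0) * iexp (\<tau> * real j * x i)"
        by (simp add: \<omega>_def algebra_simps flip: exp_of_nat_mult exp_add)
      have "iexp ((\<tau> * real j + s) * x i) = iexp (\<tau> * real j * x i) * iexp (s * x i)"
        by (simp add: distrib_right distrib_left exp_add)
      then show "(\<Sum>e\<in>UNIV. b J (j, e) * iexp (t (j, e) * x i)) = (iexp (s * x i) - 1) * (\<omega> i ^ j / of_nat J)"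
        unfolding * by (simp add: UNIV_bool b_def t_def) (simp add: algebra_simps diff_divide_distrib)
    qed
    also have "\<dots> = (iexp (s * x i) - 1) * ((\<Sum>j<J. \<omega> i ^ j) / of_nat J)"
      by (simp add: sum_distrib_left sum_divide_distrib)
    finally show ?thesis .
  qed
  have b0: "sum (b J) (A J) = 0" for J
    unfolding A_def by (simp add: b_def UNIV_bool flip: sum.cartesian_product)
  have nonneg: "(\<Sum>\<^sub>\<infinity>i. g i * (cmod (T J i))\<^sup>2) \<ge> 0" for J
    unfolding T_def by (rule infinitely_divisible_trig_nonneg[OF \<sigma> sm _ b0]) (simp add: A_def)
  \<comment> \<open>Of the two factors of the square, one is bounded by
    \<open>\<bar>s * x i\<bar>\<close> and the other by 2. The result is linear in
    \<open>\<bar>x i\<bar>\<close> and gives a summable majorant independent of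
    \<open>J\<close>.\<close>
  have T_le: "(cmod (T J i))\<^sup>2 \<le> 2 * \<bar>s\<bar> * \<bar>x i\<bar>" for J i
  proof -
    have n1: "cmod (\<omega> i) = 1"
      by (simp add: \<omega>_def)
    have "cmod ((\<Sum>j<J. \<omega> i ^ j) / of_nat J) \<le> 1"
      by (rule norm_average_powers_le[OF n1])
    then have "cmod (T J i) \<le> cmod (iexp (s * x i) - 1) * 1"
      unfolding T norm_mult by (intro mult_left_mono) auto
    then have 1: "cmod (T J i) \<le> \<bar>s * x i\<bar>" and 2: "cmod (T J i) \<le> 2"
      using norm_iexp_minus_1[of "s * x i"] norm_iexp_minus_1'[of "s * x i"] by linarith+
    have "cmod (T J i) * cmod (T J i) \<le> 2 * \<bar>s * x i\<bar>"
      by (intro mult_mono 1 2) auto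
    then show ?thesis
      by (simp add: power2_eq_square abs_mult)
  qed
  define L where "L i = g i * (if x i = x0 then 4 else 0)" for i
  have conv: "(\<lambda>J. g i * (cmod (T J i))\<^sup>2) \<longlonglongrightarrow> L i" for i
  proof -
    have "(\<lambda>J. T J i) \<longlonglongrightarrow> (iexp (s * x i) - 1) * (if \<omega> i = 1 then 1 else 0)"
      unfolding T by (intro tendsto_mult tendsto_const average_powers_tendsto) (simp add: \<omega>_def)
    then have "(\<lambda>J. g i * (cmod (T J i))\<^sup>2) \<longlonglongrightarrow> g i * (cmod ((iexp (s * x i) - 1) * (if \<omega> i = 1 then 1 else 0)))\<^sup>2"
      by (intro tendsto_intros)
    moreover have "iexp (s * x0) = -1"
      using x0 by (simp add: s_def)
    then have "g i * (cmod ((iexp (s * x i) - 1) * (if \<omega> i = 1 then 1 else 0)))\<^sup>2 = L i"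
      by (auto simp: L_def \<omega>)
    ultimately show ?thesis by simp
  qed
  have dom: "norm (g i * (cmod (T J i))\<^sup>2) \<le> 2 * \<bar>s\<bar> * \<bar>g i * x i\<bar>" for J i
    using mult_left_mono[OF T_le[of J i], of "\<bar>g i\<bar>"] by (simp add: abs_mult mult_ac)
  have dom': "norm (L i) \<le> 2 * \<bar>s\<bar> * \<bar>g i * x i\<bar>" for i
    by (rule tendsto_upperbound[OF tendsto_norm[OF conv] always_eventually]) (simp_all add: dom del: real_norm_def)
  note sT = abs_summable_comparison(1)[OF sm dom] and sL = abs_summable_comparison(1)[OF sm dom']
  have "(\<lambda>J. LINT i|count_space UNIV. g i * (cmod (T J i))\<^sup>2) \<longlonglongrightarrow> (LINT i|count_space UNIV. L i)"
  proof (rule integral_dominated_convergence[where w = "\<lambda>i. 2 * \<bar>s\<bar> * \<bar>g i * x i\<bar>"])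
    have "(\<lambda>i. norm (2 * \<bar>s\<bar> * \<bar>g i * x i\<bar>)) summable_on UNIV"
      by (rule abs_summable_comparison(1)[OF sm, where C = "2 * \<bar>s\<bar>"]) simp
    then show "integrable (count_space UNIV) (\<lambda>i. 2 * \<bar>s\<bar> * \<bar>g i * x i\<bar>)"
      by (rule count_space_integral(1))
  qed (use conv dom in auto)
  then have "(\<lambda>J. \<Sum>\<^sub>\<infinity>i. g i * (cmod (T J i))\<^sup>2) \<longlonglongrightarrow> infsum L UNIV"
    using count_space_integral(2)[OF sT] count_space_integral(2)[OF sL] by simp
  then have "infsum L UNIV \<ge> 0"
    by (rule tendsto_lowerbound[OF _ always_eventually]) (simp_all add: nonneg)
  also have "infsum L UNIV = (\<Sum>\<^sub>\<infinity>i\<in>x -` {x0}. g i * 4)"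
    by (rule infsum_cong_neutral) (auto simp: L_def)
  also have "\<dots> = infsum g (x -` {x0}) * 4"
    by (rule infsum_cmult_left')
  finally show ?thesis by simp
qed

section \<open>The pathwise integral\<close>

text \<open>A left-endpoint sum is the integral of a step function on cells \<open>{a<..b}\<close>.
  The left end of the cell containing \<open>s\<close> lies strictly below \<open>s\<close>, so the
  step functions converge to the value given by the left limit of \<open>n\<close>; they are bounded
  by 1 because \<open>n\<close> is nonnegative and \<open>c > 1\<close>.\<close>

lemma riemann_sum_tendsto_integral:
  fixes n l :: "real \<Rightarrow> real"
  assumes c: "c > 1" and n0: "\<And>t. t \<ge> 0 \<Longrightarrow> n t \<ge> 0"
    and nl: "\<And>t. t > 0 \<Longrightarrow> \<exists>m. (n \<longlongrightarrow> m) (at_left t)"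
    and lm: "\<And>s t. 0 \<le> s \<Longrightarrow> s \<le> t \<Longrightarrow> l s \<le> l t"
    and lr: "\<And>t. t \<ge> 0 \<Longrightarrow> continuous (at_right t) l"
  shows "(\<lambda>j. \<Sum>i<T * 2 ^ j. c powr (- n (real i / 2 ^ j)) * (l (real (Suc i) / 2 ^ j) - l (real i / 2 ^ j)))
    \<longlonglongrightarrow> (LINT s:{0<..real T}|interval_measure (\<lambda>s. l (max 0 s)). c powr (- Lim (at_left s) n))"
proof -
  define F where "F s = l (max 0 s)" for s
  define m where "m = interval_measure F"
  have F_mono: "F a \<le> F b" if "a \<le> b" for a b
    unfolding F_def using that by (intro lm) auto
  have F_right: "continuous (at_right a) F" for a
  proof (cases "a \<ge> 0")
    case True
    have "(l \<longlongrightarrow> l a) (at_right a)"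
      using lr[OF True] by (simp add: continuous_within)
    moreover have "\<forall>\<^sub>F s in at_right a. l s = F s"
      using eventually_at_right_less[of a] by eventually_elim (use True in \<open>simp add: F_def\<close>)
    ultimately have "(F \<longlongrightarrow> l a) (at_right a)"
      by (rule Lim_transform_eventually)
    with True show ?thesis
      by (simp add: continuous_within F_def)
  next
    case False
    then have "\<forall>\<^sub>F s in at_right a. s < 0"
      by (intro eventually_at_right_real[THEN eventually_mono]) auto
    then have "\<forall>\<^sub>F s in at_right a. l 0 = F s"
      by eventually_elim (simp add: F_def)
    from Lim_transform_eventually[OF tendsto_const this] have "(F \<longlongrightarrow> l 0) (at_right a)" .
    with False show ?thesis
      by (simp add: continuous_within F_def)
  qed
  have em: "emeasure m {a<..b} = ennreal (F b - F a)" if "a \<le> b" for a b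
    unfolding m_def using that F_mono F_right by (intro emeasure_interval_measure_Ioc) auto
  have sm [measurable_cong, simp]: "sets m = sets borel"
    by (simp add: m_def)
  have me: "measure m {a<..b} = F b - F a" if "a \<le> b" for a b
    using em[OF that] F_mono[OF that] by (simp add: measure_def)
  have int_ind: "integrable m (indicator {a<..b} :: real \<Rightarrow> real)" if "a \<le> b" for a b
    using em[OF that] by (intro integrable_real_indicator) auto
  define g where "g j i = c powr (- n (real i / 2 ^ j))" for j i :: nat
  define f where "f j s = (\<Sum>i<T * 2 ^ j. g j i * indicator {real i / 2 ^ j<..real (Suc i) / 2 ^ j} s)" for j s
  \<comment> \<open>Left end of the dyadic cell containing \<open>s\<close>. Ceiling minus one,
    rather than floor, keeps it below \<open>s\<close> even when \<open>s\<close> is itself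
    dyadic.\<close>
  define d where "d j s = (of_int (\<lceil>s * 2 ^ j\<rceil> - 1)) / (2::real) ^ j" for j and s :: real
  have le: "real i / 2 ^ j \<le> real (Suc i) / 2 ^ j" for i j
    by (intro divide_right_mono) auto
  have int_f: "(LINT s|m. f j s) = (\<Sum>i<T * 2 ^ j. g j i * (l (real (Suc i) / 2 ^ j) - l (real i / 2 ^ j)))" for j
  proof -
    have "(LINT s|m. f j s) = (\<Sum>i<T * 2 ^ j. g j i * measure m {real i / 2 ^ j<..real (Suc i) / 2 ^ j})"
      unfolding f_def using le int_ind by (subst Bochner_Integration.integral_sum) auto
    also have "\<dots> = (\<Sum>i<T * 2 ^ j. g j i * (F (real (Suc i) / 2 ^ j) - F (real i / 2 ^ j)))"
      by (simp only: me[OF le])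
    finally show ?thesis
      by (simp add: F_def del: of_nat_Suc)
  qed
  have f_out: "f j s = 0" if "s \<notin> {0<..real T}" for j s
    unfolding f_def
  proof (intro sum.neutral ballI)
    fix i assume "i \<in> {..<T * 2 ^ j}"
    then have "Suc i \<le> T * 2 ^ j"
      by simp
    then have "real (Suc i) \<le> real (T * 2 ^ j)"
      by (simp only: of_nat_le_iff)
    then have "real (Suc i) / 2 ^ j \<le> real T"
      by (simp add: divide_le_eq del: of_nat_Suc)
    moreover have "0 \<le> real i / 2 ^ j" by simp
    ultimately have "s \<notin> {real i / 2 ^ j<..real (Suc i) / 2 ^ j}"
      using that unfolding greaterThanAtMost_iff by linarith
    then show "g j i * indicator {real i / 2 ^ j<..real (Suc i) / 2 ^ j} s = 0"
      by simp
  qed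
  have f_in: "f j s = c powr (- n (d j s))" and d_nonneg: "d j s \<ge> 0"
    if s: "s \<in> {0<..real T}" for j s
  proof -
    define i0 where "i0 = nat (\<lceil>s * 2 ^ j\<rceil> - 1)"
    have pos: "\<lceil>s * 2 ^ j\<rceil> \<ge> 1"
      using s by (simp add: one_le_ceiling)
    then have i0: "int i0 = \<lceil>s * 2 ^ j\<rceil> - 1"
      by (simp add: i0_def)
    have d: "d j s = real i0 / 2 ^ j"
      unfolding d_def i0[symmetric] by simp
    have "\<lceil>s * 2 ^ j\<rceil> \<le> int (T * 2 ^ j)"
      using s by (simp add: ceiling_le_iff)
    then have "i0 < T * 2 ^ j"
      using i0 by linarith
    have iff: "s \<in> {real i / 2 ^ j<..real (Suc i) / 2 ^ j} \<longleftrightarrow> i = i0" for i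
    proof -
      have "s \<in> {real i / 2 ^ j<..real (Suc i) / 2 ^ j} \<longleftrightarrow> real i < s * 2 ^ j \<and> s * 2 ^ j \<le> real i + 1"
        by (auto simp: field_simps)
      also have "\<dots> \<longleftrightarrow> \<lceil>s * 2 ^ j\<rceil> = int i + 1"
        by (simp add: ceiling_eq_iff)
      also have "\<dots> \<longleftrightarrow> i = i0"
        using i0 by linarith
      finally show ?thesis .
    qed
    have "f j s = (\<Sum>i<T * 2 ^ j. if i = i0 then g j i else 0)"
      unfolding f_def by (intro sum.cong refl) (simp only: indicator_def iff, simp)
    also have "\<dots> = g j i0"
      using \<open>i0 < T * 2 ^ j\<close> by simp
    finally show "f j s = c powr (- n (d j s))"
      by (simp add: g_def d)
    show "d j s \<ge> 0" by (simp add: d)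
  qed
  have f_le: "norm (f j s) \<le> indicator {0<..real T} s" for j s
  proof (cases "s \<in> {0<..real T}")
    case True
    have "c powr (- n (d j s)) \<le> c powr 0"
      using c n0[OF d_nonneg[OF True]] by (intro powr_mono) auto
    then show ?thesis
      using True c by (simp add: f_in)
  qed (simp add: f_out)
  define G where "G s = indicator {0<..real T} s * c powr (- Lim (at_left s) n)" for s
  have lim: "(\<lambda>j. f j s) \<longlonglongrightarrow> G s" for s
  proof (cases "s \<in> {0<..real T}")
    case True
    then obtain y where y: "(n \<longlongrightarrow> y) (at_left s)"
      using nl[of s] by auto
    then have "Lim (at_left s) n = y"
      by (intro tendsto_Lim) auto
    have d_less: "d j s < s" for j
    proof -
      have "of_int (\<lceil>s * 2 ^ j\<rceil> - 1) < s * 2 ^ j"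
        using ceiling_correct[of "s * 2 ^ j"] by simp
      then show ?thesis
        by (simp add: d_def divide_less_eq)
    qed
    have d_ge: "s - (1/2) ^ j \<le> d j s" for j
    proof -
      have "s * 2 ^ j - 1 \<le> of_int (\<lceil>s * 2 ^ j\<rceil> - 1)"
        using le_of_int_ceiling[of "s * 2 ^ j"] by simp
      then show ?thesis
        by (simp add: d_def le_divide_eq left_diff_distrib power_one_over)
    qed
    have "(\<lambda>j. s - (1/2) ^ j) \<longlonglongrightarrow> s - 0"
      by (intro tendsto_diff tendsto_const LIMSEQ_power_zero) simp
    then have "(\<lambda>j. d j s) \<longlonglongrightarrow> s"
      using d_ge d_less by (intro tendsto_sandwich[of "\<lambda>j. s - (1/2) ^ j" "\<lambda>j. d j s" sequentially "\<lambda>_. s"])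
        (auto intro!: always_eventually less_imp_le)
    then have "filterlim (\<lambda>j. d j s) (at_left s) sequentially"
      using d_less by (intro filterlim_at[THEN iffD2] conjI always_eventually allI) (auto simp: less_imp_neq)
    with y have "(\<lambda>j. n (d j s)) \<longlonglongrightarrow> y"
      by (rule filterlim_compose)
    then have "(\<lambda>j. c powr (- n (d j s))) \<longlonglongrightarrow> c powr (- y)"
      using c by (intro tendsto_powr tendsto_const tendsto_minus) auto
    then show ?thesis
      using True by (simp add: f_in[OF True] G_def \<open>Lim (at_left s) n = y\<close>)
  qed (simp add: f_out G_def)
  have f_meas: "f j \<in> borel_measurable m" for j
    unfolding f_def by measurable
  have "(\<lambda>j. LINT s|m. f j s) \<longlonglongrightarrow> (LINT s|m. G s)"
  proof (rule integral_dominated_convergence[where w = "indicator {0<..real T}"])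
    show "G \<in> borel_measurable m"
      using f_meas lim by (rule borel_measurable_LIMSEQ_metric)
  qed (use f_meas lim f_le int_ind[of 0 "real T"] in auto)
  then show ?thesis
    unfolding int_f by (simp add: g_def G_def set_lebesgue_integral_def m_def F_def[abs_def])
qed

section \<open>The functional equation of the characteristic function\<close>

text \<open>Taking \<open>\<alpha> = \<tau> * j\<close>, multiplying by
  \<open>iexp (- \<tau> * j * m)\<close> and averaging over \<open>j\<close> damps every term except
  the one at \<open>m\<close>, by the same kernel that isolates an atom of a Levy measure.\<close>

lemma fourier_coefficients_unique:
  fixes d :: "nat \<Rightarrow> complex"
  assumes sm: "summable (\<lambda>n. norm (d n))" and zero: "\<And>\<alpha>. (\<lambda>n. d n * iexp (\<alpha> * real n)) sums 0"
  shows "d m = 0"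
proof -
  obtain \<tau> where \<tau>: "\<And>n. iexp (\<tau> * (real n - real m)) = 1 \<longleftrightarrow> real n = real m"
    using separating_frequency[of real "real m"] by blast
  define \<omega> where "\<omega> n = iexp (\<tau> * (real n - real m))" for n
  have \<omega>: "\<omega> n = 1 \<longleftrightarrow> n = m" for n
    unfolding \<omega>_def \<tau> by simp
  have n1: "cmod (\<omega> n) = 1" for n
    by (simp add: \<omega>_def)
  define K where "K J n = (\<Sum>j<J. \<omega> n ^ j) / of_nat J" for J n
  have K_le: "cmod (K J n) \<le> 1" for J n
    unfolding K_def by (rule norm_average_powers_le[OF n1])
  have K_lim: "(\<lambda>J. d n * K J n) \<longlonglongrightarrow> d n * (if n = m then 1 else 0)" for n
    using tendsto_mult_left[OF average_powers_tendsto[OF n1[of n]], of "d n"] by (simp add: K_def \<omega>)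
  have sums0: "(\<lambda>n. d n * K J n) sums 0" for J
  proof -
    have 1: "(\<lambda>n. iexp (- (\<tau> * real j * real m)) * (d n * iexp (\<tau> * real j * real n)))
        sums (iexp (- (\<tau> * real j * real m)) * 0)" for j
      by (intro sums_mult zero)
    have 2: "iexp (- (\<tau> * real j * real m)) * (d n * iexp (\<tau> * real j * real n)) = d n * \<omega> n ^ j" for j n
      by (simp add: \<omega>_def algebra_simps flip: exp_of_nat_mult exp_add)
    have "(\<lambda>n. d n * \<omega> n ^ j) sums 0" for j
      using 1[of j] unfolding 2 mult_zero_right .
    then have "(\<lambda>n. (\<Sum>j<J. d n * \<omega> n ^ j) / of_nat J) sums ((\<Sum>j<J. 0) / of_nat J)"
      by (intro sums_divide sums_sum)
    then show ?thesis
      by (simp add: K_def sum_distrib_left)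
  qed
  have "(\<lambda>J. \<Sum>n. d n * K J n) \<longlonglongrightarrow> (\<Sum>n. d n * (if n = m then 1 else 0))"
  proof (rule tannerys_theorem[THEN conjunct2, THEN conjunct2])
    show "\<forall>\<^sub>F (n, J) in sequentially \<times>\<^sub>F sequentially. norm (d n * K J n) \<le> norm (d n)"
      using mult_left_mono[OF K_le, of "norm (d _)"] by (intro always_eventually) (auto simp: norm_mult)
  qed (use K_lim sm in auto)
  moreover have "(\<Sum>n. d n * K J n) = 0" for J
    using sums0 sums_unique by fastforce
  moreover have "(\<Sum>n. d n * (if n = m then 1 else 0)) = d m"
    by (subst suminf_finite[of "{m}"]) auto
  ultimately show ?thesis
    using LIMSEQ_unique[OF tendsto_const] by fastforce
qed

text \<open>Splits an expectation by the value of \<open>A\<close>. The coefficients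
  \<open>a n\<close> do not involve \<open>g\<close>: once identified by testing with exponentials,
  they serve for every admissible \<open>g\<close>.\<close>

lemma (in prob_space) expectation_nat_valued:
  fixes A :: "'a \<Rightarrow> real" and X :: "'a \<Rightarrow> complex"
  assumes [measurable]: "A \<in> borel_measurable M" "X \<in> borel_measurable M" "g \<in> borel_measurable borel"
    and A: "AE \<omega> in M. A \<omega> \<in> \<nat>" and X: "\<And>\<omega>. norm (X \<omega>) \<le> 1" and g: "\<And>a. norm (g a) \<le> 1"
  defines "a \<equiv> \<lambda>n. CLINT \<omega>|M. X \<omega> * indicator {real n} (A \<omega>)"
  shows "(\<lambda>n. a n * g (real n)) sums (CLINT \<omega>|M. X \<omega> * g (A \<omega>))" and "summable (\<lambda>n. norm (a n))"
proof -
  define E where "E n = {\<omega> \<in> space M. A \<omega> = real n}" for n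
  have [measurable]: "E n \<in> sets M" for n
    unfolding E_def by measurable
  have "(\<lambda>n. prob (E n)) sums prob (\<Union>n. E n)"
    by (intro finite_measure_UNION) (auto simp: disjoint_family_on_def E_def)
  then have sE: "summable (\<lambda>n. prob (E n))"
    by (rule sums_summable)
  define f where "f n \<omega> = X \<omega> * indicator {real n} (A \<omega>) * g (real n)" for n \<omega>
  have f_le: "norm (f n \<omega>) \<le> indicator {real n} (A \<omega>)" for n \<omega>
    using mult_mono[OF X[of \<omega>] g[of "real n"]] by (auto simp: f_def norm_mult indicator_def)
  have x_le: "norm (X \<omega> * indicator {real n} (A \<omega>)) \<le> indicator {real n} (A \<omega>)" for n \<omega>
    using X[of \<omega>] by (auto simp: norm_mult indicator_def)
  have ind: "integrable M (\<lambda>\<omega>. indicator {real n} (A \<omega>) :: real)" for n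
    by (rule integrable_const_bound[where B = 1]) (auto simp: indicator_def)
  have ind_E: "(LINT \<omega>|M. indicator {real n} (A \<omega>)) = prob (E n)" for n
  proof -
    have "(LINT \<omega>|M. indicator {real n} (A \<omega>) :: real) = (LINT \<omega>|M. indicator (E n) \<omega>)"
      by (intro Bochner_Integration.integral_cong refl) (auto simp: E_def indicator_def)
    then show ?thesis by simp
  qed
  have [measurable]: "f n \<in> borel_measurable M" for n
    unfolding f_def by measurable
  have int_f: "integrable M (f n)" for n
  proof (rule Bochner_Integration.integrable_bound[OF ind[of n]])
    show "AE \<omega> in M. norm (f n \<omega>) \<le> norm (indicat_real {real n} (A \<omega>))"
      using f_le[of n] by simp
  qed measurable
  have int_x: "integrable M (\<lambda>\<omega>. X \<omega> * indicator {real n} (A \<omega>))" for n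
    using x_le by (intro Bochner_Integration.integrable_bound[OF ind[of n]]) auto
  have le_f: "(LINT \<omega>|M. norm (f n \<omega>)) \<le> prob (E n)" for n
    unfolding ind_E[symmetric] by (intro integral_mono integrable_norm int_f ind f_le)
  have le_x: "norm (a n) \<le> prob (E n)" for n
  proof -
    have "norm (a n) \<le> (LINT \<omega>|M. norm (X \<omega> * indicator {real n} (A \<omega>)))"
      unfolding a_def by (rule integral_norm_bound)
    also have "\<dots> \<le> prob (E n)"
      unfolding ind_E[symmetric] by (intro integral_mono integrable_norm int_x ind x_le)
    finally show ?thesis .
  qed
  show "summable (\<lambda>n. norm (a n))"
    using le_x by (intro summable_comparison_test'[OF sE]) auto
  have ae: "AE \<omega> in M. (\<lambda>n. f n \<omega>) sums (X \<omega> * g (A \<omega>)) \<and> summable (\<lambda>n. norm (f n \<omega>))"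
    using A
  proof eventually_elim
    case (elim \<omega>)
    then obtain k where k: "A \<omega> = real k"
      by (auto elim: Nats_cases)
    have fk: "f n \<omega> = 0" if "n \<notin> {k}" for n
      using that by (simp add: f_def k)
    have "(\<lambda>n. f n \<omega>) sums (\<Sum>n\<in>{k}. f n \<omega>)"
      by (rule sums_finite) (use fk in auto)
    moreover have "summable (\<lambda>n. norm (f n \<omega>))"
      by (rule summable_finite[of "{k}"]) (use fk in auto)
    ultimately show ?case
      by (simp add: f_def k)
  qed
  have sn: "summable (\<lambda>n. LINT \<omega>|M. norm (f n \<omega>))"
    using le_f by (intro summable_comparison_test'[OF sE]) auto
  have "(\<lambda>n. LINT \<omega>|M. f n \<omega>) sums (CLINT \<omega>|M. (\<Sum>n. f n \<omega>))"
    by (rule sums_integral[OF int_f]) (use ae sn in auto)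
  moreover have "(CLINT \<omega>|M. (\<Sum>n. f n \<omega>)) = (CLINT \<omega>|M. X \<omega> * g (A \<omega>))"
    by (rule integral_cong_AE) (use ae in \<open>auto simp: f_def[abs_def] sums_iff\<close>)
  moreover have "(LINT \<omega>|M. f n \<omega>) = a n * g (real n)" for n
    unfolding f_def a_def by (rule integral_mult_left_zero)
  ultimately show "(\<lambda>n. a n * g (real n)) sums (CLINT \<omega>|M. X \<omega> * g (A \<omega>))"
    by simp
qed

section \<open>Riemann sums over a grid of independent increments\<close>

lemma measurable_fst_borel [measurable]: "fst \<in> borel_measurable (borel :: (real \<times> real) measure)"
  by (intro borel_measurable_continuous_onI continuous_intros)

lemma measurable_snd_borel [measurable]: "snd \<in> borel_measurable (borel :: (real \<times> real) measure)"
  by (intro borel_measurable_continuous_onI continuous_intros)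

text \<open>The library states independence for variables of one type; \<open>R\<close> is carried by its first component.\<close>

lemma (in prob_space) expectation_affine_recursion:
  fixes P R :: "'a \<Rightarrow> real \<times> real"
  assumes ind: "indep_var borel P borel R"
  shows "(CLINT \<omega>|M. iexp (z * (snd (P \<omega>) + c powr (- fst (P \<omega>)) * fst (R \<omega>))))
    = (CLINT \<omega>|M. iexp (z * snd (P \<omega>)) * (CLINT \<omega>'|M. iexp (z * c powr (- fst (P \<omega>)) * fst (R \<omega>'))))"
proof -
  have [measurable]: "P \<in> borel_measurable M" "R \<in> borel_measurable M"
    using ind indep_var_rv1 indep_var_rv2 by blast+
  let ?P = "distr M borel P" and ?R = "distr M borel R"
  interpret P: prob_space ?P by (rule prob_space_distr) simp
  interpret R: prob_space ?R by (rule prob_space_distr) simp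
  interpret PR: pair_prob_space ?P ?R ..
  define f where "f = (\<lambda>(p :: real \<times> real, r :: real \<times> real). iexp (z * (snd p + c powr (- fst p) * fst r)))"
  have f [measurable]: "f \<in> borel_measurable (borel \<Otimes>\<^sub>M borel)"
    unfolding f_def by measurable
  have eq: "?P \<Otimes>\<^sub>M ?R = distr M (borel \<Otimes>\<^sub>M borel) (\<lambda>\<omega>. (P \<omega>, R \<omega>))"
    using ind by (simp add: indep_var_distribution_eq)
  have int: "integrable (?P \<Otimes>\<^sub>M ?R) f"
    by (rule PR.P.integrable_const_bound[where B = 1]) (auto simp: f_def split: prod.split)
  have inner: "(CLINT r|?R. f (p, r)) = iexp (z * snd p) * (CLINT \<omega>'|M. iexp (z * c powr (- fst p) * fst (R \<omega>')))" for p
  proof -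
    have "(CLINT r|?R. f (p, r)) = (CLINT \<omega>'|M. f (p, R \<omega>'))"
      by (rule integral_distr) measurable
    also have "\<dots> = (CLINT \<omega>'|M. iexp (z * snd p) * iexp (z * c powr (- fst p) * fst (R \<omega>')))"
      by (simp add: f_def distrib_left exp_add mult.assoc)
    finally show ?thesis
      by simp
  qed
  have "(CLINT \<omega>|M. f (P \<omega>, R \<omega>)) = (CLINT pr|?P \<Otimes>\<^sub>M ?R. f pr)"
    unfolding eq by (rule integral_distr[symmetric]) measurable
  also have "\<dots> = (CLINT p|?P. CLINT r|?R. f (p, r))"
    by (rule PR.integral_fst'[symmetric, OF int])
  also have "\<dots> = (CLINT \<omega>|M. CLINT r|?R. f (P \<omega>, r))"
    by (rule integral_distr) measurable
  finally show ?thesis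
    unfolding inner by (simp add: f_def)
qed

text \<open>\<open>A i\<close> and \<open>B i\<close> model the increments of \<open>N\<close> and
  \<open>L\<close> over steps of length \<open>h\<close>, known through independence and their joint
  characteristic function. \<open>\<kappa>\<close> is the size of the jump of \<open>L\<close> at a
  common jump.\<close>

locale jump_increments = prob_space M for M :: "'a measure" +
  fixes A B :: "nat \<Rightarrow> 'a \<Rightarrow> real" and h c u v w \<kappa> :: real
  assumes params: "h \<ge> 0" "c > 1" "u \<ge> 0" "v \<ge> 0" "w \<ge> 0" "\<kappa> > 0"
    and A_meas [measurable]: "A i \<in> borel_measurable M"
    and B_meas [measurable]: "B i \<in> borel_measurable M"
    and indep: "indep_vars (\<lambda>_. borel) (\<lambda>i \<omega>. (A i \<omega>, B i \<omega>)) {..<n}"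
    and char_AB: "(CLINT \<omega>|M. iexp (\<alpha> * A i \<omega> + \<beta> * B i \<omega>))
      = exp (complex_of_real h * (u * (iexp \<alpha> - 1) + v * (iexp \<beta> - 1) + w * (iexp (\<alpha> + \<beta> * \<kappa>) - 1)))"
begin

text \<open>The marginal characteristic function is that of a Poisson variable of mean
  \<open>h * (u + w)\<close>, so the law is the one constructed by
  \<open>poisson_sum_exists\<close>, which is carried by the closed semigroup of natural
  numbers.\<close>

lemma A_Nats: "AE \<omega> in M. A i \<omega> \<in> \<nat>"
proof -
  obtain \<rho> where \<rho>: "real_distribution \<rho>"
    "\<And>z. char \<rho> z = exp (levy_exponent (\<lambda>_::unit. h * (u + w)) (\<lambda>_. 1) z)"
    "\<And>S. closed S \<Longrightarrow> 0 \<in> S \<Longrightarrow> (\<And>a b. a \<in> S \<Longrightarrow> b \<in> S \<Longrightarrow> a + b \<in> S) \<Longrightarrow>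
      range (\<lambda>_::unit. 1::real) \<subseteq> S \<Longrightarrow> AE y in \<rho>. y \<in> S"
    by (rule poisson_sum_exists[of "\<lambda>_::unit. h * (u + w)" "\<lambda>_. 1"]) (use params in auto)
  have "char (distr M borel (A i)) z = exp (levy_exponent (\<lambda>_::unit. h * (u + w)) (\<lambda>_. 1) z)" for z
    using char_AB[of z i 0]
    by (simp add: levy_exponent_def char_def integral_distr algebra_simps UNIV_unit)
  then have "char (distr M borel (A i)) = char \<rho>"
    by (simp add: fun_eq_iff \<rho>(2))
  then have "distr M borel (A i) = \<rho>"
    by (intro Levy_uniqueness \<rho>(1) real_distribution_distr) simp_all
  moreover have "AE y in \<rho>. y \<in> (\<nat> :: real set)"
    by (rule \<rho>(3)) (auto simp: closed_Nats)
  ultimately have "AE y in distr M borel (A i). y \<in> (\<nat> :: real set)"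
    by (simp only:)
  then show ?thesis
    by (subst (asm) AE_distr_iff) (auto intro: borel_closed[OF closed_Nats, simplified])
qed

text \<open>The same argument with a Poisson sum of jumps 1 and \<open>\<kappa>\<close>, carried by
  the half-line.\<close>

lemma B_nonneg: "AE \<omega> in M. B i \<omega> \<ge> 0"
proof -
  let ?g = "\<lambda>b. if b then h * v else h * w" and ?x = "\<lambda>b. if b then 1 else \<kappa>"
  obtain \<rho> where \<rho>: "real_distribution \<rho>"
    "\<And>z. char \<rho> z = exp (levy_exponent ?g ?x z)"
    "\<And>S. closed S \<Longrightarrow> 0 \<in> S \<Longrightarrow> (\<And>a b. a \<in> S \<Longrightarrow> b \<in> S \<Longrightarrow> a + b \<in> S) \<Longrightarrow>
      range ?x \<subseteq> S \<Longrightarrow> AE y in \<rho>. y \<in> S"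
    by (rule poisson_sum_exists[of ?g ?x]) (use params in auto)
  have "char (distr M borel (B i)) z = exp (levy_exponent ?g ?x z)" for z
    using char_AB[of 0 i z]
    by (simp add: levy_exponent_def char_def integral_distr algebra_simps UNIV_bool)
  then have "char (distr M borel (B i)) = char \<rho>"
    by (simp add: fun_eq_iff \<rho>(2))
  then have "distr M borel (B i) = \<rho>"
    by (intro Levy_uniqueness \<rho>(1) real_distribution_distr) simp_all
  moreover have "AE y in \<rho>. y \<in> {0..}"
    by (rule \<rho>(3)) (use params in auto)
  ultimately have "AE y in distr M borel (B i). y \<in> {0..}"
    by (simp only:)
  then show ?thesis
    by (subst (asm) AE_distr_iff) auto
qed

text \<open>For \<open>\<beta> = z\<close> the exponent in \<open>char_AB\<close> is affine in
  \<open>iexp \<alpha>\<close>, namely \<open>h * (drift z + jump z * iexp \<alpha>)\<close>: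
  \<open>jump\<close> collects the jumps of \<open>N\<close> with their effect on \<open>L\<close>,
  and \<open>drift\<close> the rest.\<close>

definition drift :: "real \<Rightarrow> complex" where
  "drift z = v * (iexp z - 1) - u - w"

definition jump :: "real \<Rightarrow> complex" where
  "jump z = u + w * iexp (z * \<kappa>)"

text \<open>Expanding the joint transform in powers of \<open>iexp \<alpha>\<close> and comparing
  Fourier coefficients gives the expectation of \<open>iexp (z * B i)\<close> on the event
  \<open>A i = j\<close>. These coefficients are then used with a general \<open>g\<close>.\<close>

lemma expectation_step:
  assumes [measurable]: "g \<in> borel_measurable borel" and g: "\<And>a. norm (g a) \<le> 1"
  shows "(\<lambda>j. exp (h * drift z) * ((h * jump z) ^ j /\<^sub>R fact j) * g (real j))
    sums (CLINT \<omega>|M. iexp (z * B i \<omega>) * g (A i \<omega>))"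
proof -
  define a where "a n = (CLINT \<omega>|M. iexp (z * B i \<omega>) * indicator {real n} (A i \<omega>))" for n
  define b where "b n = exp (h * drift z) * ((h * jump z) ^ n /\<^sub>R fact n)" for n
  have *: "(\<lambda>n. a n * g' (real n)) sums (CLINT \<omega>|M. iexp (z * B i \<omega>) * g' (A i \<omega>))"
    and sa: "summable (\<lambda>n. norm (a n))"
    if "g' \<in> borel_measurable borel" "\<And>a. norm (g' a) \<le> 1" for g'
    unfolding a_def using expectation_nat_valued[OF A_meas _ that(1) A_Nats _ that(2), of "\<lambda>\<omega>. iexp (z * B i \<omega>)"]
    by auto
  have sb: "summable (\<lambda>n. norm (b n))"
    unfolding b_def norm_mult by (intro summable_mult summable_norm_exp)
  have "a m - b m = 0" for m
  proof (rule fourier_coefficients_unique)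
    show "summable (\<lambda>n. norm (a n - b n))"
      by (rule summable_comparison_test'[OF summable_add[OF sa[OF assms] sb]])
        (use norm_triangle_ineq4 in auto)
    fix \<alpha>
    have "(\<lambda>n. a n * iexp (\<alpha> * real n)) sums (CLINT \<omega>|M. iexp (z * B i \<omega>) * iexp (\<alpha> * A i \<omega>))"
      by (rule *[of "\<lambda>x. iexp (\<alpha> * x)"]) auto
    moreover have "(CLINT \<omega>|M. iexp (z * B i \<omega>) * iexp (\<alpha> * A i \<omega>)) = exp (h * drift z + h * jump z * iexp \<alpha>)"
    proof -
      have "(CLINT \<omega>|M. iexp (z * B i \<omega>) * iexp (\<alpha> * A i \<omega>)) = (CLINT \<omega>|M. iexp (\<alpha> * A i \<omega> + z * B i \<omega>))"
        by (simp add: distrib_left exp_add mult.commute)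
      also have "\<dots> = exp (h * drift z + h * jump z * iexp \<alpha>)"
        unfolding char_AB by (simp add: drift_def jump_def distrib_left exp_add algebra_simps)
      finally show ?thesis .
    qed
    moreover have "(\<lambda>n. b n * iexp (\<alpha> * real n)) sums exp (h * drift z + h * jump z * iexp \<alpha>)"
    proof -
      have "(\<lambda>n. exp (h * drift z) * ((h * jump z * iexp \<alpha>) ^ n /\<^sub>R fact n))
          sums (exp (h * drift z) * exp (h * jump z * iexp \<alpha>))"
        by (intro sums_mult exp_converges)
      moreover have "exp (h * drift z) * ((h * jump z * iexp \<alpha>) ^ n /\<^sub>R fact n) = b n * iexp (\<alpha> * real n)" for n
        by (simp add: b_def power_mult_distrib mult_ac flip: exp_of_nat_mult)
      ultimately show ?thesis
        by (simp add: exp_add)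
    qed
    ultimately have "(\<lambda>n. a n * iexp (\<alpha> * real n) - b n * iexp (\<alpha> * real n)) sums 0"
      using sums_diff by fastforce
    then show "(\<lambda>n. (a n - b n) * iexp (\<alpha> * real n)) sums 0"
      by (simp add: left_diff_distrib)
  qed
  then have "a = b" by auto
  then show ?thesis
    using *[OF assms] by (simp add: b_def)
qed

text \<open>The starting index \<open>m\<close> is carried along so that what remains after the
  first step is again a sum of this kind, as in \<open>rsum_Suc\<close>.\<close>

definition rsum :: "nat \<Rightarrow> nat \<Rightarrow> 'a \<Rightarrow> real" where
  "rsum m n \<omega> = (\<Sum>i<n. c powr (- (\<Sum>j<i. A (m + j) \<omega>)) * B (m + i) \<omega>)"

lemma rsum_meas [measurable]: "rsum m n \<in> borel_measurable M"
  unfolding rsum_def by measurable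

lemma rsum_Suc: "rsum m (Suc n) \<omega> = B m \<omega> + c powr (- A m \<omega>) * rsum (Suc m) n \<omega>"
proof -
  have "rsum m (Suc n) \<omega> = B m \<omega> + (\<Sum>i<n. c powr (- (\<Sum>j<Suc i. A (m + j) \<omega>)) * B (m + Suc i) \<omega>)"
    unfolding rsum_def using params by (subst sum.lessThan_Suc_shift) simp
  also have "(\<Sum>i<n. c powr (- (\<Sum>j<Suc i. A (m + j) \<omega>)) * B (m + Suc i) \<omega>)
      = (\<Sum>i<n. c powr (- A m \<omega>) * (c powr (- (\<Sum>j<i. A (Suc m + j) \<omega>)) * B (Suc m + i) \<omega>))"
    by (intro sum.cong refl, subst sum.lessThan_Suc_shift)
      (simp add: mult.assoc flip: powr_add)
  finally show ?thesis
    by (simp add: rsum_def sum_distrib_left)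
qed

definition phi :: "nat \<Rightarrow> nat \<Rightarrow> real \<Rightarrow> complex" where
  "phi m n z = (CLINT \<omega>|M. iexp (z * rsum m n \<omega>))"

lemma phi_eq_char: "phi m n = char (distr M borel (rsum m n))"
  by (auto simp: phi_def char_def integral_distr)

lemma norm_phi: "norm (phi m n z) \<le> 1"
  unfolding phi_eq_char
  by (intro real_distribution.cmod_char_le_1 real_distribution_distr) simp

lemma phi_meas [measurable]: "phi m n \<in> borel_measurable borel"
  unfolding phi_eq_char
  by (intro real_distribution.char_measurable real_distribution_distr) simp

text \<open>Conditioning on the first step, which is independent of the block of later ones;
  \<open>expectation_step\<close> expands over the number \<open>j\<close> of jumps of
  \<open>N\<close> in it, each of which divides the argument by \<open>c\<close>.\<close>

lemma phi_Suc_sums: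
  "(\<lambda>j. exp (h * drift z) * ((h * jump z) ^ j /\<^sub>R fact j) * phi (Suc m) n (z * c powr (- real j)))
    sums phi m (Suc n) z"
proof -
  let ?P = "\<lambda>\<omega>. (A m \<omega>, B m \<omega>)"
  define f where "f p = (\<Sum>i<n. c powr (- (\<Sum>j<i. fst (p (Suc m + j)))) * snd (p (Suc m + i)), 0 :: real)"
    for p :: "nat \<Rightarrow> real \<times> real"
  have comp: "(\<lambda>p. p i) \<in> measurable (PiM I (\<lambda>_. borel)) (borel :: (real \<times> real) measure)"
    if "i \<in> I" for i and I :: "nat set"
    using that by (rule measurable_component_singleton)
  have f_meas: "f \<in> borel_measurable (PiM {Suc m..<Suc m + n} (\<lambda>_. borel))"
    unfolding f_def
    by (intro borel_measurable_Pair borel_measurable_sum borel_measurable_times powr_real_measurable borel_measurable_const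
        borel_measurable_uminus measurable_compose[OF comp measurable_fst_borel]
        measurable_compose[OF comp measurable_snd_borel]) auto
  have "indep_var borel ((\<lambda>p. p m) \<circ> (\<lambda>\<omega>. restrict (\<lambda>i. (A i \<omega>, B i \<omega>)) {m}))
      borel (f \<circ> (\<lambda>\<omega>. restrict (\<lambda>i. (A i \<omega>, B i \<omega>)) {Suc m..<Suc m + n}))"
    by (intro indep_var_compose[OF indep_var_restrict[OF indep[of "Suc m + n"]]] f_meas comp) auto
  moreover have "(\<lambda>p. p m) \<circ> (\<lambda>\<omega>. restrict (\<lambda>i. (A i \<omega>, B i \<omega>)) {m}) = ?P"
    by auto
  moreover have "f \<circ> (\<lambda>\<omega>. restrict (\<lambda>i. (A i \<omega>, B i \<omega>)) {Suc m..<Suc m + n}) = (\<lambda>\<omega>. (rsum (Suc m) n \<omega>, 0))"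
    by (auto simp: f_def rsum_def fun_eq_iff intro!: sum.cong arg_cong[where f = "\<lambda>x. c powr - x * _"])
  ultimately have ind: "indep_var borel ?P borel (\<lambda>\<omega>. (rsum (Suc m) n \<omega>, 0 :: real))"
    by simp
  have "phi m (Suc n) z = (CLINT \<omega>|M. iexp (z * B m \<omega>) * phi (Suc m) n (z * c powr (- A m \<omega>)))"
    unfolding phi_def rsum_Suc using expectation_affine_recursion[OF ind, of z c] by simp
  moreover have "(\<lambda>j. exp (h * drift z) * ((h * jump z) ^ j /\<^sub>R fact j) * phi (Suc m) n (z * c powr (- real j)))
    sums (CLINT \<omega>|M. iexp (z * B m \<omega>) * phi (Suc m) n (z * c powr (- A m \<omega>)))"
    by (rule expectation_step[of "\<lambda>a. phi (Suc m) n (z * c powr (- a))"]) (auto simp: norm_phi)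
  ultimately show ?thesis by simp
qed

text \<open>The coefficients of the recursion \<open>phi_Suc_sums\<close> are free of
  \<open>m\<close>, so induction on the number of steps suffices.\<close>

lemma phi_shift: "phi m n z = phi 0 n z"
proof (induction n arbitrary: m z)
  case 0
  then show ?case by (simp add: phi_def rsum_def)
next
  case (Suc n)
  have e: "(\<lambda>j. exp (h * drift z) * ((h * jump z) ^ j /\<^sub>R fact j) * phi 0 n (z * c powr (- real j)))
    sums phi m (Suc n) z" for m
  proof -
    have "phi (Suc m) n y = phi 0 n y" for y
      by (rule Suc.IH)
    with phi_Suc_sums[of z m n] show ?thesis
      by (simp only:)
  qed
  show ?case
    by (rule sums_unique2[OF e e])
qed

text \<open>Error of one Euler step: the second-order remainder of \<open>exp (h * drift z)\<close>,
  its first-order part combined with one jump of \<open>N\<close>, and the tail from two or more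
  jumps. All three are of order \<open>h ^ 2\<close> for small \<open>h\<close>.\<close>

definition step_error :: "real \<Rightarrow> real" where
  "step_error z = norm (exp (h * drift z) - 1 - h * drift z) + norm (exp (h * drift z) - 1) * norm (h * jump z)
     + norm (exp (h * drift z)) * (exp (norm (h * jump z)) - 1 - norm (h * jump z))"

lemma phi_step:
  "norm (phi 0 (Suc n) z - phi 0 n z - h * (drift z * phi 0 n z + jump z * phi 0 n (z / c))) \<le> step_error z"
proof -
  let ?K = "exp (h * drift z)" and ?W = "h * jump z"
  define t where "t j = ?K * (?W ^ j /\<^sub>R fact j) * phi 0 n (z * c powr (- real j))" for j
  have "t sums phi 0 (Suc n) z"
  proof -
    have "phi (Suc 0) n (z * c powr - real j) = phi 0 n (z * c powr - real j)" for j
      by (rule phi_shift)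
    then have "t = (\<lambda>j. ?K * (?W ^ j /\<^sub>R fact j) * phi (Suc 0) n (z * c powr - real j))"
      by (simp add: t_def fun_eq_iff)
    with phi_Suc_sums[of z 0 n] show ?thesis
      by (simp only: of_real_mult[symmetric])
  qed
  then have s: "(\<lambda>j. t (j + 2)) sums (phi 0 (Suc n) z - (t 0 + t 1))"
    using sums_split_initial_segment[of t _ 2] by (simp add: numeral_2_eq_2)
  have "(\<lambda>j. norm ?W ^ j /\<^sub>R fact j) sums exp (norm ?W)"
    by (rule exp_converges)
  then have "(\<lambda>j. norm ?W ^ (j + 2) /\<^sub>R fact (j + 2)) sums (exp (norm ?W) - (1 + norm ?W))"
    using sums_split_initial_segment[of "\<lambda>j. norm ?W ^ j /\<^sub>R fact j" _ 2] by (simp add: numeral_2_eq_2)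
  then have b: "(\<lambda>j. norm ?K * (norm ?W ^ (j + 2) /\<^sub>R fact (j + 2))) sums (norm ?K * (exp (norm ?W) - (1 + norm ?W)))"
    by (rule sums_mult)
  have "norm (t (j + 2)) \<le> norm ?K * (norm ?W ^ (j + 2) /\<^sub>R fact (j + 2))" for j
    using mult_left_mono[OF norm_phi[of 0 n "z * c powr (- real (j + 2))"], of "norm (?K * (?W ^ (j + 2) /\<^sub>R fact (j + 2)))"]
    unfolding t_def by (simp only: norm_mult norm_scaleR norm_power) (simp add: mult_ac)
  then have "norm (\<Sum>j. t (j + 2)) \<le> (\<Sum>j. norm ?K * (norm ?W ^ (j + 2) /\<^sub>R fact (j + 2)))"
    by (intro norm_suminf_le sums_summable[OF b])
  then have tail: "norm (phi 0 (Suc n) z - (t 0 + t 1)) \<le> norm ?K * (exp (norm ?W) - 1 - norm ?W)"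
    using s b by (simp add: sums_iff diff_diff_eq)
  have t0: "t 0 = ?K * phi 0 n z" and t1: "t 1 = ?K * ?W * phi 0 n (z / c)"
    using params by (simp_all add: t_def powr_minus_divide)
  have eq: "phi 0 (Suc n) z - phi 0 n z - h * (drift z * phi 0 n z + jump z * phi 0 n (z / c))
      = (?K - 1 - h * drift z) * phi 0 n z + (?K - 1) * ?W * phi 0 n (z / c) + (phi 0 (Suc n) z - (t 0 + t 1))"
    unfolding t0 t1 by (simp add: algebra_simps)
  have n1: "norm ((?K - 1 - h * drift z) * phi 0 n z) \<le> norm (?K - 1 - h * drift z)"
    using mult_left_mono[OF norm_phi[of 0 n z], of "norm (?K - 1 - h * drift z)"] by (simp add: norm_mult)
  have n2: "norm ((?K - 1) * ?W * phi 0 n (z / c)) \<le> norm (?K - 1) * norm ?W"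
    using mult_left_mono[OF norm_phi[of 0 n "z / c"], of "norm ((?K - 1) * ?W)"] by (simp only: norm_mult mult_1_right) simp
  show ?thesis
    unfolding eq step_error_def
    by (rule order_trans[OF norm_triangle_ineq add_mono[OF order_trans[OF norm_triangle_ineq add_mono[OF n1 n2]] tail]])
qed

lemma AE_rsum_mono: "AE \<omega> in M. mono (\<lambda>n. rsum 0 n \<omega>)"
proof -
  have "AE \<omega> in M. \<forall>i. B i \<omega> \<ge> 0"
    by (subst AE_all_countable) (intro allI B_nonneg)
  then show ?thesis
  proof eventually_elim
    case (elim \<omega>)
    show ?case
      by (rule incseq_SucI) (use elim in \<open>simp add: rsum_def\<close>)
  qed
qed

text \<open>Majorant for the change of \<open>phi\<close> between \<open>a\<close> and
  \<open>b\<close> steps. Truncation at 2 makes it finite without moment assumptions and lets it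
  pass to limits by dominated convergence.\<close>

definition delta :: "nat \<Rightarrow> nat \<Rightarrow> real \<Rightarrow> real" where
  "delta a b z = (LINT \<omega>|M. min 2 (\<bar>z\<bar> * \<bar>rsum 0 b \<omega> - rsum 0 a \<omega>\<bar>))"

text \<open>Riemann sums increase with the number of steps, so the change up to an intermediate
  \<open>n\<close> is dominated by the change over the whole range: one bound serves all steps in
  between.\<close>

lemma norm_phi_diff:
  assumes "a \<le> n" "n \<le> b"
  shows "norm (phi 0 n z - phi 0 a z) \<le> delta a b z"
proof -
  have int: "integrable M (\<lambda>\<omega>. iexp (z * rsum 0 n \<omega>))" for n
    by (rule integrable_const_bound[where B = 1]) auto
  have "phi 0 n z - phi 0 a z = (CLINT \<omega>|M. iexp (z * rsum 0 n \<omega>) - iexp (z * rsum 0 a \<omega>))"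
    unfolding phi_def by (rule Bochner_Integration.integral_diff[symmetric, OF int int])
  also have "norm \<dots> \<le> (LINT \<omega>|M. norm (iexp (z * rsum 0 n \<omega>) - iexp (z * rsum 0 a \<omega>)))"
    by (rule integral_norm_bound)
  also have "\<dots> \<le> delta a b z"
    unfolding delta_def
  proof (rule integral_mono_AE)
    show "integrable M (\<lambda>\<omega>. norm (iexp (z * rsum 0 n \<omega>) - iexp (z * rsum 0 a \<omega>)))"
      by (intro integrable_norm Bochner_Integration.integrable_diff int)
    show "integrable M (\<lambda>\<omega>. min 2 (\<bar>z\<bar> * \<bar>rsum 0 b \<omega> - rsum 0 a \<omega>\<bar>))"
      by (rule integrable_const_bound[where B = 2]) auto
    show "AE \<omega> in M. norm (iexp (z * rsum 0 n \<omega>) - iexp (z * rsum 0 a \<omega>))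
        \<le> min 2 (\<bar>z\<bar> * \<bar>rsum 0 b \<omega> - rsum 0 a \<omega>\<bar>)"
      using AE_rsum_mono
    proof eventually_elim
      case (elim \<omega>)
      have "norm (iexp (z * rsum 0 n \<omega>) - iexp (z * rsum 0 a \<omega>)) \<le> 1 + 1"
        by (rule order_trans[OF norm_triangle_ineq4]) simp
      moreover have "norm (iexp (z * rsum 0 n \<omega>) - iexp (z * rsum 0 a \<omega>)) \<le> \<bar>z * rsum 0 n \<omega> - z * rsum 0 a \<omega>\<bar>"
        by (rule norm_iexp_diff)
      moreover have "\<bar>z * rsum 0 n \<omega> - z * rsum 0 a \<omega>\<bar> = \<bar>z\<bar> * \<bar>rsum 0 n \<omega> - rsum 0 a \<omega>\<bar>"
        by (simp add: abs_mult flip: right_diff_distrib)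
      moreover have "\<bar>z\<bar> * \<bar>rsum 0 n \<omega> - rsum 0 a \<omega>\<bar> \<le> \<bar>z\<bar> * \<bar>rsum 0 b \<omega> - rsum 0 a \<omega>\<bar>"
        using monoD[OF elim assms(1)] monoD[OF elim assms(2)] by (intro mult_left_mono) auto
      ultimately show ?case by simp
    qed
  qed
  finally show ?thesis .
qed

text \<open>A unit of time consists of \<open>m = 1 / h\<close> Euler steps. They telescope;
  freezing the generator term at step \<open>a\<close> costs the \<open>delta\<close> terms, and the
  step errors add up to \<open>m * step_error z\<close>.\<close>

lemma phi_increment:
  assumes hm: "h * real m = 1"
  shows "norm (phi 0 (a + m) z - phi 0 a z - (drift z * phi 0 a z + jump z * phi 0 a (z / c)))
    \<le> real m * step_error z + (norm (drift z) * delta a (a + m) z + norm (jump z) * delta a (a + m) (z / c))"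
proof -
  define G where "G n = drift z * phi 0 n z + jump z * phi 0 n (z / c)" for n
  define D where "D n = phi 0 n z" for n
  define \<epsilon> where "\<epsilon> = norm (drift z) * delta a (a + m) z + norm (jump z) * delta a (a + m) (z / c)"
  have hm': "complex_of_real h * of_nat m = 1"
    using arg_cong[OF hm, of complex_of_real] by simp
  have "(\<Sum>n<m. D (a + Suc n) - D (a + n)) = D (a + m) - D a"
    using sum_lessThan_telescope[of "\<lambda>n. D (a + n)" m] by simp
  moreover have "(\<Sum>n<m. h * G a) = (complex_of_real h * of_nat m) * G a"
    by simp
  then have "(\<Sum>n<m. h * G a) = G a"
    unfolding hm' by simp
  ultimately have "D (a + m) - D a - G a = (\<Sum>n<m. D (a + Suc n) - D (a + n)) - (\<Sum>n<m. h * G a)"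
    by simp
  also have "\<dots> = (\<Sum>n<m. (D (Suc (a + n)) - D (a + n) - h * G (a + n)) + h * (G (a + n) - G a))"
    unfolding sum_subtractf[symmetric] by (intro sum.cong refl) (simp add: algebra_simps)
  also have "norm \<dots> \<le> (\<Sum>n<m. step_error z + h * \<epsilon>)"
  proof (rule order_trans[OF norm_sum sum_mono])
    fix n assume n: "n \<in> {..<m}"
    have "norm (G (a + n) - G a) = norm (drift z * (phi 0 (a + n) z - phi 0 a z) + jump z * (phi 0 (a + n) (z / c) - phi 0 a (z / c)))"
      by (simp add: G_def algebra_simps)
    also have "\<dots> \<le> norm (drift z) * norm (phi 0 (a + n) z - phi 0 a z)
        + norm (jump z) * norm (phi 0 (a + n) (z / c) - phi 0 a (z / c))"
      by (rule order_trans[OF norm_triangle_ineq]) (simp add: norm_mult)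
    also have "\<dots> \<le> \<epsilon>"
      unfolding \<epsilon>_def using n by (intro add_mono mult_left_mono norm_phi_diff) auto
    finally have 1: "norm (h * (G (a + n) - G a)) \<le> h * \<epsilon>"
      using params by (simp add: norm_mult mult_left_mono)
    have 2: "norm (D (Suc (a + n)) - D (a + n) - h * G (a + n)) \<le> step_error z"
      unfolding D_def G_def by (rule phi_step)
    show "norm ((D (Suc (a + n)) - D (a + n) - h * G (a + n)) + h * (G (a + n) - G a)) \<le> step_error z + h * \<epsilon>"
      by (rule order_trans[OF norm_triangle_ineq add_mono[OF 2 1]])
  qed
  also have "\<dots> = real m * step_error z + \<epsilon>"
  proof -
    have "(\<Sum>n<m. step_error z + h * \<epsilon>) = real m * step_error z + (h * real m) * \<epsilon>"
      by (simp add: distrib_left)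
    then show ?thesis
      unfolding hm by simp
  qed
  finally show ?thesis
    by (simp add: D_def G_def \<epsilon>_def)
qed

end

section \<open>From the process to the law of its integral\<close>

lemma integral_jump_measure:
  fixes f :: "real \<times> real \<Rightarrow> complex"
  assumes "c > 0" "u \<ge> 0" "v \<ge> 0" "w \<ge> 0" and [measurable]: "f \<in> borel_measurable borel"
  shows "(CLINT x|jump_measure c u v w k. f x) = u * f (1, 0) + v * f (0, 1) + w * f (1, c powi (- k))"
proof -
  let ?\<nu> = "jump_measure c u v w k"
  define a b d :: "real \<times> real" where "a = (1, 0)" and "b = (0, 1)" and "d = (1, c powi (- k))"
  have "c powi (- k) \<noteq> 0"
    using assms(1) by simp
  then have dist: "a \<noteq> b" "a \<noteq> d" "b \<noteq> d"
    by (auto simp: a_def b_def d_def)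
  have em: "emeasure ?\<nu> A = ennreal u * indicator A a + ennreal v * indicator A b + ennreal w * indicator A d"
    if "A \<in> sets borel" for A
    using emeasure_jump_measure[OF that] by (simp add: a_def b_def d_def)
  have sets [measurable_cong, simp]: "sets ?\<nu> = sets borel"
    by (rule sets_jump_measure)
  have ma: "measure ?\<nu> {a} = u" "measure ?\<nu> {b} = v" "measure ?\<nu> {d} = w"
    using assms dist by (simp_all add: measure_def em)
  have fin: "emeasure ?\<nu> {x} < top" for x
    by (simp add: em ennreal_mult_less_top ennreal_add_less_top indicator_def)
  have int: "integrable ?\<nu> (\<lambda>x. indicat_real {y} x *\<^sub>R f y)" for y
    by (intro integrable_scaleR_left integrable_real_indicator) (simp_all add: fin)
  have lint: "(CLINT x|?\<nu>. indicat_real {y} x *\<^sub>R f y) = measure ?\<nu> {y} *\<^sub>R f y" for y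
  proof -
    have "(CLINT x|?\<nu>. indicat_real {y} x *\<^sub>R f y) = (LINT x|?\<nu>. indicat_real {y} x) *\<^sub>R f y"
      by (rule integral_scaleR_left) (use fin in \<open>auto intro!: integrable_real_indicator\<close>)
    then show ?thesis by simp
  qed
  have "emeasure ?\<nu> (- {a, b, d}) = 0"
    by (subst em) auto
  then have "- {a, b, d} \<in> null_sets ?\<nu>"
    by (intro null_setsI) auto
  from AE_not_in[OF this] have ae: "AE x in ?\<nu>. x \<in> {a, b, d}"
    by simp
  have "(CLINT x|?\<nu>. f x) = (CLINT x|?\<nu>. indicat_real {a} x *\<^sub>R f a + indicat_real {b} x *\<^sub>R f b + indicat_real {d} x *\<^sub>R f d)"
  proof (rule integral_cong_AE)
    show "AE x in ?\<nu>. f x = indicat_real {a} x *\<^sub>R f a + indicat_real {b} x *\<^sub>R f b + indicat_real {d} x *\<^sub>R f d"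
      using ae by eventually_elim (use dist in \<open>auto simp: indicator_def\<close>)
  qed measurable
  also have "\<dots> = u *\<^sub>R f a + v *\<^sub>R f b + w *\<^sub>R f d"
    by (simp add: Bochner_Integration.integral_add int lint ma Bochner_Integration.integrable_add)
  finally show ?thesis
    by (simp add: scaleR_conv_of_real a_def b_def d_def)
qed

text \<open>Floor plus one approximates from strictly above, as a limit from the right
  demands.\<close>

lemma dyadic_approximation:
  fixes t :: real
  assumes "t \<ge> 0"
  shows "filterlim (\<lambda>j. real (Suc (nat \<lfloor>t * 2 ^ j\<rfloor>)) / 2 ^ j) (at_right t) sequentially"
proof -
  define d where "d j = real (Suc (nat \<lfloor>t * 2 ^ j\<rfloor>)) / 2 ^ j" for j
  have d: "d j = (of_int \<lfloor>t * 2 ^ j\<rfloor> + 1) / 2 ^ j" for j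
    using assms by (simp add: d_def)
  have gt: "t < d j" for j
    using floor_correct[of "t * 2 ^ j"] by (simp add: d less_divide_eq)
  have le: "d j \<le> t + (1/2) ^ j" for j
    using floor_correct[of "t * 2 ^ j"] by (simp add: d divide_le_eq distrib_right power_one_over)
  have "(\<lambda>j. t + (1/2) ^ j) \<longlonglongrightarrow> t + 0"
    by (intro tendsto_add tendsto_const LIMSEQ_power_zero) simp
  then have "d \<longlonglongrightarrow> t"
    using le gt by (intro tendsto_sandwich[of "\<lambda>_. t" d sequentially "\<lambda>j. t + (1/2) ^ j"])
      (auto intro!: always_eventually less_imp_le)
  moreover have "d j \<in> {t<..}" "d j \<noteq> t" for j
    using gt[of j] by auto
  ultimately have "filterlim d (at_right t) sequentially"
    by (simp only: filterlim_at eventually_True simp_thms)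
  then show ?thesis
    by (simp only: d_def[abs_def])
qed

locale exp_functional_setup =
  fixes M :: "'a measure" and N L :: "real \<Rightarrow> 'a \<Rightarrow> real" and c u v w :: real and k :: int
    and \<mu> :: "real measure"
  assumes c: "c > 1" and uvw: "u \<ge> 0" "v \<ge> 0" "w \<ge> 0"
    and cpp: "compound_poisson_process M (\<lambda>t \<omega>. (N t \<omega>, L t \<omega>)) (jump_measure c u v w k)"
    and law: "exp_functional_law M c N L \<mu>"
begin

lemma levy: "levy_process M (\<lambda>t \<omega>. (N t \<omega>, L t \<omega>))"
  using cpp by (simp add: compound_poisson_process_def)

sublocale prob_space M
  using levy by (simp add: levy_process_def)

lemma NL_meas: "t \<ge> 0 \<Longrightarrow> (\<lambda>\<omega>. (N t \<omega>, L t \<omega>)) \<in> borel_measurable M"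
  using levy by (simp add: levy_process_def)

lemma N_meas: "t \<ge> 0 \<Longrightarrow> N t \<in> borel_measurable M" and L_meas: "t \<ge> 0 \<Longrightarrow> L t \<in> borel_measurable M"
  using measurable_compose[OF NL_meas measurable_fst_borel] measurable_compose[OF NL_meas measurable_snd_borel]
  by simp_all

lemma char_NL:
  assumes "t \<ge> 0"
  shows "(CLINT \<omega>|M. iexp (\<alpha> * N t \<omega> + \<beta> * L t \<omega>))
    = exp (complex_of_real t * (u * (iexp \<alpha> - 1) + v * (iexp \<beta> - 1) + w * (iexp (\<alpha> + \<beta> * c powi (- k)) - 1)))"
proof -
  have "(CLINT \<omega>|M. iexp ((\<alpha>, \<beta>) \<bullet> (N t \<omega>, L t \<omega>)))
    = exp (complex_of_real t * (CLINT x|jump_measure c u v w k. iexp ((\<alpha>, \<beta>) \<bullet> x) - 1))"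
    using cpp assms unfolding compound_poisson_process_def by blast
  also have "(CLINT x|jump_measure c u v w k. iexp ((\<alpha>, \<beta>) \<bullet> x) - 1)
    = u * (iexp ((\<alpha>, \<beta>) \<bullet> (1, 0)) - 1) + v * (iexp ((\<alpha>, \<beta>) \<bullet> (0, 1)) - 1)
      + w * (iexp ((\<alpha>, \<beta>) \<bullet> (1, c powi (- k))) - 1)"
    using c uvw by (intro integral_jump_measure borel_measurable_continuous_onI continuous_intros) auto
  finally show ?thesis
    by (simp add: inner_Pair)
qed

lemma indep_increments:
  assumes "0 \<le> t 0" "mono t"
  shows "indep_vars (\<lambda>_. borel) (\<lambda>i \<omega>. (N (t (Suc i)) \<omega>, L (t (Suc i)) \<omega>) - (N (t i) \<omega>, L (t i) \<omega>)) {..<n}"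
proof -
  have "\<forall>n (t :: nat \<Rightarrow> real). 0 \<le> t 0 \<longrightarrow> mono t \<longrightarrow>
      indep_vars (\<lambda>_. borel) (\<lambda>i \<omega>. (N (t (Suc i)) \<omega>, L (t (Suc i)) \<omega>) - (N (t i) \<omega>, L (t i) \<omega>)) {..<n}"
    using levy unfolding levy_process_def by (elim conjE)
  from this[rule_format, OF assms] show ?thesis .
qed

lemma stationary_increments:
  assumes "0 \<le> s" "0 \<le> t"
  shows "distr M borel (\<lambda>\<omega>. (N (s + t) \<omega>, L (s + t) \<omega>) - (N s \<omega>, L s \<omega>)) = distr M borel (\<lambda>\<omega>. (N t \<omega>, L t \<omega>))"
proof -
  have "\<forall>s\<ge>0. \<forall>t\<ge>0. distr M borel (\<lambda>\<omega>. (N (s + t) \<omega>, L (s + t) \<omega>) - (N s \<omega>, L s \<omega>))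
      = distr M borel (\<lambda>\<omega>. (N t \<omega>, L t \<omega>))"
    using levy unfolding levy_process_def by (elim conjE)
  from this[rule_format, OF assms] show ?thesis .
qed

lemma AE_cadlag: "AE \<omega> in M. \<forall>t\<ge>0. continuous (at_right t) (\<lambda>s. (N s \<omega>, L s \<omega>)) \<and>
    (t > 0 \<longrightarrow> (\<exists>l. ((\<lambda>s. (N s \<omega>, L s \<omega>)) \<longlongrightarrow> l) (at_left t)))"
  using levy unfolding levy_process_def by (elim conjE)

definition A :: "nat \<Rightarrow> nat \<Rightarrow> 'a \<Rightarrow> real" where
  "A j i \<omega> = N (real (Suc i) / 2 ^ j) \<omega> - N (real i / 2 ^ j) \<omega>"

definition B :: "nat \<Rightarrow> nat \<Rightarrow> 'a \<Rightarrow> real" where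
  "B j i \<omega> = L (real (Suc i) / 2 ^ j) \<omega> - L (real i / 2 ^ j) \<omega>"

lemma increments: "jump_increments M (A j) (B j) (1 / 2 ^ j) c u v w (c powi (- k))"
proof
  show "A j i \<in> borel_measurable M" "B j i \<in> borel_measurable M" for i
    unfolding A_def B_def by (intro borel_measurable_diff N_meas L_meas; simp)+
  show "indep_vars (\<lambda>_. borel) (\<lambda>i \<omega>. (A j i \<omega>, B j i \<omega>)) {..<n}" for n
  proof -
    have "mono (\<lambda>i. real i / 2 ^ j)"
      by (intro monoI divide_right_mono) auto
    with indep_increments[of "\<lambda>i. real i / 2 ^ j" n]
    have "indep_vars (\<lambda>_. borel) (\<lambda>i \<omega>. (N (real (Suc i) / 2 ^ j) \<omega>, L (real (Suc i) / 2 ^ j) \<omega>)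
        - (N (real i / 2 ^ j) \<omega>, L (real i / 2 ^ j) \<omega>)) {..<n}"
      by (simp only: of_nat_0 div_0 order_refl)
    then show ?thesis
      by (simp add: A_def B_def del: of_nat_Suc)
  qed
  show "(CLINT \<omega>|M. iexp (\<alpha> * A j i \<omega> + \<beta> * B j i \<omega>))
      = exp (complex_of_real (1 / 2 ^ j) * (u * (iexp \<alpha> - 1) + v * (iexp \<beta> - 1) + w * (iexp (\<alpha> + \<beta> * c powi (- k)) - 1)))"
    for \<alpha> i \<beta>
  proof -
    let ?s = "real i / 2 ^ j" and ?t = "1 / 2 ^ j :: real"
    let ?Z = "\<lambda>t \<omega>. (N t \<omega>, L t \<omega>)"
    let ?f = "\<lambda>p :: real \<times> real. iexp (\<alpha> * fst p + \<beta> * snd p)"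
    have f_meas: "?f \<in> borel_measurable borel"
      by (intro borel_measurable_continuous_onI continuous_intros)
    have "real (Suc i) / 2 ^ j = ?s + ?t"
      by (simp add: add_divide_distrib)
    then have "(CLINT \<omega>|M. iexp (\<alpha> * A j i \<omega> + \<beta> * B j i \<omega>)) = (CLINT \<omega>|M. ?f (?Z (?s + ?t) \<omega> - ?Z ?s \<omega>))"
      by (simp add: A_def B_def)
    also have "\<dots> = (CLINT p|distr M borel (\<lambda>\<omega>. ?Z (?s + ?t) \<omega> - ?Z ?s \<omega>). ?f p)"
      by (rule integral_distr[symmetric, OF _ f_meas]) (intro borel_measurable_diff NL_meas; simp)
    also have "distr M borel (\<lambda>\<omega>. ?Z (?s + ?t) \<omega> - ?Z ?s \<omega>) = distr M borel (?Z ?t)"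
      by (rule stationary_increments) simp_all
    also have "(CLINT p|distr M borel (?Z ?t). ?f p) = (CLINT \<omega>|M. ?f (?Z ?t \<omega>))"
      by (rule integral_distr[OF _ f_meas]) (intro NL_meas; simp)
    finally show ?thesis
      using char_NL[of ?t \<alpha> \<beta>] by simp
  qed
qed (use c uvw in auto)

lemma N_0: "AE \<omega> in M. N 0 \<omega> = 0"
  using levy by (auto simp: levy_process_def zero_prod_def)

text \<open>An almost sure statement covers countably many increments at once, so the signs are
  first obtained on all dyadic grids; right-continuity extends them to all times.\<close>

lemma AE_paths:
  "AE \<omega> in M. N 0 \<omega> = 0 \<and> (\<forall>t\<ge>0. N t \<omega> \<ge> 0) \<and> (\<forall>s t. 0 \<le> s \<longrightarrow> s \<le> t \<longrightarrow> L s \<omega> \<le> L t \<omega>) \<and>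
     (\<forall>t\<ge>0. continuous (at_right t) (\<lambda>s. L s \<omega>)) \<and> (\<forall>t>0. \<exists>l. ((\<lambda>s. N s \<omega>) \<longlongrightarrow> l) (at_left t))"
proof -
  have "AE \<omega> in M. \<forall>j i. A j i \<omega> \<in> \<nat>" "AE \<omega> in M. \<forall>j i. B j i \<omega> \<ge> 0"
    by (simp_all add: AE_all_countable jump_increments.A_Nats[OF increments] jump_increments.B_nonneg[OF increments])
  then show ?thesis
    using AE_cadlag N_0
  proof eventually_elim
    case (elim \<omega>)
    have cN: "continuous (at_right t) (\<lambda>s. N s \<omega>)" and cL: "continuous (at_right t) (\<lambda>s. L s \<omega>)" if "t \<ge> 0" for t
    proof -
      have *: "continuous (at_right t) (\<lambda>s. (N s \<omega>, L s \<omega>))"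
        using elim(3) that by blast
      show "continuous (at_right t) (\<lambda>s. N s \<omega>)" "continuous (at_right t) (\<lambda>s. L s \<omega>)"
        using continuous_fst[OF *] continuous_snd[OF *] by simp_all
    qed
    have left: "\<exists>l. ((\<lambda>s. N s \<omega>) \<longlongrightarrow> l) (at_left t)" if t: "t > 0" for t
    proof -
      obtain l where "((\<lambda>s. (N s \<omega>, L s \<omega>)) \<longlongrightarrow> l) (at_left t)"
        using elim(3) t less_imp_le[OF t] by blast
      from tendsto_fst[OF this] show ?thesis
        by (intro exI) simp
    qed
    define d where "d j t = real (Suc (nat \<lfloor>t * 2 ^ j\<rfloor>)) / 2 ^ j" for j and t :: real
    have lim: "(\<lambda>j. f (d j t)) \<longlonglongrightarrow> f t" if "continuous (at_right t) f" "t \<ge> 0" for f :: "real \<Rightarrow> real" and t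
      using that filterlim_compose[OF _ dyadic_approximation[OF that(2)], of f "nhds (f t)"]
      by (simp add: continuous_within d_def)
    have N_dyadic: "N (real i / 2 ^ j) \<omega> \<ge> 0" for i j
    proof (induction i)
      case (Suc i)
      have "A j i \<omega> \<in> \<nat>"
        using elim(1) by blast
      then obtain n where "A j i \<omega> = real n"
        by (rule Nats_cases)
      then have "A j i \<omega> \<ge> 0"
        by simp
      with Suc show ?case by (simp add: A_def del: of_nat_Suc)
    qed (simp add: elim(4))
    have L_dyadic: "mono (\<lambda>i. L (real i / 2 ^ j) \<omega>)" for j
      by (rule incseq_SucI) (use elim(2) in \<open>simp add: B_def del: of_nat_Suc\<close>)
    have N_ge: "N t \<omega> \<ge> 0" if "t \<ge> 0" for t
      by (rule tendsto_lowerbound[OF lim[OF cN[OF that] that] always_eventually])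
        (simp_all add: d_def N_dyadic del: of_nat_Suc)
    have L_le: "L s \<omega> \<le> L t \<omega>" if "0 \<le> s" "s \<le> t" for s t
    proof (rule LIMSEQ_le[OF lim[OF cL] lim[OF cL]])
      have "L (d j s) \<omega> \<le> L (d j t) \<omega>" for j
      proof -
        have "nat \<lfloor>s * 2 ^ j\<rfloor> \<le> nat \<lfloor>t * 2 ^ j\<rfloor>"
          using that by (intro nat_mono floor_mono mult_right_mono) auto
        then show ?thesis
          unfolding d_def by (intro monoD[OF L_dyadic]) simp
      qed
      then show "\<exists>N. \<forall>j\<ge>N. L (d j s) \<omega> \<le> L (d j t) \<omega>" by blast
    qed (use that in auto)
    show ?case
      by (intro conjI allI impI elim(4) N_ge L_le cL left)
  qed
qed

abbreviation R :: "nat \<Rightarrow> nat \<Rightarrow> 'a \<Rightarrow> real" where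
  "R j T \<equiv> jump_increments.rsum (A j) (B j) c 0 (T * 2 ^ j)"

lemma AE_rsum_tendsto: "AE \<omega> in M. \<forall>T. (\<lambda>j. R j T \<omega>) \<longlonglongrightarrow> exp_functional c N L (real T) \<omega>"
  using AE_paths
proof eventually_elim
  case (elim \<omega>)
  have eq: "R j T \<omega> = (\<Sum>i<T * 2 ^ j. c powr (- N (real i / 2 ^ j) \<omega>) * (L (real (Suc i) / 2 ^ j) \<omega> - L (real i / 2 ^ j) \<omega>))"
    for j T
  proof -
    have "(\<Sum>i'<i. A j (0 + i') \<omega>) = N (real i / 2 ^ j) \<omega>" for i
      unfolding A_def using elim sum_lessThan_telescope[of "\<lambda>i. N (real i / 2 ^ j) \<omega>" i] by simp
    then show ?thesis
      unfolding jump_increments.rsum_def[OF increments] by (simp add: B_def del: of_nat_Suc)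
  qed
  show ?case
    unfolding eq exp_functional_def
    using elim by (intro allI riemann_sum_tendsto_integral[OF c]) blast+
qed

text \<open>A measurable version of the integral up to the integer time \<open>T\<close>: as a limit
  of measurable Riemann sums it is measurable by construction, and it agrees with
  \<open>exp_functional\<close> almost surely.\<close>

definition XT :: "nat \<Rightarrow> 'a \<Rightarrow> real" where
  "XT T \<omega> = lim (\<lambda>j. R j T \<omega>)"

lemma R_meas [measurable]: "R j T \<in> borel_measurable M"
  by (rule jump_increments.rsum_meas[OF increments])

lemma XT_meas [measurable]: "XT T \<in> borel_measurable M"
  unfolding XT_def by (rule borel_measurable_lim_metric) (rule R_meas)

lemma AE_XT:
  "AE \<omega> in M. \<forall>T. (\<lambda>j. R j T \<omega>) \<longlonglongrightarrow> XT T \<omega> \<and> XT T \<omega> = exp_functional c N L (real T) \<omega>"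
  using AE_rsum_tendsto
proof eventually_elim
  case (elim \<omega>)
  show ?case
  proof
    fix T
    have "XT T \<omega> = exp_functional c N L (real T) \<omega>"
      unfolding XT_def using elim by (intro limI) blast
    with elim show "(\<lambda>j. R j T \<omega>) \<longlonglongrightarrow> XT T \<omega> \<and> XT T \<omega> = exp_functional c N L (real T) \<omega>"
      by simp
  qed
qed

abbreviation "drift \<equiv> jump_increments.drift u v w"
abbreviation "jump \<equiv> jump_increments.jump u w (c powi (- k))"
abbreviation "phi j T \<equiv> jump_increments.phi M (A j) (B j) c 0 (T * 2 ^ j)"
abbreviation "delta j T \<equiv> jump_increments.delta M (A j) (B j) c (T * 2 ^ j) (T * 2 ^ j + 2 ^ j)"
abbreviation "step_error j \<equiv> jump_increments.step_error (1 / 2 ^ j) u v w (c powi (- k))"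

definition phiT :: "nat \<Rightarrow> real \<Rightarrow> complex" where
  "phiT T z = (CLINT \<omega>|M. iexp (z * XT T \<omega>))"

definition deltaT :: "nat \<Rightarrow> real \<Rightarrow> real" where
  "deltaT T z = (LINT \<omega>|M. min 2 (\<bar>z\<bar> * \<bar>XT (Suc T) \<omega> - XT T \<omega>\<bar>))"

lemma phi_tendsto: "(\<lambda>j. phi j T z) \<longlonglongrightarrow> phiT T z"
  unfolding jump_increments.phi_def[OF increments] phiT_def
proof (rule integral_dominated_convergence[where w = "\<lambda>_. 1"])
  show "AE \<omega> in M. (\<lambda>j. iexp (z * R j T \<omega>)) \<longlonglongrightarrow> iexp (z * XT T \<omega>)"
    using AE_XT
  proof eventually_elim
    case (elim \<omega>)
    then have "(\<lambda>j. R j T \<omega>) \<longlonglongrightarrow> XT T \<omega>" by blast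
    then show ?case by (intro tendsto_intros)
  qed
qed auto

lemma delta_tendsto: "(\<lambda>j. delta j T z) \<longlonglongrightarrow> deltaT T z"
proof -
  have "T * 2 ^ j + 2 ^ j = Suc T * 2 ^ j" for j :: nat
    by simp
  then have eq: "delta j T z = (LINT \<omega>|M. min 2 (\<bar>z\<bar> * \<bar>R j (Suc T) \<omega> - R j T \<omega>\<bar>))" for j
    unfolding jump_increments.delta_def[OF increments] by (simp only:)
  show ?thesis
    unfolding eq deltaT_def
  proof (rule integral_dominated_convergence[where w = "\<lambda>_. 2"])
    show "(\<lambda>\<omega>. min 2 (\<bar>z\<bar> * \<bar>R j (Suc T) \<omega> - R j T \<omega>\<bar>)) \<in> borel_measurable M" for j
      by measurable
    show "AE \<omega> in M. (\<lambda>j. min 2 (\<bar>z\<bar> * \<bar>R j (Suc T) \<omega> - R j T \<omega>\<bar>))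
        \<longlonglongrightarrow> min 2 (\<bar>z\<bar> * \<bar>XT (Suc T) \<omega> - XT T \<omega>\<bar>)"
      using AE_XT
    proof eventually_elim
      case (elim \<omega>)
      then have "(\<lambda>j. R j T \<omega>) \<longlonglongrightarrow> XT T \<omega>" "(\<lambda>j. R j (Suc T) \<omega>) \<longlonglongrightarrow> XT (Suc T) \<omega>" by blast+
      then show ?case by (intro tendsto_min tendsto_const tendsto_mult_left tendsto_rabs tendsto_diff)
    qed
  qed auto
qed

text \<open>A unit of time has \<open>n = 2 ^ j\<close> steps, so this is the accumulated error.
  Each of its terms has a limit because \<open>n * (exp (x / n) - 1)\<close> tends to
  \<open>x\<close>.\<close>

lemma step_error_tendsto: "(\<lambda>j. real (2 ^ j) * step_error j z) \<longlonglongrightarrow> 0"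
proof -
  define x y where "x = drift z" and "y = norm (jump z)"
  have seq: "(\<lambda>j. f (2 ^ j)) \<longlonglongrightarrow> l" if "f \<longlonglongrightarrow> l" for f :: "nat \<Rightarrow> 'b::topological_space" and l
    using LIMSEQ_subseq_LIMSEQ[OF that, of "\<lambda>j. 2 ^ j"] by (simp add: strict_mono_def comp_def)
  define F where "F n = norm (of_nat n * (exp (x / of_nat n) - 1) - x)
      + norm (of_nat n * (exp (x / of_nat n) - 1)) * (y / real n)
      + norm (exp (x / of_nat n)) * (real n * (exp (y / real n) - 1) - y)" for n
  have div: "(\<lambda>n. a / of_nat n) \<longlonglongrightarrow> 0" for a :: "'b::{real_normed_field}"
    by (rule tendsto_divide_0[OF tendsto_const tendsto_of_nat])
  have "F \<longlonglongrightarrow> norm (x - x) + norm x * 0 + norm (exp (0::complex)) * (y - y)"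
    unfolding F_def by (intro tendsto_add tendsto_mult tendsto_norm tendsto_diff tendsto_exp_scaled div tendsto_exp tendsto_const)
  then have "(\<lambda>j. F (2 ^ j)) \<longlonglongrightarrow> 0"
    by (intro seq) simp
  moreover have "F (2 ^ j) = real (2 ^ j) * step_error j z" for j
  proof -
    define n :: nat where "n = 2 ^ j"
    have n: "real n > 0" "(1::real) / 2 ^ j = 1 / real n"
      by (simp_all add: n_def)
    have e: "complex_of_real (1 / real n) * x = x / of_nat n" "norm (complex_of_real (1 / real n) * jump z) = y / real n"
      by (simp_all add: y_def norm_mult norm_divide)
    have "norm (of_nat n * (exp (x / of_nat n) - 1) - x) = real n * norm (exp (x / of_nat n) - 1 - x / of_nat n)"
    proof -
      have "of_nat n * (exp (x / of_nat n) - 1) - x = of_nat n * (exp (x / of_nat n) - 1 - x / of_nat n)"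
        using n by (simp add: right_diff_distrib)
      then show ?thesis by (simp add: norm_mult)
    qed
    moreover have "real n * (exp (y / real n) - 1) - y = real n * (exp (y / real n) - 1 - y / real n)"
      using n by (simp add: right_diff_distrib)
    moreover have "step_error j z = norm (exp (x / of_nat n) - 1 - x / of_nat n)
        + norm (exp (x / of_nat n) - 1) * (y / real n)
        + norm (exp (x / of_nat n)) * (exp (y / real n) - 1 - y / real n)"
      unfolding jump_increments.step_error_def[OF increments] unfolding n(2) x_def[symmetric] e ..
    moreover have "norm (of_nat n * (exp (x / of_nat n) - 1)) = real n * norm (exp (x / of_nat n) - 1)"
      by (simp add: norm_mult)
    ultimately have "F n = real n * step_error j z"
      unfolding F_def by (simp only: distrib_left mult_ac)
    then show ?thesis
      by (simp add: n_def)
  qed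
  ultimately show ?thesis by simp
qed

text \<open>The limit of \<open>phi_increment\<close> as the mesh tends to 0, over a fixed unit of
  time.\<close>

lemma phiT_increment:
  "norm (phiT (Suc T) z - phiT T z - (drift z * phiT T z + jump z * phiT T (z / c)))
    \<le> norm (drift z) * deltaT T z + norm (jump z) * deltaT T (z / c)"
proof (rule LIMSEQ_le)
  show "(\<lambda>j. norm (phi j (Suc T) z - phi j T z - (drift z * phi j T z + jump z * phi j T (z / c))))
    \<longlonglongrightarrow> norm (phiT (Suc T) z - phiT T z - (drift z * phiT T z + jump z * phiT T (z / c)))"
    by (intro tendsto_norm tendsto_diff tendsto_add tendsto_mult_left phi_tendsto)
  have "(\<lambda>j. real (2 ^ j) * step_error j z + (norm (drift z) * delta j T z + norm (jump z) * delta j T (z / c)))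
    \<longlonglongrightarrow> 0 + (norm (drift z) * deltaT T z + norm (jump z) * deltaT T (z / c))"
    by (intro tendsto_add tendsto_mult_left delta_tendsto step_error_tendsto)
  then show "(\<lambda>j. real (2 ^ j) * step_error j z + (norm (drift z) * delta j T z + norm (jump z) * delta j T (z / c)))
    \<longlonglongrightarrow> norm (drift z) * deltaT T z + norm (jump z) * deltaT T (z / c)"
    by simp
  have eq: "T * 2 ^ j + 2 ^ j = Suc T * 2 ^ j" for j :: nat
    by simp
  have "norm (jump_increments.phi M (A j) (B j) c 0 (T * 2 ^ j + 2 ^ j) z - phi j T z
      - (drift z * phi j T z + jump z * phi j T (z / c)))
    \<le> real (2 ^ j) * step_error j z + (norm (drift z) * delta j T z + norm (jump z) * delta j T (z / c))" for j
    by (rule jump_increments.phi_increment[OF increments]) simp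
  then show "\<exists>N. \<forall>j\<ge>N. norm (phi j (Suc T) z - phi j T z - (drift z * phi j T z + jump z * phi j T (z / c)))
    \<le> real (2 ^ j) * step_error j z + (norm (drift z) * delta j T z + norm (jump z) * delta j T (z / c))"
    unfolding eq by blast
qed

lemma real_distribution_law: "real_distribution \<mu>"
  using law unfolding exp_functional_law_def by (auto intro: real_distribution_distr)

text \<open>Stationarity in the limit: \<open>phiT (Suc T)\<close> and \<open>phiT T\<close> both
  tend to \<open>char \<mu>\<close> and \<open>deltaT\<close> tends to 0, so in
  \<open>phiT_increment\<close> only the generator term survives and has to vanish.\<close>

lemma char_law_equation: "drift z * char \<mu> z + jump z * char \<mu> (z / c) = 0"
proof -
  obtain X where X [measurable]: "X \<in> borel_measurable M"
    and lim: "AE \<omega> in M. ((\<lambda>t. exp_functional c N L t \<omega>) \<longlongrightarrow> X \<omega>) at_top"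
    and \<mu>: "\<mu> = distr M borel X"
    using law unfolding exp_functional_law_def by blast
  have ae: "AE \<omega> in M. (\<lambda>T. XT T \<omega>) \<longlonglongrightarrow> X \<omega>"
    using AE_XT lim
  proof eventually_elim
    case (elim \<omega>)
    have "(\<lambda>T. exp_functional c N L (real T) \<omega>) \<longlonglongrightarrow> X \<omega>"
      by (rule filterlim_compose[OF elim(2) filterlim_real_sequentially])
    with elim(1) show ?case by simp
  qed
  have phi_lim: "(\<lambda>T. phiT T z) \<longlonglongrightarrow> char \<mu> z" for z
  proof -
    have "(\<lambda>T. CLINT \<omega>|M. iexp (z * XT T \<omega>)) \<longlonglongrightarrow> (CLINT \<omega>|M. iexp (z * X \<omega>))"
    proof (rule integral_dominated_convergence[where w = "\<lambda>_. 1"])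
      show "AE \<omega> in M. (\<lambda>T. iexp (z * XT T \<omega>)) \<longlonglongrightarrow> iexp (z * X \<omega>)"
        using ae by eventually_elim (intro tendsto_intros)
    qed auto
    then show ?thesis
      by (simp add: phiT_def char_def \<mu> integral_distr)
  qed
  have delta_lim: "(\<lambda>T. deltaT T z) \<longlonglongrightarrow> 0" for z
  proof -
    have "(\<lambda>T. LINT \<omega>|M. min 2 (\<bar>z\<bar> * \<bar>XT (Suc T) \<omega> - XT T \<omega>\<bar>)) \<longlonglongrightarrow> (LINT \<omega>|M. 0)"
    proof (rule integral_dominated_convergence[where w = "\<lambda>_. 2"])
      show "AE \<omega> in M. (\<lambda>T. min 2 (\<bar>z\<bar> * \<bar>XT (Suc T) \<omega> - XT T \<omega>\<bar>)) \<longlonglongrightarrow> 0"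
        using ae
      proof eventually_elim
        case (elim \<omega>)
        have "(\<lambda>T. min 2 (\<bar>z\<bar> * \<bar>XT (Suc T) \<omega> - XT T \<omega>\<bar>)) \<longlonglongrightarrow> min 2 (\<bar>z\<bar> * \<bar>X \<omega> - X \<omega>\<bar>)"
          by (intro tendsto_min tendsto_const tendsto_mult_left tendsto_rabs tendsto_diff LIMSEQ_Suc elim)
        then show ?case by simp
      qed
    qed auto
    then show ?thesis by (simp add: deltaT_def)
  qed
  have "norm (char \<mu> z - char \<mu> z - (drift z * char \<mu> z + jump z * char \<mu> (z / c)))
      \<le> norm (drift z) * 0 + norm (jump z) * 0"
  proof (rule LIMSEQ_le)
    show "(\<lambda>T. norm (phiT (Suc T) z - phiT T z - (drift z * phiT T z + jump z * phiT T (z / c))))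
        \<longlonglongrightarrow> norm (char \<mu> z - char \<mu> z - (drift z * char \<mu> z + jump z * char \<mu> (z / c)))"
      by (intro tendsto_norm tendsto_diff tendsto_add tendsto_mult_left phi_lim LIMSEQ_Suc)
    show "(\<lambda>T. norm (drift z) * deltaT T z + norm (jump z) * deltaT T (z / c)) \<longlonglongrightarrow> norm (drift z) * 0 + norm (jump z) * 0"
      by (intro tendsto_add tendsto_mult_left delta_lim)
  qed (use phiT_increment in blast)
  then show ?thesis
    by (simp only: diff_self diff_0 norm_minus_cancel mult_zero_right add_0 norm_le_zero_iff)
qed

lemma char_functional_equation:
  "(u + v + w - v * iexp z) * char \<mu> z = (u + w * iexp (z * c powi (- k))) * char \<mu> (z / c)"
  using char_law_equation[of z]
  unfolding jump_increments.drift_def[OF increments] jump_increments.jump_def[OF increments]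
  by (simp add: algebra_simps)

end

section \<open>The Levy exponent of the stationary law\<close>

lemma has_sum_times_bool:
  fixes f :: "'i \<times> bool \<Rightarrow> 'b::real_normed_vector"
  assumes "((\<lambda>m. f (m, True)) has_sum a) UNIV" "((\<lambda>m. f (m, False)) has_sum b) UNIV"
  shows "(f has_sum a + b) UNIV"
proof -
  have "(f has_sum a) (range (\<lambda>m. (m, True)))"
    using assms(1) by (subst has_sum_reindex) (auto simp: inj_on_def comp_def)
  moreover have "(f has_sum b) (range (\<lambda>m. (m, False)))"
    using assms(2) by (subst has_sum_reindex) (auto simp: inj_on_def comp_def)
  ultimately have "(f has_sum a + b) (range (\<lambda>m. (m, True)) \<union> range (\<lambda>m. (m, False)))"
    by (rule has_sum_Un_disjoint) auto
  moreover have "range (\<lambda>m. (m, True)) \<union> range (\<lambda>m. (m, False)) = (UNIV :: ('i \<times> bool) set)"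
    by (auto simp: image_iff)
  ultimately show ?thesis by simp
qed

lemma has_sum_geometric:
  fixes c :: real
  assumes "c > 1"
  shows "((\<lambda>n. C / c ^ n) has_sum C / (1 - 1 / c)) UNIV"
proof -
  have s: "(\<lambda>n. (1 / c) ^ n) sums (1 / (1 - 1 / c))"
    using assms by (intro geometric_sums) simp
  then have "((\<lambda>n. (1 / c) ^ n) has_sum (1 / (1 - 1 / c))) UNIV"
    using assms by (intro sums_nonneg_imp_has_sum) auto
  from has_sum_cmult_right[OF this, of C] show ?thesis
    by (simp add: power_one_over)
qed

text \<open>Iterating \<open>J\<close> times leaves the factor \<open>\<phi> (z / c ^ J)\<close>,
  which tends to \<open>\<phi> 0 = 1\<close>. First moments shrink by \<open>1 / c ^ n\<close> at
  level \<open>n\<close>, so the combined family is summable in this sense although its total mass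
  need not be finite.\<close>

lemma iterated_levy_exponent:
  fixes G X :: "'m::countable \<Rightarrow> real" and \<phi> :: "real \<Rightarrow> complex"
  assumes c: "c > 1" and sm: "(\<lambda>m. G m * X m) summable_on UNIV"
    and \<phi>: "isCont \<phi> 0" "\<phi> 0 = 1" "\<And>z. \<phi> z = \<phi> (z / c) * exp (levy_exponent G X z)"
  shows "(\<lambda>(n::nat, m). G m * (X m / c ^ n)) summable_on UNIV"
    and "\<phi> z = exp (levy_exponent (\<lambda>(n::nat, m). G m) (\<lambda>(n, m). X m / c ^ n) z)"
proof -
  let ?g = "\<lambda>(n::nat, m). G m" and ?x = "\<lambda>(n::nat, m). X m / c ^ n"
  have abs: "(\<lambda>m. \<bar>G m * X m\<bar>) summable_on UNIV"
    using sm by (simp only: summable_on_iff_abs)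
  have inner: "(\<Sum>\<^sub>\<infinity>m. norm (G m * (X m / c ^ n))) = (\<Sum>\<^sub>\<infinity>m. \<bar>G m * X m\<bar>) / c ^ n" for n
  proof -
    have "(\<Sum>\<^sub>\<infinity>m. norm (G m * (X m / c ^ n))) = (\<Sum>\<^sub>\<infinity>m. \<bar>G m * X m\<bar> * (1 / c ^ n))"
      using c by (intro infsum_cong) (simp add: abs_mult)
    also have "\<dots> = (\<Sum>\<^sub>\<infinity>m. \<bar>G m * X m\<bar>) * (1 / c ^ n)"
      by (rule infsum_cmult_left')
    finally show ?thesis by simp
  qed
  have "(\<lambda>p. norm (case p of (n, m) \<Rightarrow> G m * (X m / c ^ n))) summable_on (UNIV \<times> UNIV)"
    unfolding Infinite_Sum.abs_summable_on_Sigma_iff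
  proof (intro conjI ballI)
    fix n :: nat
    show "(\<lambda>m. norm (case (n, m) of (n, m) \<Rightarrow> G m * (X m / c ^ n))) summable_on UNIV"
      by (rule abs_summable_comparison(1)[OF sm, where C = "1 / c ^ n"]) (use c in \<open>simp add: abs_mult\<close>)
    show "(\<lambda>n. norm (\<Sum>\<^sub>\<infinity>m. norm (case (n, m) of (n, m) \<Rightarrow> G m * (X m / c ^ n)))) summable_on UNIV"
    proof -
      have "norm (\<Sum>\<^sub>\<infinity>m. norm (case (n, m) of (n, m) \<Rightarrow> G m * (X m / c ^ n))) = (\<Sum>\<^sub>\<infinity>m. \<bar>G m * X m\<bar>) / c ^ n"
        for n :: nat
        unfolding prod.case inner
        by (subst real_norm_def, rule abs_of_nonneg) (use c in \<open>auto intro!: divide_nonneg_nonneg infsum_nonneg\<close>)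
      then show ?thesis
        using has_sum_imp_summable[OF has_sum_geometric[OF c]] by (simp only:)
    qed
  qed
  from abs_summable_summable[OF this] show sm': "(\<lambda>(n::nat, m). G m * (X m / c ^ n)) summable_on UNIV"
    by (simp only: UNIV_Times_UNIV)
  then have sm'': "(\<lambda>i. ?g i * ?x i) summable_on UNIV"
    by (simp add: case_prod_unfold)
  have "levy_exponent ?g ?x z = (\<Sum>\<^sub>\<infinity>n. levy_exponent G X (z / c ^ n))"
    unfolding levy_exponent_def
    using infsum_Sigma_banach[of "\<lambda>i. complex_of_real (?g i) * (iexp (z * ?x i) - 1)" UNIV "\<lambda>_. UNIV"]
      levy_exponent_summable(2)[OF sm'', of z]
    by (simp add: case_prod_unfold)
  moreover have "(\<lambda>n. levy_exponent G X (z / c ^ n)) summable_on UNIV"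
    unfolding levy_exponent_def
    using summable_on_Sigma_banach[of "\<lambda>n m. complex_of_real (?g (n, m)) * (iexp (z * ?x (n, m)) - 1)" UNIV "\<lambda>_. UNIV"]
      levy_exponent_summable(2)[OF sm'', of z]
    by (simp add: case_prod_unfold)
  ultimately have "((\<lambda>n. levy_exponent G X (z / c ^ n)) has_sum levy_exponent ?g ?x z) UNIV"
    by simp
  then have "(\<lambda>n. levy_exponent G X (z / c ^ n)) sums levy_exponent ?g ?x z"
    by (rule has_sum_imp_sums)
  then have lim1: "(\<lambda>J. exp (\<Sum>n<J. levy_exponent G X (z / c ^ n))) \<longlonglongrightarrow> exp (levy_exponent ?g ?x z)"
    unfolding sums_def by (rule tendsto_exp)
  have "\<phi> z = \<phi> (z / c ^ J) * exp (\<Sum>n<J. levy_exponent G X (z / c ^ n))" for J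
  proof (induction J)
    case (Suc J)
    then show ?case
      using \<phi>(3)[of "z / c ^ J"] by (simp add: exp_add mult_ac)
  qed simp
  moreover have "(\<lambda>J. z / c ^ J) \<longlonglongrightarrow> 0"
  proof -
    have "(\<lambda>J. z * (1 / c) ^ J) \<longlonglongrightarrow> z * 0"
      using c by (intro tendsto_mult_left LIMSEQ_power_zero) simp
    then show ?thesis by (simp add: power_one_over)
  qed
  then have "(\<lambda>J. \<phi> (z / c ^ J)) \<longlonglongrightarrow> 1"
    using isCont_tendsto_compose[OF \<phi>(1)] \<phi>(2) by fastforce
  from tendsto_mult[OF this lim1]
  have "(\<lambda>J. \<phi> (z / c ^ J) * exp (\<Sum>n<J. levy_exponent G X (z / c ^ n))) \<longlonglongrightarrow> exp (levy_exponent ?g ?x z)"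
    by simp
  ultimately have "(\<lambda>J. \<phi> z) \<longlonglongrightarrow> exp (levy_exponent ?g ?x z)"
    by simp
  then show "\<phi> z = exp (levy_exponent ?g ?x z)"
    by (rule LIMSEQ_unique[OF tendsto_const])
qed

section \<open>Logarithmic series\<close>

lemma log_series_summable:
  fixes t :: real
  assumes "\<bar>t\<bar> < 1"
  shows "(\<lambda>m. \<bar>t\<bar> ^ Suc m) summable_on UNIV"
    "summable (\<lambda>m. \<bar>t\<bar> ^ Suc m)"
proof -
  show "summable (\<lambda>m. \<bar>t\<bar> ^ Suc m)"
    using assms by (simp add: summable_mult summable_geometric)
  then show "(\<lambda>m. \<bar>t\<bar> ^ Suc m) summable_on UNIV"
    by (rule summable_nonneg_imp_summable_on) simp
qed

text \<open>Difference of the series for \<open>- ln (1 - W)\<close> at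
  \<open>W = t * iexp y\<close> and at \<open>W = t\<close>; the latter supplies the
  \<open>- 1\<close> of a Levy exponent. Index \<open>m\<close> stands for order
  \<open>m + 1\<close>.\<close>

lemma log_series_has_sum:
  fixes t y :: real
  assumes t: "\<bar>t\<bar> < 1"
  shows "((\<lambda>m. complex_of_real (t ^ Suc m / real (Suc m)) * (iexp (y * real (Suc m)) - 1))
    has_sum ln (1 - complex_of_real t) - ln (1 - t * iexp y)) UNIV"
proof -
  have ln_sums: "(\<lambda>m. W ^ Suc m / of_nat (Suc m)) sums - ln (1 - W)" if W: "norm W < 1" for W :: complex
  proof -
    have "(\<lambda>n. (- 1) ^ Suc n / of_nat n * (- W) ^ n) sums ln (1 + - W)"
      by (rule Ln_series) (use W in simp)
    then have "(\<lambda>n. - ((- 1) ^ Suc n / of_nat n * (- W) ^ n)) sums - ln (1 - W)"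
      using sums_minus by fastforce
    moreover have "(\<lambda>n. - ((- 1) ^ Suc n / of_nat n * (- W) ^ n)) = (\<lambda>n. W ^ n / of_nat n)"
      by (simp add: fun_eq_iff flip: power_mult_distrib)
    ultimately have "(\<lambda>n. W ^ n / of_nat n) sums - ln (1 - W)"
      by (simp only:)
    then show ?thesis
      by (subst sums_Suc_iff) simp
  qed
  have "(\<lambda>m. (t * iexp y) ^ Suc m / of_nat (Suc m) - complex_of_real t ^ Suc m / of_nat (Suc m))
      sums (- ln (1 - t * iexp y) - - ln (1 - complex_of_real t))"
    using t by (intro sums_diff ln_sums) (auto simp: norm_mult)
  moreover have "(t * iexp y) ^ Suc m / of_nat (Suc m) - complex_of_real t ^ Suc m / of_nat (Suc m)
    = complex_of_real (t ^ Suc m / real (Suc m)) * (iexp (y * real (Suc m)) - 1)" for m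
  proof -
    have "(iexp y) ^ Suc m = iexp (y * real (Suc m))"
      unfolding exp_of_nat_mult[symmetric] by (simp add: mult_ac)
    then show ?thesis
      by (simp only: power_mult_distrib of_real_divide of_real_power of_real_of_nat_eq)
        (simp add: right_diff_distrib del: power_Suc of_nat_Suc)
  qed
  ultimately have "(\<lambda>m. complex_of_real (t ^ Suc m / real (Suc m)) * (iexp (y * real (Suc m)) - 1))
      sums (ln (1 - complex_of_real t) - ln (1 - t * iexp y))"
    by (simp del: power_Suc of_nat_Suc)
  moreover have "summable (\<lambda>m. norm (complex_of_real (t ^ Suc m / real (Suc m)) * (iexp (y * real (Suc m)) - 1)))"
  proof (rule summable_comparison_test'[OF summable_mult[OF log_series_summable(2)[OF t], of 2]])
    fix m
    have "norm (complex_of_real (t ^ Suc m / real (Suc m)) * (iexp (y * real (Suc m)) - 1))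
        \<le> (\<bar>t\<bar> ^ Suc m / real (Suc m)) * 2"
      unfolding norm_mult by (intro mult_mono norm_iexp_minus_1') (simp_all add: norm_divide norm_power norm_mult del: of_nat_Suc)
    also have "\<dots> \<le> \<bar>t\<bar> ^ Suc m * 2"
      by (intro mult_right_mono) (simp_all add: divide_le_eq_1 field_simps)
    finally show "norm (norm (complex_of_real (t ^ Suc m / real (Suc m)) * (iexp (y * real (Suc m)) - 1)))
        \<le> 2 * \<bar>t\<bar> ^ Suc m"
      by (simp del: of_nat_Suc)
  qed
  ultimately show ?thesis
    by (intro norm_summable_imp_has_sum)
qed

lemma exp_log_series:
  fixes t y :: real
  assumes "\<bar>t\<bar> < 1"
  shows "exp (ln (1 - complex_of_real t) - ln (1 - t * iexp y)) = (1 - t) / (1 - t * iexp y)"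
proof -
  have "norm (t * iexp y) < 1" "norm (complex_of_real t) < 1"
    using assms by (auto simp: norm_mult)
  then have "t * iexp y \<noteq> 1" "complex_of_real t \<noteq> 1"
    by auto
  then show ?thesis
    by (simp add: exp_diff)
qed

section \<open>Negative net masses\<close>

text \<open>Supplies arbitrarily large even numbers that are not a natural number times a positive
  power of \<open>c\<close>. Such a coincidence makes \<open>c ^ i\<close> rational, so only
  rational powers of \<open>c\<close> matter, and \<open>d = 1\<close> serves when there are
  none.\<close>

lemma power_not_twice_primitive:
  fixes c :: real
  assumes c: "c > 1" and not2: "\<And>m::nat. m \<ge> 1 \<Longrightarrow> c ^ m \<noteq> 2"
  obtains d :: nat where "d \<ge> 1"
    "\<And>s i m'. i \<ge> 1 \<Longrightarrow> real (2 + 2 * s * d) \<noteq> real m' * c ^ i"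
proof (cases "\<exists>j\<ge>1. c ^ j \<in> \<rat>")
  case False
  have "real (2 + 2 * s * 1) \<noteq> real m' * c ^ i" if "i \<ge> 1" for s i m'
  proof
    assume *: "real (2 + 2 * s * 1) = real m' * c ^ i"
    moreover have "real (2 + 2 * s * 1) > 0"
      by (rule of_nat_0_less_iff[THEN iffD2]) simp
    ultimately have "m' \<noteq> 0"
      by (metis mult_zero_left of_nat_0 less_irrefl)
    with * have "c ^ i = real (2 + 2 * s * 1) / real m'" by (simp add: field_simps)
    then have "c ^ i \<in> \<rat>" by simp
    with False that show False by blast
  qed
  then show ?thesis by (intro that[of 1]) auto
next
  case True
  define j where "j = (LEAST j. j \<ge> 1 \<and> c ^ j \<in> \<rat>)"
  have j: "j \<ge> 1" "c ^ j \<in> \<rat>"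
    using LeastI_ex[of "\<lambda>j. j \<ge> 1 \<and> c ^ j \<in> \<rat>"] True unfolding j_def by blast+
  obtain \<alpha> \<beta> :: nat where ab: "\<beta> \<noteq> 0" "\<bar>c ^ j\<bar> = real \<alpha> / real \<beta>" "coprime \<alpha> \<beta>"
    using Rats_abs_nat_div_natE[OF j(2)] by metis
  have cj: "c ^ j = real \<alpha> / real \<beta>"
    using ab(2) c by simp
  have "c ^ j > 1"
    using c j(1) by (intro one_less_power) auto
  then have "\<alpha> > \<beta>"
    using ab(1) unfolding cj by (simp add: field_simps)
  \<comment> \<open>Since \<open>c ^ j > 1\<close>, a numerator below 3 leaves only
    \<open>c ^ j = 2\<close>, which is excluded.\<close>
  have "\<alpha> \<ge> 3"
  proof (rule ccontr)
    assume "\<not> \<alpha> \<ge> 3"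
    with \<open>\<alpha> > \<beta>\<close> ab(1) have "\<alpha> = 2" "\<beta> = 1" by auto
    with cj not2[OF j(1)] show False by simp
  qed
  have multiple: "j dvd i" if "c ^ i \<in> \<rat>" for i
  proof (rule ccontr)
    assume "\<not> j dvd i"
    then have r: "i mod j \<ge> 1"
      by (simp add: dvd_eq_mod_eq_0)
    have "c ^ i = (c ^ j) ^ (i div j) * c ^ (i mod j)"
      by (simp flip: power_mult power_add)
    then have "c ^ (i mod j) = c ^ i / (c ^ j) ^ (i div j)"
      using c by (simp add: field_simps)
    then have "c ^ (i mod j) \<in> \<rat>"
      using that j(2) by simp
    with r have "j \<le> i mod j"
      unfolding j_def by (intro Least_le) simp
    moreover have "i mod j < j"
      using j(1) by (intro mod_less_divisor) simp
    ultimately show False by simp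
  qed
  \<comment> \<open>With \<open>d = \<alpha>\<close> the numbers are congruent to 2 modulo
    \<open>\<alpha>\<close>, whereas a coincidence would make \<open>\<alpha>\<close> divide them,
    and hence 2.\<close>
  have "real (2 + 2 * s * \<alpha>) \<noteq> real m' * c ^ i" if i: "i \<ge> 1" for s i m'
  proof
    assume *: "real (2 + 2 * s * \<alpha>) = real m' * c ^ i"
    moreover have "real (2 + 2 * s * \<alpha>) > 0"
      by (rule of_nat_0_less_iff[THEN iffD2]) simp
    ultimately have "m' \<noteq> 0"
      by (metis mult_zero_left of_nat_0 less_irrefl)
    with * have "c ^ i = real (2 + 2 * s * \<alpha>) / real m'" by (simp add: field_simps)
    then have "c ^ i \<in> \<rat>" by simp
    then obtain t where t: "i = j * t"
      using multiple by blast
    with i have "t \<ge> 1" by (cases t) auto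
    have "c ^ i = (real \<alpha> / real \<beta>) ^ t"
      unfolding t power_mult cj ..
    with * have "real (2 + 2 * s * \<alpha>) * real \<beta> ^ t = real m' * real \<alpha> ^ t"
      using ab(1) by (simp add: power_divide field_simps)
    then have "real ((2 + 2 * s * \<alpha>) * \<beta> ^ t) = real (m' * \<alpha> ^ t)"
      by (simp only: of_nat_mult of_nat_power)
    then have "(2 + 2 * s * \<alpha>) * \<beta> ^ t = m' * \<alpha> ^ t"
      by (simp only: of_nat_eq_iff)
    then have "\<alpha> ^ t dvd (2 + 2 * s * \<alpha>) * \<beta> ^ t"
      by simp
    moreover have "\<alpha> dvd \<alpha> ^ t"
      using \<open>t \<ge> 1\<close> by simp
    ultimately have "\<alpha> dvd (2 + 2 * s * \<alpha>) * \<beta> ^ t"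
      using dvd_trans by blast
    moreover have "coprime \<alpha> (\<beta> ^ t)"
      using ab(3) by simp
    ultimately have "\<alpha> dvd 2 + 2 * s * \<alpha>"
      using coprime_dvd_mult_left_iff by blast
    then have "\<alpha> dvd 2"
      by (rule dvd_add_left_iff[THEN iffD1, rotated]) simp
    with \<open>\<alpha> \<ge> 3\<close> show False
      using dvd_imp_le[of \<alpha> 2] by simp
  qed
  then show ?thesis
    using \<open>\<alpha> \<ge> 3\<close> by (intro that[of \<alpha>]) auto
qed

text \<open>Raising to the power \<open>l\<close> turns \<open>c ^ i\<close> into
  \<open>2 ^ i\<close>, after which parity decides.\<close>

lemma odd_times_power_of_root_two:
  fixes c :: real and b m i l :: nat
  assumes c: "c ^ l = 2" and l: "l \<ge> 1" and i: "i \<ge> 1"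
  shows "real b * c ^ i = real m \<Longrightarrow> even m"
    and "real b = real m * c ^ i \<Longrightarrow> even b"
proof -
  have e: "even b" if "real a * c ^ i = real b" for a b :: nat
  proof -
    have "real b ^ l = real a ^ l * (c ^ i) ^ l"
      by (simp flip: that add: power_mult_distrib)
    also have "(c ^ i) ^ l = 2 ^ i"
      unfolding c[symmetric] by (simp flip: power_mult add: mult.commute)
    finally have "real (b ^ l) = real (a ^ l * 2 ^ i)"
      by simp
    then have "b ^ l = a ^ l * 2 ^ i"
      by (simp only: of_nat_eq_iff)
    with i have "even (b ^ l)" by simp
    then show ?thesis by simp
  qed
  show "real b * c ^ i = real m \<Longrightarrow> even m" by (rule e)
  show "real b = real m * c ^ i \<Longrightarrow> even b" using e[of m b] by simp
qed

text \<open>At a given site each level \<open>n\<close> of each of the two series contributes at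
  most one atom, so the atoms other than \<open>i0\<close> are dominated by two geometric series in
  \<open>1 / c\<close>.\<close>

lemma net_mass_le:
  fixes g :: "nat \<times> 'm \<times> bool \<Rightarrow> real"
  assumes c: "c > 1" and g: "g summable_on F" and i0: "i0 \<in> F" and C: "C \<ge> 0"
    and inj: "\<And>n m m' b. (n, m, b) \<in> F \<Longrightarrow> (n, m', b) \<in> F \<Longrightarrow> m = m'"
    and le: "\<And>i. i \<in> F \<Longrightarrow> i \<noteq> i0 \<Longrightarrow> g i \<le> C / c ^ fst i"
  shows "infsum g F \<le> g i0 + 2 * (C / (1 - 1 / c))"
proof -
  let ?h = "\<lambda>(n::nat, b::bool). C / c ^ n"
  have h: "(?h has_sum C / (1 - 1 / c) + C / (1 - 1 / c)) UNIV"
    by (rule has_sum_times_bool) (simp_all add: has_sum_geometric[OF c])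
  define \<pi> where "\<pi> = (\<lambda>(n::nat, m::'m, b::bool). (n, b))"
  have inj\<pi>: "inj_on \<pi> F"
    using inj by (auto simp: inj_on_def \<pi>_def)
  have hF: "?h summable_on (\<pi> ` F)"
    by (rule summable_on_subset_banach[OF has_sum_imp_summable[OF h]]) simp
  then have hF': "(\<lambda>i. ?h (\<pi> i)) summable_on F"
    using summable_on_reindex[OF inj\<pi>, of ?h] by (simp add: comp_def)
  have eq: "?h (\<pi> i) = C / c ^ fst i" for i
    by (simp add: \<pi>_def split: prod.split)
  have "infsum (\<lambda>i. ?h (\<pi> i)) F = infsum ?h (\<pi> ` F)"
    using infsum_reindex[OF inj\<pi>, of ?h] by (simp add: comp_def)
  also have "\<dots> \<le> infsum ?h UNIV"
    using C c by (intro infsum_mono2 hF has_sum_imp_summable[OF h]) auto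
  also have "\<dots> = 2 * (C / (1 - 1 / c))"
    using infsumI[OF h] by simp
  finally have tail: "infsum (\<lambda>i. C / c ^ fst i) F \<le> 2 * (C / (1 - 1 / c))"
    unfolding eq .
  have i0_sum: "((\<lambda>i. if i = i0 then g i0 else 0) has_sum g i0) F"
  proof -
    have "((\<lambda>i. if i = i0 then g i0 else 0) has_sum g i0) F
        \<longleftrightarrow> ((\<lambda>i. if i = i0 then g i0 else 0) has_sum g i0) {i0}"
      by (rule has_sum_cong_neutral) (use i0 in auto)
    moreover have "((\<lambda>i. if i = i0 then g i0 else 0) has_sum g i0) {i0}"
      by (rule has_sum_finiteI) simp_all
    ultimately show ?thesis by simp
  qed
  have "infsum g F \<le> g i0 + infsum (\<lambda>i. C / c ^ fst i) F"
  proof (rule has_sum_mono[OF has_sum_infsum[OF g] has_sum_add[OF i0_sum has_sum_infsum]])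
    show "(\<lambda>i. C / c ^ fst i) summable_on F"
      using hF' unfolding eq .
    fix i assume "i \<in> F"
    then show "g i \<le> (if i = i0 then g i0 else 0) + C / c ^ fst i"
      using le[of i] C c by auto
  qed
  with tail show ?thesis by simp
qed

text \<open>\<open>m\<close> encodes order \<open>m + 1\<close>; \<open>True\<close> marks the
  series from the denominator \<open>1 - q * iexp z\<close>, \<open>False\<close> the one from the
  numerator \<open>1 + a * iexp (z * \<kappa>)\<close>.\<close>

definition mass :: "real \<Rightarrow> real \<Rightarrow> nat \<times> bool \<Rightarrow> real" where
  "mass q a = (\<lambda>(m, b). if b then q ^ Suc m / real (Suc m) else - ((- a) ^ Suc m) / real (Suc m))"

definition site :: "real \<Rightarrow> nat \<times> bool \<Rightarrow> real" where
  "site \<kappa> = (\<lambda>(m, b). if b then real (Suc m) else real (Suc m) * \<kappa>)"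

abbreviation "atom_mass q a \<equiv> (\<lambda>(n::nat, i). mass q a i)"
abbreviation "atom_site c \<kappa> \<equiv> (\<lambda>(n::nat, i). site \<kappa> i / c ^ n)"

context
  fixes c q a \<kappa> x0 :: real
  assumes c: "c > 1" and q: "0 \<le> q" "q < 1" and a: "0 < a" "a < 1" and \<kappa>: "\<kappa> > 0" and x0: "x0 > 0"
    and sm: "(\<lambda>i. atom_mass q a i * atom_site c \<kappa> i) summable_on UNIV"
begin

lemma fiber_True: "(n, m, True) \<in> atom_site c \<kappa> -` {x0} \<longleftrightarrow> real (Suc m) = x0 * c ^ n"
  and fiber_False: "(n, m, False) \<in> atom_site c \<kappa> -` {x0} \<longleftrightarrow> real (Suc m) * \<kappa> = x0 * c ^ n"
  using c by (auto simp: site_def field_simps)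

text \<open>At level \<open>n\<close> an atom at \<open>x0\<close> has order
  \<open>x0 * c ^ n\<close> or \<open>x0 * c ^ n / \<kappa>\<close>, so division by the order
  supplies the geometric decay in \<open>n\<close>; the numerators are bounded by \<open>E\<close>
  and \<open>E'\<close>.\<close>

lemma fiber_net_mass_le:
  assumes i0: "i0 \<in> atom_site c \<kappa> -` {x0}"
    and True_le: "\<And>n m. real (Suc m) = x0 * c ^ n \<Longrightarrow> q ^ Suc m \<le> E"
    and False_le: "\<And>n m. real (Suc m) * \<kappa> = x0 * c ^ n \<Longrightarrow> (n, m, False) \<noteq> i0 \<Longrightarrow> - ((- a) ^ Suc m) \<le> E'"
    and E: "0 \<le> E" "0 \<le> E'"
  shows "infsum (atom_mass q a) (atom_site c \<kappa> -` {x0}) \<le> atom_mass q a i0 + 2 * ((E + \<kappa> * E') / x0 / (1 - 1 / c))"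
proof (rule net_mass_le[OF c _ i0])
  show "atom_mass q a summable_on atom_site c \<kappa> -` {x0}"
    using x0 by (intro levy_exponent_fiber_summable[OF _ sm]) simp
  show "(E + \<kappa> * E') / x0 \<ge> 0"
    using E \<kappa> x0 by simp
  show "m = m'" if "(n, m, b) \<in> atom_site c \<kappa> -` {x0}" "(n, m', b) \<in> atom_site c \<kappa> -` {x0}" for n m m' b
  proof (cases b)
    case True
    then show ?thesis
      using that fiber_True[of n m] fiber_True[of n m'] by simp
  next
    case False
    then have "real (Suc m) * \<kappa> = real (Suc m') * \<kappa>"
      using that fiber_False[of n m] fiber_False[of n m'] by simp
    then show ?thesis using \<kappa> by simp
  qed
  fix i assume i: "i \<in> atom_site c \<kappa> -` {x0}" "i \<noteq> i0"
  obtain n m b where nmb: "i = (n, m, b)"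
    by (cases i) auto
  have pos: "x0 * c ^ n > 0"
    using x0 c by simp
  show "atom_mass q a i \<le> (E + \<kappa> * E') / x0 / c ^ fst i"
  proof (cases b)
    case True
    then have m: "real (Suc m) = x0 * c ^ n"
      using i(1) fiber_True nmb by simp
    have "atom_mass q a i = q ^ Suc m / (x0 * c ^ n)"
      unfolding nmb prod.case mass_def using True by (simp only: if_True m)
    also have "\<dots> \<le> (E + \<kappa> * E') / (x0 * c ^ n)"
      using True_le[OF m] pos E \<kappa> by (intro divide_right_mono) (auto intro: add_increasing2)
    finally show ?thesis by (simp add: nmb)
  next
    case False
    then have m: "real (Suc m) * \<kappa> = x0 * c ^ n"
      using i(1) fiber_False nmb by simp
    then have m': "real (Suc m) = x0 * c ^ n / \<kappa>"
      using \<kappa> by (simp add: field_simps)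
    have "atom_mass q a i = - ((- a) ^ Suc m) / (x0 * c ^ n / \<kappa>)"
      unfolding nmb prod.case mass_def using False by (simp only: if_False m')
    also have "\<dots> = \<kappa> * - ((- a) ^ Suc m) / (x0 * c ^ n)"
      by simp
    also have "\<dots> \<le> (E + \<kappa> * E') / (x0 * c ^ n)"
      using False_le[OF m] i(2) False nmb pos E \<kappa>
      by (intro divide_right_mono add_increasing mult_left_mono) auto
    finally show ?thesis by (simp add: nmb)
  qed
qed

end

text \<open>If \<open>c\<^sup>l = 2\<close>, the negative atoms of the second series tend to be covered by its positive atoms.
  At \<open>b c \<kappa>\<close> with \<open>b\<close> odd this fails: the atom of index \<open>b\<close> would belong to the factor \<open>n = -1\<close>,
  and what remains is the index \<open>2 b\<close> of mass \<open>- a\<^sup>2\<^sup>b / (2 b)\<close> against terms of order \<open>q\<^sup>b\<close>.\<close>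

lemma net_mass_negative_root_two:
  fixes c q a :: real and k :: int
  assumes c: "c > 1" and cl: "c ^ l = 2" and q: "0 \<le> q" "q < a\<^sup>2" and a: "0 < a" "a < 1"
    and sm: "(\<lambda>i. atom_mass q a i * atom_site c (c powi (- k)) i) summable_on UNIV"
  obtains x0 where "x0 > 0" "infsum (atom_mass q a) (atom_site c (c powi (- k)) -` {x0}) < 0"
proof -
  define \<kappa> where "\<kappa> = c powi (- k)"
  have \<kappa>: "\<kappa> > 0"
    using c by (simp add: \<kappa>_def)
  have "a\<^sup>2 < 1"
    using a by (simp add: power_less_one_iff)
  then have q1: "q < 1"
    using q by simp
  have l: "l \<ge> 1"
    using cl by (cases l) auto
  \<comment> \<open>Dividing the tail bound by the negative mass, of size
    \<open>(a\<^sup>2) ^ b / (2 * b)\<close>, leaves \<open>K * (q / a\<^sup>2) ^ b\<close>.\<close>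
  define K where "K = 4 / (c * \<kappa> * (1 - 1 / c))"
  have "(\<lambda>n. K * (q / a\<^sup>2) ^ n) \<longlonglongrightarrow> K * 0"
    using q a by (intro tendsto_mult_left LIMSEQ_power_zero) (simp add: field_simps)
  then have "\<forall>\<^sub>F n in sequentially. K * (q / a\<^sup>2) ^ n < 1"
    by (rule order_tendstoD(2)) simp
  then obtain n1 where n1: "\<And>n. n \<ge> n1 \<Longrightarrow> K * (q / a\<^sup>2) ^ n < 1"
    unfolding eventually_sequentially by blast
  define b where "b = 2 * n1 + 1"
  have b: "odd b" "b \<ge> 1" "K * (q / a\<^sup>2) ^ b < 1"
    using n1[of b] by (auto simp: b_def)
  define x0 where "x0 = real b * c * \<kappa>"
  have x0: "x0 > 0"
    using b(2) c \<kappa> by (simp add: x0_def)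
  \<comment> \<open>Level \<open>l - 1\<close> because
    \<open>2 * b * \<kappa> / c ^ (l - 1) = b * c * \<kappa>\<close>; the second entry codes order
    \<open>2 * b\<close>.\<close>
  define i0 :: "nat \<times> nat \<times> bool" where "i0 = (l - 1, 2 * b - 1, False)"
  have Suc_i0: "Suc (2 * b - 1) = 2 * b"
    using b(2) by simp
  note F = fiber_True[OF c q(1) q1 a \<kappa> x0 sm[folded \<kappa>_def]] fiber_False[OF c q(1) q1 a \<kappa> x0 sm[folded \<kappa>_def]]
  have "c ^ l = c * c ^ (l - 1)"
    using l by (simp flip: power_Suc)
  then have i0: "i0 \<in> atom_site c \<kappa> -` {x0}"
    unfolding i0_def by (intro F(2)[THEN iffD2]) (simp only: Suc_i0, use cl in \<open>simp add: x0_def\<close>)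
  have "infsum (atom_mass q a) (atom_site c \<kappa> -` {x0}) \<le> atom_mass q a i0 + 2 * ((q ^ b + \<kappa> * 0) / x0 / (1 - 1 / c))"
  proof (rule fiber_net_mass_le[OF c q(1) q1 a \<kappa> x0 sm[folded \<kappa>_def] i0])
    fix n m
    assume m: "real (Suc m) = x0 * c ^ n"
    \<comment> \<open>The order is \<open>b\<close> times an integer power of \<open>c\<close>. A
      negative exponent would make the odd number \<open>b\<close> a natural number times
      \<open>c ^ i\<close> with \<open>i \<ge> 1\<close>, hence even.\<close>
    have "b \<le> Suc m"
    proof (rule ccontr)
      assume "\<not> b \<le> Suc m"
      then have lt: "real (Suc m) < real b"
        by (simp only: of_nat_less_iff not_le)
      have eq: "real (Suc m) = real b * c powi (1 - k + int n)"
        unfolding m x0_def \<kappa>_def using c by (simp add: power_int_add power_int_diff power_int_minus field_simps)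
      have "1 - k + int n < 0"
      proof (rule ccontr)
        assume "\<not> 1 - k + int n < 0"
        then have "c powi (1 - k + int n) = c ^ nat (1 - k + int n)"
          by (simp add: power_int_def)
        then have "c powi (1 - k + int n) \<ge> 1"
          using c by simp
        then have "real b * 1 \<le> real b * c powi (1 - k + int n)"
          by (intro mult_left_mono) auto
        with lt eq show False by simp
      qed
      then obtain i where i: "1 - k + int n = - int i" "i \<ge> 1"
        by (metis neg_int_cases One_nat_def Suc_leI)
      have "c powi (1 - k + int n) = inverse (c ^ i)"
        unfolding i(1) by (simp add: power_int_minus)
      then have "real b = real (Suc m) * c ^ i"
        unfolding eq using c by simp
      with odd_times_power_of_root_two(2)[OF cl l i(2)] b(1) show False by blast
    qed
    then show "q ^ Suc m \<le> q ^ b"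
      using q q1 by (intro power_decreasing) auto
  next
    fix n m
    assume m: "real (Suc m) * \<kappa> = x0 * c ^ n"
    then have "real b * c ^ Suc n = real (Suc m)"
      using \<kappa> by (simp add: x0_def)
    \<comment> \<open>In the second series the exponent of \<open>c\<close> is always positive, so
      every order at this site is even and the masses are nonpositive; hence the bound 0.\<close>
    then have "even (Suc m)"
      by (rule odd_times_power_of_root_two(1)[OF cl l, rotated]) simp
    then have "(- a) ^ Suc m = a ^ Suc m"
      by (rule power_minus_even)
    then show "- ((- a) ^ Suc m) \<le> 0"
      using a by simp
  qed (use q in auto)
  also have "atom_mass q a i0 = - ((a\<^sup>2) ^ b) / (2 * real b)"
    unfolding i0_def prod.case mass_def if_False Suc_i0 by (simp add: power_mult)
  also have "- ((a\<^sup>2) ^ b) / (2 * real b) + 2 * ((q ^ b + \<kappa> * 0) / x0 / (1 - 1 / c))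
      = (a\<^sup>2) ^ b / (2 * real b) * (K * (q / a\<^sup>2) ^ b - 1)"
    unfolding x0_def K_def using a b(2) c \<kappa> by (simp add: power_divide divide_simps)
  also have "\<dots> < 0"
    using b a by (intro mult_pos_neg) auto
  finally show ?thesis
    using x0 that unfolding \<kappa>_def by blast
qed

text \<open>Here the index \<open>b\<close> is even, large and not of the form \<open>m' c\<^sup>i\<close> with \<open>i \<ge> 1\<close>, so that every other atom
  at the same place has order \<open>q\<^sup>b\<close> or at most \<open>a\<^sup>c\<^sup>b\<close>.\<close>

lemma net_mass_negative_no_root_two:
  fixes c q a :: real and k :: int
  assumes c: "c > 1" and not2: "\<And>m::nat. m \<ge> 1 \<Longrightarrow> c ^ m \<noteq> 2" and q: "0 \<le> q" "q < a" and a: "0 < a" "a < 1"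
    and sm: "(\<lambda>i. atom_mass q a i * atom_site c (c powi (- k)) i) summable_on UNIV"
  obtains x0 where "x0 > 0" "infsum (atom_mass q a) (atom_site c (c powi (- k)) -` {x0}) < 0"
proof -
  define \<kappa> where "\<kappa> = c powi (- k)"
  have \<kappa>: "\<kappa> > 0"
    using c by (simp add: \<kappa>_def)
  have q1: "q < 1"
    using q a by simp
  \<comment> \<open>As \<open>k\<close> may have either sign, the level \<open>n0\<close> is taken
    so deep that \<open>\<kappa> / c ^ n0\<close> becomes \<open>1 / c ^ e\<close> with a natural
    exponent. At \<open>x0\<close> the orders in both series are then \<open>b\<close> times an
    integer power of \<open>c\<close>.\<close>
  define n0 where "n0 = nat \<bar>k\<bar>"
  define e where "e = nat (k + \<bar>k\<bar>)"
  have \<kappa>e: "\<kappa> / c ^ n0 = 1 / c ^ e"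
  proof -
    have "\<kappa> / c ^ n0 = c powi (- k) / c powi int n0"
      by (simp add: \<kappa>_def)
    also have "\<dots> = c powi (- k - int n0)"
      using c by (intro power_int_diff[symmetric]) simp
    also have "- k - int n0 = - int e"
      by (simp add: n0_def e_def)
    finally show ?thesis
      using c by (simp add: power_int_minus divide_inverse)
  qed
  \<comment> \<open>Comes from dividing the tail bound by \<open>a ^ b / b\<close>, the size of the
    negative mass at \<open>i0\<close>.\<close>
  define D where "D = 2 * c ^ n0 / (\<kappa> * (1 - 1 / c))"
  \<comment> \<open>An order of at least \<open>b * c\<close> contributes at most
    \<open>a powr (b * c) = a ^ b * a' ^ b\<close>, which is smaller than \<open>a ^ b\<close> by
    the exponentially small factor \<open>a' ^ b\<close>.\<close>
  define a' where "a' = a powr (c - 1)"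
  have a': "0 \<le> a'" "a' < 1"
    using a c powr_less_mono2[of "c - 1" a 1] by (auto simp: a'_def)
  have "(\<lambda>n. D * (q / a) ^ n + D * \<kappa> * a' ^ n) \<longlonglongrightarrow> D * 0 + D * \<kappa> * 0"
    using q a a' by (intro tendsto_add tendsto_mult_left LIMSEQ_power_zero) (simp_all add: field_simps)
  then have "\<forall>\<^sub>F n in sequentially. D * (q / a) ^ n + D * \<kappa> * a' ^ n < 1"
    by (rule order_tendstoD(2)) simp
  then obtain n1 where n1: "\<And>n. n \<ge> n1 \<Longrightarrow> D * (q / a) ^ n + D * \<kappa> * a' ^ n < 1"
    unfolding eventually_sequentially by blast
  obtain d where d: "d \<ge> 1" "\<And>s i m'. i \<ge> 1 \<Longrightarrow> real (2 + 2 * s * d) \<noteq> real m' * c ^ i"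
    by (rule power_not_twice_primitive[OF c not2]) (assumption | rule that)+
  \<comment> \<open>Even, so that order \<open>b\<close> of the second series has negative mass; at
    least \<open>n1\<close>, for the estimate; and of the form that avoids natural multiples of
    positive powers of \<open>c\<close>.\<close>
  define b where "b = 2 + 2 * n1 * d"
  have prim: "real b \<noteq> real m' * c ^ i" if "i \<ge> 1" for m' i
    unfolding b_def by (rule d(2)[OF that])
  have "n1 * 1 \<le> n1 * d"
    by (rule mult_le_mono2[OF d(1)])
  then have "n1 \<le> b"
    unfolding b_def mult.assoc by linarith
  then have b3: "D * (q / a) ^ b + D * \<kappa> * a' ^ b < 1"
    by (rule n1)
  have b: "even b" "b \<ge> 1"
    by (simp_all add: b_def)
  define x0 where "x0 = real b * \<kappa> / c ^ n0"
  have x0: "x0 > 0"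
    using b(2) c \<kappa> by (simp add: x0_def)
  define i0 :: "nat \<times> nat \<times> bool" where "i0 = (n0, b - 1, False)"
  have Suc_i0: "Suc (b - 1) = b"
    using b(2) by simp
  note F = fiber_True[OF c q(1) q1 a \<kappa> x0 sm[folded \<kappa>_def]] fiber_False[OF c q(1) q1 a \<kappa> x0 sm[folded \<kappa>_def]]
  have i0: "i0 \<in> atom_site c \<kappa> -` {x0}"
    unfolding i0_def by (intro F(2)[THEN iffD2]) (simp only: Suc_i0, use c in \<open>simp add: x0_def\<close>)
  \<comment> \<open>An atom at a level below \<open>j\<close> would exhibit \<open>b\<close> as a
    natural number times a positive power of \<open>c\<close>.\<close>
  have shift: "n \<ge> j \<and> real m' = real b * c ^ (n - j)" if "real m' = real b / c ^ j * c ^ n" for m' n j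
  proof -
    have "n \<ge> j"
    proof (rule ccontr)
      assume "\<not> n \<ge> j"
      then have "j - n \<ge> 1" "c ^ j = c ^ n * c ^ (j - n)"
        by (simp_all flip: power_add)
      with that c have "real b = real m' * c ^ (j - n)"
        by (simp add: field_simps)
      with prim[OF \<open>j - n \<ge> 1\<close>] show False by blast
    qed
    moreover from this have "c ^ n = c ^ j * c ^ (n - j)"
      by (simp flip: power_add)
    ultimately show ?thesis
      using that c by simp
  qed
  have "infsum (atom_mass q a) (atom_site c \<kappa> -` {x0})
      \<le> atom_mass q a i0 + 2 * ((q ^ b + \<kappa> * (a ^ b * a' ^ b)) / x0 / (1 - 1 / c))"
  proof (rule fiber_net_mass_le[OF c q(1) q1 a \<kappa> x0 sm[folded \<kappa>_def] i0])
    fix n m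
    assume "real (Suc m) = x0 * c ^ n"
    also have "x0 = real b / c ^ e"
      using \<kappa>e unfolding x0_def by (metis mult.right_neutral times_divide_eq_right)
    finally have "real (Suc m) = real b * c ^ (n - e)"
      using shift by blast
    moreover have "real b * 1 \<le> real b * c ^ (n - e)"
      using c by (intro mult_left_mono) auto
    ultimately have "real b \<le> real (Suc m)"
      by simp
    then show "q ^ Suc m \<le> q ^ b"
      using q q1 by (intro power_decreasing) (auto simp only: of_nat_le_iff)
  next
    fix n m
    assume m: "real (Suc m) * \<kappa> = x0 * c ^ n" "(n, m, False) \<noteq> i0"
    then have "real (Suc m) * \<kappa> = (real b / c ^ n0 * c ^ n) * \<kappa>"
      by (simp add: x0_def mult_ac del: of_nat_Suc)
    then have "real (Suc m) = real b / c ^ n0 * c ^ n"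
      by (rule mult_right_cancel[THEN iffD1, rotated]) (use \<kappa> in simp)
    then have n: "n \<ge> n0" "real (Suc m) = real b * c ^ (n - n0)"
      using shift by blast+
    have "n \<noteq> n0"
    proof
      assume "n = n0"
      with n(2) have "Suc m = b"
        by (simp del: of_nat_Suc)
      with \<open>n = n0\<close> m(2) show False
        by (auto simp: i0_def)
    qed
    with n(1) have "c ^ 1 \<le> c ^ (n - n0)"
      using c by (intro power_increasing) auto
    then have "real b * c \<le> real (Suc m)"
      unfolding n(2) by (intro mult_left_mono) auto
    then have "a powr real (Suc m) \<le> a powr (real b * c)"
      using a by (intro powr_mono') auto
    also have "real b * c = real b + (c - 1) * real b"
      by (simp add: algebra_simps)
    also have "a powr \<dots> = a ^ b * a' ^ b"
      using a by (simp add: powr_add a'_def powr_realpow powr_powr[symmetric])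
    also have "a powr real (Suc m) = a ^ Suc m"
      using a by (intro powr_realpow) simp
    finally have "a ^ Suc m \<le> a ^ b * a' ^ b" .
    moreover have "- ((- a) ^ Suc m) \<le> \<bar>(- a) ^ Suc m\<bar>"
      by (rule abs_ge_minus_self)
    moreover have "\<bar>(- a) ^ Suc m\<bar> = a ^ Suc m"
      using a by (simp add: power_abs abs_mult)
    ultimately show "- ((- a) ^ Suc m) \<le> a ^ b * a' ^ b"
      by linarith
  qed (use q a a' in auto)
  also have "atom_mass q a i0 = - (a ^ b) / real b"
    unfolding i0_def prod.case mass_def if_False Suc_i0 using b(1) by simp
  also have "- (a ^ b) / real b + 2 * ((q ^ b + \<kappa> * (a ^ b * a' ^ b)) / x0 / (1 - 1 / c))
      = a ^ b / real b * (D * (q / a) ^ b + D * \<kappa> * a' ^ b - 1)"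
  proof -
    define r where "r = 1 - 1 / c"
    have "r > 0" using c by (simp add: r_def)
    then show ?thesis
      unfolding x0_def D_def r_def[symmetric] using a b(2) c \<kappa>
      by (simp add: power_divide field_simps)
  qed
  also have "\<dots> < 0"
    using b b3 a by (intro mult_pos_neg) auto
  finally show ?thesis
    using x0 that unfolding \<kappa>_def by blast
qed

section \<open>Divisibility of the stationary law\<close>

lemma powers_summable_on:
  fixes t :: real
  assumes "\<bar>t\<bar> < 1"
  shows "(\<lambda>m. t ^ Suc m) summable_on UNIV"
  using log_series_summable(1)[OF assms] summable_on_iff_abs[of "\<lambda>m. t ^ Suc m" UNIV]
  by (simp add: power_abs abs_mult)

lemma has_sum_mass_exponent:
  assumes q: "\<bar>q\<bar> < 1" and a: "\<bar>a\<bar> < 1"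
  shows "((\<lambda>i. complex_of_real (mass q a i) * (iexp (z * site \<kappa> i) - 1)) has_sum
    (ln (1 - complex_of_real q) - ln (1 - q * iexp z))
      + - (ln (1 - complex_of_real (- a)) - ln (1 - complex_of_real (- a) * iexp (z * \<kappa>)))) UNIV"
proof (rule has_sum_times_bool)
  show "((\<lambda>m. complex_of_real (mass q a (m, True)) * (iexp (z * site \<kappa> (m, True)) - 1)) has_sum
      ln (1 - complex_of_real q) - ln (1 - q * iexp z)) UNIV"
    using log_series_has_sum[OF q, of z] by (simp add: mass_def site_def del: of_nat_Suc power_Suc)
  have "\<bar>- a\<bar> < 1" using a by simp
  from log_series_has_sum[OF this, of "z * \<kappa>"]
  have "((\<lambda>m. - (complex_of_real ((- a) ^ Suc m / real (Suc m)) * (iexp (z * \<kappa> * real (Suc m)) - 1)))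
      has_sum - (ln (1 - complex_of_real (- a)) - ln (1 - complex_of_real (- a) * iexp (z * \<kappa>)))) UNIV"
    by (subst has_sum_uminus) (simp only: minus_minus)
  moreover have "- (complex_of_real ((- a) ^ Suc m / real (Suc m)) * (iexp (z * \<kappa> * real (Suc m)) - 1))
      = complex_of_real (mass q a (m, False)) * (iexp (z * site \<kappa> (m, False)) - 1)" for m
    by (simp add: mass_def site_def mult_ac del: of_nat_Suc power_Suc)
  ultimately show "((\<lambda>m. complex_of_real (mass q a (m, False)) * (iexp (z * site \<kappa> (m, False)) - 1)) has_sum
      - (ln (1 - complex_of_real (- a)) - ln (1 - complex_of_real (- a) * iexp (z * \<kappa>)))) UNIV"
    by (simp only:)
qed

lemma mass_site_summable:
  assumes q: "\<bar>q\<bar> < 1" and a: "\<bar>a\<bar> < 1"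
  shows "(\<lambda>i. mass q a i * site \<kappa> i) summable_on UNIV"
proof -
  from powers_summable_on[OF q] summable_on_cmult_left[OF powers_summable_on[of "- a"], of "- \<kappa>"] a
  have s: "(\<lambda>m. q ^ Suc m) summable_on UNIV" "(\<lambda>m. (- a) ^ Suc m * - \<kappa>) summable_on UNIV"
    by (simp_all only: abs_minus_cancel)
  have "((\<lambda>i. mass q a i * site \<kappa> i) has_sum
      infsum (\<lambda>m. q ^ Suc m) UNIV + infsum (\<lambda>m. (- a) ^ Suc m * - \<kappa>) UNIV) UNIV"
    by (rule has_sum_times_bool)
      (use has_sum_infsum[OF s(1)] has_sum_infsum[OF s(2)] in \<open>simp_all add: mass_def site_def del: of_nat_Suc power_Suc\<close>)
  then show ?thesis
    by (rule has_sum_imp_summable)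
qed

lemma exp_mass_exponent:
  assumes q: "\<bar>q\<bar> < 1" and a: "\<bar>a\<bar> < 1"
  shows "exp ((ln (1 - complex_of_real q) - ln (1 - q * iexp z))
      + - (ln (1 - complex_of_real (- a)) - ln (1 - complex_of_real (- a) * iexp (z * \<kappa>))))
    = (1 - q) / (1 - q * iexp z) * ((1 + a * iexp (z * \<kappa>)) / (1 + a))"
proof -
  have "\<bar>- a\<bar> < 1" using a by simp
  then show ?thesis
    unfolding exp_add exp_minus exp_log_series[OF q, of z] exp_log_series[OF \<open>\<bar>- a\<bar> < 1\<close>, of "z * \<kappa>"]
    by simp
qed

context exp_functional_setup
begin

context
  fixes q a :: real
  assumes q_eq: "q = v / (u + v + w)" and a_eq: "a = w / u" and uw: "0 < w" "w < u"
begin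

lemma qa_bounds: "0 \<le> q" "q < 1" "0 < a" "a < 1"
  using uvw uw by (auto simp: q_eq a_eq divide_simps)

text \<open>The functional equation with both factors normalized to 1 at \<open>z = 0\<close>; the
  constants match because \<open>u * (1 + a) = (u + v + w) * (1 - q)\<close>.\<close>

lemma char_recursion:
  "char \<mu> z = char \<mu> (z / c) * ((1 - q) / (1 - q * iexp z) * ((1 + a * iexp (z * c powi (- k))) / (1 + a)))"
proof -
  define s where "s = u + v + w"
  have s: "s > 0" using uvw uw by (simp add: s_def)
  have "norm (complex_of_real q * iexp z) < 1"
    using qa_bounds by (simp add: norm_mult)
  then have nz: "1 - complex_of_real q * iexp z \<noteq> 0"
    by auto
  have v: "v = s * q" and w: "w = u * a"
    using s uw by (simp_all add: q_eq a_eq s_def)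
  have u: "u * (1 + a) = s * (1 - q)"
    using v w by (simp add: s_def algebra_simps)
  have u': "complex_of_real u * (1 + a) = s * (1 - q)"
    using arg_cong[OF u, of complex_of_real] by simp
  have a1: "1 + complex_of_real a \<noteq> 0"
    using qa_bounds by (metis add_pos_pos of_real_1 of_real_add of_real_eq_0_iff order_less_irrefl zero_less_one)
  have lhs: "complex_of_real (u + v + w) - v * iexp z = s * (1 - q * iexp z)"
  proof -
    have "complex_of_real (u + v + w) - v * iexp z = complex_of_real s - complex_of_real (s * q) * iexp z"
      unfolding v[symmetric] unfolding s_def ..
    then show ?thesis by (simp add: right_diff_distrib)
  qed
  have rhs: "complex_of_real u + w * iexp (z * c powi (- k)) = u * (1 + a * iexp (z * c powi (- k)))"
    by (simp add: w algebra_simps)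
  have "s * (1 - q * iexp z) * char \<mu> z = u * (1 + a * iexp (z * c powi (- k))) * char \<mu> (z / c)"
    using char_functional_equation[of z] unfolding lhs[symmetric] rhs[symmetric] by simp
  then have "char \<mu> z = u * (1 + a * iexp (z * c powi (- k))) * char \<mu> (z / c) / (s * (1 - q * iexp z))"
    using nz s by (simp add: field_simps)
  also have "complex_of_real u = s * (1 - q) / (1 + a)"
    using u' a1 by (simp add: field_simps)
  finally show ?thesis
    using s by (simp add: mult_ac)
qed

text \<open>Leaves open which atoms \<open>G\<close>, \<open>X\<close> represent the one-step
  exponent: \<open>mass\<close> and \<open>site\<close> in general, merged atoms in the two
  infinitely divisible cases, where merging makes all weights nonnegative.\<close>

lemma char_levy_exponent:
  fixes G X :: "'m::countable \<Rightarrow> real"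
  assumes GX: "(\<lambda>m. G m * X m) summable_on UNIV"
    and exponent: "\<And>z. ((\<lambda>m. complex_of_real (G m) * (iexp (z * X m) - 1)) has_sum
      (ln (1 - complex_of_real q) - ln (1 - q * iexp z))
      + - (ln (1 - complex_of_real (- a)) - ln (1 - complex_of_real (- a) * iexp (z * c powi (- k))))) UNIV"
  shows "(\<lambda>i. (\<lambda>(n::nat, m). G m) i * (\<lambda>(n, m). X m / c ^ n) i) summable_on UNIV"
    and "char \<mu> z = exp (levy_exponent (\<lambda>(n::nat, m). G m) (\<lambda>(n, m). X m / c ^ n) z)"
proof -
  interpret \<mu>: real_distribution \<mu>
    by (rule real_distribution_law)
  have "levy_exponent G X z = (ln (1 - complex_of_real q) - ln (1 - q * iexp z))
      + - (ln (1 - complex_of_real (- a)) - ln (1 - complex_of_real (- a) * iexp (z * c powi (- k))))" for z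
    unfolding levy_exponent_def by (rule infsumI[OF exponent])
  then have rec: "char \<mu> z = char \<mu> (z / c) * exp (levy_exponent G X z)" for z
    using char_recursion[of z] exp_mass_exponent[of q a z "c powi (- k)"] qa_bounds by simp
  note it = iterated_levy_exponent[OF c GX \<mu>.isCont_char \<mu>.char_zero rec]
  show "(\<lambda>i. (\<lambda>(n::nat, m). G m) i * (\<lambda>(n, m). X m / c ^ n) i) summable_on UNIV"
    using it(1) by (simp add: case_prod_unfold)
  show "char \<mu> z = exp (levy_exponent (\<lambda>(n::nat, m). G m) (\<lambda>(n, m). X m / c ^ n) z)"
    by (rule it(2))
qed

lemma atom_summable: "(\<lambda>i. atom_mass q a i * atom_site c (c powi (- k)) i) summable_on UNIV"
  and char_atom: "char \<mu> z = exp (levy_exponent (atom_mass q a) (atom_site c (c powi (- k))) z)"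
  using qa_bounds by (intro char_levy_exponent mass_site_summable has_sum_mass_exponent; simp)+

lemma quasi_infinitely_divisible_law: "quasi_infinitely_divisible \<mu>"
proof (rule quasi_infinitely_divisible_levy_exponent[OF real_distribution_law char_atom _ atom_summable])
  show "atom_site c (c powi (- k)) i \<noteq> 0" for i
    using c by (auto simp: site_def split: prod.split)
qed

lemma not_infinitely_divisible_law:
  assumes "a\<^sup>2 > q \<or> a > q \<and> (\<forall>m::nat. m \<ge> 1 \<longrightarrow> c ^ m \<noteq> 2)"
  shows "\<not> infinitely_divisible \<mu>"
proof
  assume id: "infinitely_divisible \<mu>"
  have nonneg: "infsum (atom_mass q a) (atom_site c (c powi (- k)) -` {x0}) \<ge> 0" if "x0 > 0" for x0
    by (rule infinitely_divisible_net_mass_nonneg[OF id char_atom atom_summable]) (use that in simp)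
  show False
  proof (cases "\<forall>m::nat. m \<ge> 1 \<longrightarrow> c ^ m \<noteq> 2")
    case True
    \<comment> \<open>As \<open>a\<^sup>2 < a\<close>, either alternative of the assumption gives
      \<open>q < a\<close>.\<close>
    have "a * a < a * 1"
      using qa_bounds by (intro mult_strict_left_mono) auto
    then have "a\<^sup>2 < a"
      by (simp add: power2_eq_square)
    with assms have "q < a" by auto
    obtain x0 where "x0 > 0" "infsum (atom_mass q a) (atom_site c (c powi (- k)) -` {x0}) < 0"
      by (rule net_mass_negative_no_root_two[OF c _ qa_bounds(1) \<open>q < a\<close> qa_bounds(3,4) atom_summable])
        (use True in auto)
    with nonneg show False by fastforce
  next
    case False
    then obtain l where l: "c ^ l = 2" by auto
    from False assms have "q < a\<^sup>2" by auto
    obtain x0 where "x0 > 0" "infsum (atom_mass q a) (atom_site c (c powi (- k)) -` {x0}) < 0"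
      by (rule net_mass_negative_root_two[OF c l qa_bounds(1) \<open>q < a\<^sup>2\<close> qa_bounds(3,4) atom_summable]) auto
    with nonneg show False by fastforce
  qed
qed

text \<open>For \<open>k = 0\<close> equal orders of the two series share a site at every level and
  are merged; the merged weight is nonnegative since
  \<open>a ^ Suc m \<le> q ^ Suc m\<close>.\<close>

lemma infinitely_divisible_law_0:
  assumes k: "k = 0" and aq: "a \<le> q"
  shows "infinitely_divisible \<mu>"
proof -
  define G where "G m = q ^ Suc m / real (Suc m) + - ((- a) ^ Suc m) / real (Suc m)" for m
  define X where "X m = real (Suc m)" for m
  have q: "\<bar>q\<bar> < 1" and a: "\<bar>- a\<bar> < 1" using qa_bounds by auto
  have "(\<lambda>m. q ^ Suc m + - ((- a) ^ Suc m)) summable_on UNIV"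
    by (intro summable_on_add powers_summable_on q summable_on_uminus[THEN iffD2] a)
  moreover have "G m * X m = q ^ Suc m + - ((- a) ^ Suc m)" for m
    by (simp add: G_def X_def field_simps del: of_nat_Suc power_Suc)
  ultimately have GX: "(\<lambda>m. G m * X m) summable_on UNIV"
    by simp
  have ex: "((\<lambda>m. complex_of_real (G m) * (iexp (z * X m) - 1)) has_sum
      (ln (1 - complex_of_real q) - ln (1 - q * iexp z))
      + - (ln (1 - complex_of_real (- a)) - ln (1 - complex_of_real (- a) * iexp (z * c powi (- k))))) UNIV" for z
  proof -
    have "((\<lambda>m. complex_of_real (q ^ Suc m / real (Suc m)) * (iexp (z * real (Suc m)) - 1)
        + - (complex_of_real ((- a) ^ Suc m / real (Suc m)) * (iexp (z * real (Suc m)) - 1))) has_sum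
      (ln (1 - complex_of_real q) - ln (1 - q * iexp z))
      + - (ln (1 - complex_of_real (- a)) - ln (1 - complex_of_real (- a) * iexp z))) UNIV"
      using log_series_has_sum[OF q, of z] log_series_has_sum[OF a, of z]
      by (intro has_sum_add) (simp_all only: has_sum_uminus minus_minus)
    moreover have "complex_of_real (G m) * (iexp (z * X m) - 1) = complex_of_real (q ^ Suc m / real (Suc m)) * (iexp (z * real (Suc m)) - 1)
        + - (complex_of_real ((- a) ^ Suc m / real (Suc m)) * (iexp (z * real (Suc m)) - 1))" for m
      by (simp add: G_def X_def algebra_simps del: of_nat_Suc power_Suc)
    ultimately show ?thesis
      by (simp only: k) simp
  qed
  have G: "G m \<ge> 0" for m
  proof -
    have "(- a) ^ Suc m \<le> \<bar>(- a) ^ Suc m\<bar>" by (rule abs_ge_self)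
    also have "\<dots> = a ^ Suc m"
      using qa_bounds by (simp add: power_abs abs_mult)
    also have "\<dots> \<le> q ^ Suc m"
      using aq qa_bounds by (intro power_mono) auto
    finally show ?thesis
      by (simp add: G_def divide_right_mono del: of_nat_Suc power_Suc flip: diff_divide_distrib)
  qed
  show ?thesis
    by (rule infinitely_divisible_levy_exponent[OF real_distribution_law char_levy_exponent(2)[OF GX ex]
          _ char_levy_exponent(1)[OF GX ex]]) (auto simp: G split: prod.split)
qed

text \<open>With \<open>\<kappa> = 1/2\<close> the negative atom of even index \<open>2 m\<close> sits at \<open>m\<close>, where it is absorbed
  by the positive atom of index \<open>m\<close>.\<close>

lemma infinitely_divisible_law_root_two:
  assumes k: "c powi (- k) = 1 / 2" and aq: "a\<^sup>2 \<le> q"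
  shows "infinitely_divisible \<mu>"
proof -
  define G where "G = (\<lambda>(m, b). if b then q ^ Suc m / real (Suc m) + - ((- a) ^ Suc (2 * m + 1)) / real (Suc (2 * m + 1))
      else - ((- a) ^ Suc (2 * m)) / real (Suc (2 * m)))"
  define X where "X = (\<lambda>(m, b). if b then real (Suc m) else real (Suc (2 * m)) / 2)"
  have q: "\<bar>q\<bar> < 1" and a: "\<bar>- a\<bar> < 1" using qa_bounds by auto
  \<comment> \<open>Splits the orders of the second series by parity: \<open>(m, True)\<close> is
    the even order \<open>2 * m + 2\<close>, which meets order \<open>m + 1\<close> of the first
    series, and \<open>(m, False)\<close> is the odd order \<open>2 * m + 1\<close>, whose mass is
    positive.\<close>
  define \<beta> :: "nat \<times> bool \<Rightarrow> nat" where "\<beta> = (\<lambda>(m, b). if b then 2 * m + 1 else 2 * m)"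
  have bij: "bij_betw \<beta> UNIV UNIV"
  proof (rule bij_betwI[where g = "\<lambda>n. (n div 2, odd n)"])
    show "\<beta> (n div 2, odd n) = n" for n
      by (simp add: \<beta>_def)
  qed (auto simp: \<beta>_def split: if_splits)
  have even: "(- a) ^ Suc (2 * m + 1) = (a\<^sup>2) ^ Suc m" and odd: "(- a) ^ Suc (2 * m) = - (a * (a\<^sup>2) ^ m)" for m
    by (simp_all add: power_mult power2_eq_square)
  have GX: "(\<lambda>i. G i * X i) summable_on UNIV"
  proof -
    have "(\<lambda>m. q ^ Suc m) summable_on UNIV"
      using log_series_summable(1)[OF q] qa_bounds by simp
    moreover have a2: "(\<lambda>m. \<bar>- a\<bar> ^ Suc m) summable_on UNIV"
      by (rule log_series_summable(1)[OF a])
    then have "((\<lambda>m. \<bar>- a\<bar> ^ Suc m * (1 / 2)) has_sum infsum (\<lambda>m. \<bar>- a\<bar> ^ Suc m * (1 / 2)) UNIV) UNIV"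
      by (intro has_sum_infsum summable_on_cmult_left)
    then have "((\<lambda>i. \<bar>- a\<bar> ^ Suc (\<beta> i) * (1 / 2)) has_sum infsum (\<lambda>m. \<bar>- a\<bar> ^ Suc m * (1 / 2)) UNIV) UNIV"
      unfolding has_sum_reindex_bij_betw[OF bij, of "\<lambda>m. \<bar>- a\<bar> ^ Suc m * (1 / 2)"] .
    then have sa: "(\<lambda>i. \<bar>- a\<bar> ^ Suc (\<beta> i) * (1 / 2)) summable_on UNIV"
      by (rule has_sum_imp_summable)
    then have "(\<lambda>i. - ((- a) ^ Suc (\<beta> i)) * (1 / 2)) summable_on UNIV"
      by (rule abs_summable_comparison(2)[where C = 1]) (simp add: abs_mult power_abs)
    moreover have "(\<lambda>(m, b). if b then q ^ Suc m else 0) summable_on (UNIV :: (nat \<times> bool) set)"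
    proof -
      have "((\<lambda>(m, b). if b then q ^ Suc m else 0) has_sum infsum (\<lambda>m. q ^ Suc m) UNIV + 0) (UNIV :: (nat \<times> bool) set)"
        by (rule has_sum_times_bool) (use has_sum_infsum[OF \<open>(\<lambda>m. q ^ Suc m) summable_on UNIV\<close>] in simp_all)
      then show ?thesis by (rule has_sum_imp_summable)
    qed
    ultimately have "(\<lambda>i. (\<lambda>(m, b). if b then q ^ Suc m else 0) i + - ((- a) ^ Suc (\<beta> i)) * (1 / 2)) summable_on UNIV"
      by (intro summable_on_add)
    moreover have "(\<lambda>(m, b). if b then q ^ Suc m else 0) i + - ((- a) ^ Suc (\<beta> i)) * (1 / 2) = G i * X i" for i
    proof (cases i)
      case (Pair m b)
      have "real (Suc (2 * m + 1)) = 2 * real (Suc m)" by simp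
      then show ?thesis
        unfolding Pair by (simp add: G_def X_def \<beta>_def divide_simps del: of_nat_Suc power_Suc)
    qed
    ultimately show ?thesis by simp
  qed
  have ex: "((\<lambda>i. complex_of_real (G i) * (iexp (z * X i) - 1)) has_sum
      (ln (1 - complex_of_real q) - ln (1 - q * iexp z))
      + - (ln (1 - complex_of_real (- a)) - ln (1 - complex_of_real (- a) * iexp (z * c powi (- k))))) UNIV" for z
  proof -
    define H where "H n = - (complex_of_real ((- a) ^ Suc n / real (Suc n)) * (iexp (z * (1 / 2) * real (Suc n)) - 1))" for n
    have "(H has_sum - (ln (1 - complex_of_real (- a)) - ln (1 - complex_of_real (- a) * iexp (z * (1 / 2))))) UNIV"
      unfolding H_def using log_series_has_sum[OF a, of "z * (1 / 2)"] by (simp only: has_sum_uminus minus_minus)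
    then have H: "((\<lambda>i. H (\<beta> i)) has_sum - (ln (1 - complex_of_real (- a)) - ln (1 - complex_of_real (- a) * iexp (z * (1 / 2))))) UNIV"
      using has_sum_reindex_bij_betw[OF bij] by blast
    define Q where "Q = (\<lambda>(m, b). if b then complex_of_real (q ^ Suc m / real (Suc m)) * (iexp (z * real (Suc m)) - 1) else 0)"
    have "(Q has_sum (ln (1 - complex_of_real q) - ln (1 - q * iexp z)) + 0) UNIV"
      by (rule has_sum_times_bool) (use log_series_has_sum[OF q, of z] in \<open>simp_all add: Q_def del: of_nat_Suc power_Suc\<close>)
    from has_sum_add[OF this H]
    have "((\<lambda>i. Q i + H (\<beta> i)) has_sum (ln (1 - complex_of_real q) - ln (1 - q * iexp z))
      + - (ln (1 - complex_of_real (- a)) - ln (1 - complex_of_real (- a) * iexp (z * c powi (- k))))) UNIV"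
      unfolding k by (simp only: add_0_right)
    moreover have "Q i + H (\<beta> i) = complex_of_real (G i) * (iexp (z * X i) - 1)" for i
    proof (cases i)
      case (Pair m b)
      have e: "z * (1 / 2) * real (Suc (2 * m + 1)) = z * real (Suc m)" by simp
      have od: "z * (1 / 2) * real (Suc (2 * m)) = z * (real (Suc (2 * m)) / 2)" by simp
      show ?thesis
      proof (cases b)
        case True
        have "H (\<beta> i) = complex_of_real (- ((- a) ^ Suc (2 * m + 1)) / real (Suc (2 * m + 1))) * (iexp (z * real (Suc m)) - 1)"
          unfolding Pair H_def \<beta>_def prod.case if_P[OF True] e by (simp del: of_nat_Suc power_Suc)
        moreover have "Q i = complex_of_real (q ^ Suc m / real (Suc m)) * (iexp (z * real (Suc m)) - 1)"
          unfolding Pair Q_def prod.case if_P[OF True] ..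
        moreover have "G i = q ^ Suc m / real (Suc m) + - ((- a) ^ Suc (2 * m + 1)) / real (Suc (2 * m + 1))" "X i = real (Suc m)"
          unfolding Pair G_def X_def prod.case if_P[OF True] by (rule refl)+
        ultimately show ?thesis
          by (simp only: of_real_add distrib_right)
      next
        case False
        have "H (\<beta> i) = complex_of_real (- ((- a) ^ Suc (2 * m)) / real (Suc (2 * m))) * (iexp (z * (real (Suc (2 * m)) / 2)) - 1)"
          unfolding Pair H_def \<beta>_def prod.case if_not_P[OF False] od by (simp del: of_nat_Suc power_Suc)
        moreover have "Q i = 0"
          unfolding Pair Q_def prod.case if_not_P[OF False] ..
        moreover have "G i = - ((- a) ^ Suc (2 * m)) / real (Suc (2 * m))" "X i = real (Suc (2 * m)) / 2"
          unfolding Pair G_def X_def prod.case if_not_P[OF False] by (rule refl)+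
        ultimately show ?thesis
          by (simp only: add_0)
      qed
    qed
    ultimately show ?thesis
      by (simp only:)
  qed
  have G: "G i \<ge> 0" for i
  proof (cases i)
    case (Pair m b)
    have "(a\<^sup>2) ^ Suc m / real (Suc (2 * m + 1)) \<le> q ^ Suc m / real (Suc m)"
      using aq qa_bounds by (intro frac_le power_mono) auto
    then show ?thesis
      unfolding Pair G_def prod.case even odd using qa_bounds by (simp del: of_nat_Suc power_Suc)
  qed
  show ?thesis
    by (rule infinitely_divisible_levy_exponent[OF real_distribution_law char_levy_exponent(2)[OF GX ex]
          _ char_levy_exponent(1)[OF GX ex]]) (auto simp: G split: prod.split)
qed

end

end

theorem theorem5p5:
  fixes c u v w p q r :: real
    and M :: "int \<Rightarrow> 'a measure"
    and N L :: "int \<Rightarrow> real \<Rightarrow> 'a \<Rightarrow> real"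
    and \<mu> :: "int \<Rightarrow> real measure"
  assumes "c > 1"
    and "p \<ge> 0" "q \<ge> 0" "r \<ge> 0" "p + q + r = 1"
    and "u \<ge> 0" "v \<ge> 0" "w \<ge> 0" "u + v + w > 0"
    and "p = u / (u + v + w)" "q = v / (u + v + w)" "r = w / (u + v + w)"
    and "\<And>k. compound_poisson_process (M k) (\<lambda>t \<omega>. (N k t \<omega>, L k t \<omega>)) (jump_measure c u v w k)"
    and "\<And>k. exp_functional_law (M k) c (N k) (L k) (\<mu> k)"
    and "0 < r" "r < p"
  shows "(\<forall>k. \<mu> k \<in> ID0) \<longleftrightarrow>
    r\<^sup>2 > p\<^sup>2 * q \<or>
    (p\<^sup>2 * q\<^sup>2 < r\<^sup>2 \<and> r\<^sup>2 \<le> p\<^sup>2 * q \<and> (\<forall>m::nat. m \<ge> 1 \<longrightarrow> c ^ m \<noteq> 2))"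
proof -
  define s where "s = u + v + w"
  have s: "s > 0"
    using assms(9) by (simp add: s_def)
  have p: "p > 0"
    using assms(15,16) by simp
  have u: "u = p * s" and w: "w = r * s"
    using s assms(10,12) by (simp_all add: s_def)
  define a where "a = w / u"
  have a_eq: "a = r / p"
    using s by (simp add: a_def u w)
  have uw: "0 < w" "w < u"
    using s assms(15,16) by (simp_all add: u w)
  have hyps: "exp_functional_setup (M k) (N k) (L k) c u v w k (\<mu> k)" for k
    using assms by unfold_locales auto
  note q = \<open>q = v / (u + v + w)\<close>
  have quasi: "quasi_infinitely_divisible (\<mu> k)" for k
    by (rule exp_functional_setup.quasi_infinitely_divisible_law[OF hyps q a_def uw])
  have a_pos: "a > 0"
    using p assms(15) by (simp add: a_eq)
  have sq: "r\<^sup>2 > p\<^sup>2 * q \<longleftrightarrow> a\<^sup>2 > q"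
    using p by (simp add: a_eq power_divide field_simps)
  have "p\<^sup>2 * q\<^sup>2 < r\<^sup>2 \<longleftrightarrow> (p * q)\<^sup>2 < r\<^sup>2"
    by (simp add: power_mult_distrib)
  also have "\<dots> \<longleftrightarrow> p * q < r"
    using assms(2-4) power2_less_imp_less[of "p * q" r] power_strict_mono[of "p * q" r 2] by auto
  also have "\<dots> \<longleftrightarrow> q < a"
    using p by (simp add: a_eq field_simps)
  finally have lin: "p\<^sup>2 * q\<^sup>2 < r\<^sup>2 \<longleftrightarrow> q < a" .
  have "(\<forall>k. \<not> infinitely_divisible (\<mu> k)) \<longleftrightarrow> a\<^sup>2 > q \<or> a > q \<and> (\<forall>m::nat. m \<ge> 1 \<longrightarrow> c ^ m \<noteq> 2)"
    (is "?L \<longleftrightarrow> ?R")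
  proof
    assume ?R
    then show ?L
      using exp_functional_setup.not_infinitely_divisible_law[OF hyps q a_def uw] by blast
  next
    assume L: ?L
    show ?R
    proof (rule ccontr)
      assume nR: "\<not> ?R"
      then have aq: "a\<^sup>2 \<le> q"
        by auto
      show False
      proof (cases "a \<le> q")
        case True
        have "infinitely_divisible (\<mu> 0)"
          by (rule exp_functional_setup.infinitely_divisible_law_0[OF hyps q a_def uw refl True])
        with L show False by blast
      next
        case False
        with nR obtain l :: nat where l: "c ^ l = 2"
          by auto
        have "c powi (- int l) = 1 / 2"
          by (simp add: power_int_minus l)
        then have "infinitely_divisible (\<mu> (int l))"
          by (rule exp_functional_setup.infinitely_divisible_law_root_two[OF hyps q a_def uw _ aq])
        with L show False by blast
      qed
    qed
  qed
  moreover have "(\<forall>k. \<mu> k \<in> ID0) \<longleftrightarrow> (\<forall>k. \<not> infinitely_divisible (\<mu> k))"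
    by (simp add: ID0_def quasi)
  ultimately show ?thesis
    unfolding sq lin not_less[symmetric] by blast
qed

end
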